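(* Let $x: M \hookrightarrow \mathbb{P}^5$ be a nondegenerate immersed Legendrian surface. Let $\tilde{x}: M \hookrightarrow \Lambda$ be the associated lift to the bundle $\Lambda$ of Legendrian $2$-planes, and let $\tilde{x}^*\mathrm{Sp}_3(\mathbb{C}) \to M$ be the pulled back bundle of symplectic frames. Then $\tilde{x}^*\mathrm{Sp}_3(\mathbb{C})$ admits a reduction to a sub-bundle with $1$-dimensional fibers on which the induced Maurer-Cartan form $\phi=\begin{pmatrix}\omega&\eta\\ \theta&-\omega^t\end{pmatrix}$ (with $\omega^i=\omega_{i0}$, $i=1,2$) satisfies, for suitable functions $a_1,a_2,a_3,a_4,b_1,b_2,b_3,c_1,c_2$, $$\theta_{00}=\theta_{10}=\theta_{20}=0,\quad \theta_{11}=\omega^2,\quad \theta_{12}=\omega^1+\omega^2,\quad \theta_{22}=\omega^1,\qquad \omega_{ij}=\tfrac{\delta_{ij}}{3}\,\omega_{00}\ (i,j=1,2),$$ $$\omega_{01}=(a_2+a_4)\,\omega^1+\tfrac35(a_3-a_2)\,\omega^2,\qquad \omega_{02}=\tfrac35(a_2-a_3)\,\omega^1+(a_1+a_3)\,\omega^2,$$ $$\eta_{11}=a_1\omega^2,\quad \eta_{12}=a_2\omega^1+a_3\omega^2,\quad \eta_{22}=a_4\omega^1,$$ $$\eta_{10}=b_1\omega^1+b_2\omega^2,\quad \eta_{20}=b_3\omega^1-b_1\omega^2,\quad \eta_{00}=c_1\omega^1+c_2\omega^2 .$$ Moreover, writing $da_i=-\tfrac43a_i\omega_{00}+a_{ik}\omega^k$,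 $db_i=-2b_i\omega_{00}+b_{ik}\omega^k$, $dc_i=-\tfrac83c_i\omega_{00}+c_{ik}\omega^k$ (sum over $k=1,2$), the following relations hold: $$a_{11}=-2b_2,\qquad a_{22}=-\tfrac32a_{21}+\tfrac{15}{2}b_3+8b_1,\qquad a_{31}=-\tfrac32a_{21}+\tfrac{15}{2}b_3+10b_1,$$ $$a_{32}=a_{21}+5b_2-12b_1-5b_3,\qquad a_{42}=-2b_3,$$ $$b_{12}=b_{21}-\tfrac35a_3^2+c_2+a_4a_1-\tfrac25a_2a_3,\qquad b_{32}=-b_{11}-c_1+\tfrac35a_2^2+\tfrac25a_2a_3-a_4a_1,$$ $$c_{12}=c_{21}-2a_1b_3-2a_3b_3+2a_2b_2+2a_4b_2 .$$
   Context: Everything is holomorphic and local. $V=\mathbb{C}^6$ with its standard symplectic form $\varpi$; $\mathbb{P}^5=\mathbb{P}(V)$ carries the contact hyperplane field $\mathcal{H}_{x}=[(\hat{x}\lrcorner\varpi)^{\perp}]$, where $\hat{x}\in V$ is any lift of $x$. An immersed Legendrian surface is an immersion $x:M\hookrightarrow\mathbb{P}^5$ of a complex surface that is tangent to $\mathcal{H}$. $\mathrm{Sp}_3\mathbb{C}$ is the symplectic group of $V$, identified with the set of bases (frames) $(e,f)=(e_0,e_1,e_2,f_0,f_1,f_2)$ of $V$ for which $e_0\wedge f_0+e_1\wedge f_1+e_2\wedge f_2$ is dual to $\varpi$. The Maurer-Cartan form is defined by $d(e,f)=(e,f)\phi$, $\phi=\begin{pmatrix}\omega&\eta\\ \theta&-\omega^t\end{pmatrix}$,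 with $3\times3$ blocks indexed by $0,1,2$, $\theta^t=\theta$, $\eta^t=\eta$, and $d\phi+\phi\wedge\phi=0$. $\Lambda\to\mathbb{P}^5$ is the bundle of Legendrian $2$-planes in $\mathcal H$ (Lagrangian for the induced conformal symplectic form), and $\mathrm{Sp}_3\mathbb{C}\to\Lambda$ is the map $(e,f)\mapsto([e_0],[e_0\wedge e_1\wedge e_2])$. The lift $\tilde{x}$ sends a point to its tangent Legendrian plane, so $\tilde{x}^*\mathrm{Sp}_3\mathbb{C}$ consists of frames along $x$ with $[e_0]=x$ and $[e_0\wedge e_1\wedge e_2]$ the tangent plane. On $\tilde x^*\mathrm{Sp}_3\mathbb{C}$ one has $\theta_{i0}=0$; $\omega^1,\omega^2$ restrict to a coframe of $M$ on each section; and $\theta_{ij}=t_{ijk}\omega^k$ ($i,j,k\in\{1,2\}$) with $t_{ijk}$ fully symmetric. The cubic differential $\Phi=t_{ijk}\omega^i\omega^j\omega^k$ is well defined on $M$ up to scale. The surface is nondegenerate if at every point $\Phi$ lies in the open $\mathrm{GL}_2\mathbb{C}$-orbit of binary cubics, i.e. is a product of three pairwise non-proportional linear forms. The action of finite permutation groups in the normalization is ignored. *)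

theory Defs
  imports "HOL-Analysis.Analysis"
begin

text \<open>
  Complex vector spaces as real normed spaces with a multiplication by \<open>\<i>\<close>.
  A map is holomorphic if it is Frechet differentiable with complex linear differential.
\<close>

class complex_space = real_normed_vector +
  fixes imult :: "'a \<Rightarrow> 'a"
  assumes imult_imult: "imult (imult v) = - v"
    and imult_add: "imult (v + w) = imult v + imult w"
    and imult_scaleR: "imult (r *\<^sub>R v) = r *\<^sub>R imult v"

instantiation complex :: complex_space
begin
definition imult_complex :: "complex \<Rightarrow> complex" where "imult_complex z = \<i> * z"
instance by standard (simp_all add: imult_complex_def algebra_simps flip: mult.assoc)
end

instantiation prod :: (complex_space, complex_space) complex_space
begin
definition imult_prod :: "'a \<times> 'b \<Rightarrow> 'a \<times> 'b"
  where "imult_prod v = (imult (fst v), imult (snd v))"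
instance by standard
  (simp_all add: imult_prod_def imult_imult imult_add imult_scaleR prod_eq_iff)
end

instantiation vec :: (complex_space, finite) complex_space
begin
definition imult_vec :: "'a ^ 'b \<Rightarrow> 'a ^ 'b" where "imult_vec v = (\<chi> i. imult (v $ i))"
instance by standard
  (simp_all add: imult_vec_def imult_imult imult_add imult_scaleR vec_eq_iff)
end

definition holo :: "('a::complex_space \<Rightarrow> 'b::complex_space) \<Rightarrow> 'a set \<Rightarrow> bool" where
  "holo f U \<longleftrightarrow> open U \<and>
     (\<forall>p\<in>U. \<exists>D. (f has_derivative D) (at p) \<and> (\<forall>v. D (imult v) = imult (D v)))"

lemma holo_iff_holomorphic_on:
  fixes f :: "complex \<Rightarrow> complex"
  shows "holo f U \<longleftrightarrow> open U \<and> f holomorphic_on U"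
proof -
  have "(\<exists>D. (f has_derivative D) (at p) \<and> (\<forall>v. D (imult v) = imult (D v)))
      \<longleftrightarrow> f field_differentiable (at p)" for p
  proof
    assume "\<exists>D. (f has_derivative D) (at p) \<and> (\<forall>v. D (imult v) = imult (D v))"
    then obtain D where D: "(f has_derivative D) (at p)" "\<And>v. D (\<i> * v) = \<i> * D v"
      by (auto simp: imult_complex_def)
    interpret bounded_linear D using D(1) by (rule has_derivative_bounded_linear)
    have "D v = D 1 * v" for v
    proof -
      have "v = Re v *\<^sub>R 1 + Im v *\<^sub>R (\<i> * 1)" by (simp add: complex_eq_iff)
      then have "D v = Re v *\<^sub>R D 1 + Im v *\<^sub>R (\<i> * D 1)" by (metis D(2) add scaleR)
      also have "\<dots> = D 1 * (Re v *\<^sub>R 1 + Im v *\<^sub>R (\<i> * 1))"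
        by (simp add: scaleR_conv_of_real algebra_simps)
      also have "\<dots> = D 1 * v" by (simp add: complex_eq_iff)
      finally show ?thesis .
    qed
    then have "D = (*) (D 1)" by blast
    then show "f field_differentiable (at p)"
      using D(1) unfolding field_differentiable_def has_field_derivative_def by metis
  next
    assume "f field_differentiable (at p)"
    then obtain d where "(f has_derivative (*) d) (at p)"
      unfolding field_differentiable_def has_field_derivative_def by blast
    moreover have "\<forall>v. d * imult v = imult (d * v)" by (simp add: imult_complex_def)
    ultimately show "\<exists>D. (f has_derivative D) (at p) \<and> (\<forall>v. D (imult v) = imult (D v))"
      by blast
  qed
  then show ?thesis
    by (auto simp: holo_def holomorphic_on_open field_differentiable_def)
qed

abbreviation diff_at :: "('a::complex_space \<Rightarrow> 'b::complex_space) \<Rightarrow> 'a \<Rightarrow> 'a \<Rightarrow> 'b" where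
  "diff_at f p \<equiv> frechet_derivative f (at p)"

text \<open>
  \<open>V = \<complex>\<^sup>6\<close> has coordinates indexed by \<open>Inl 0, Inl 1, Inl 2, Inr 0, Inr 1, Inr 2\<close>. A frame
  \<open>(e, f)\<close> is the matrix with columns \<open>e\<^sub>0, e\<^sub>1, e\<^sub>2, f\<^sub>0, f\<^sub>1, f\<^sub>2\<close>; a point of \<open>P(V)\<close> is a
  line in \<open>V\<close>. The index type \<open>3\<close> has the elements \<open>0, 1, 2\<close>.
\<close>

type_synonym V6 = "complex ^ (3 + 3)"
type_synonym frame = "complex ^ (3 + 3) ^ (3 + 3)"
type_synonym surf = "complex ^ 2"

definition varpi :: "V6 \<Rightarrow> V6 \<Rightarrow> complex" where
  "varpi u v = (\<Sum>i\<in>UNIV. u $ Inl i * v $ Inr i - u $ Inr i * v $ Inl i)"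

definition e_vec :: "frame \<Rightarrow> 3 \<Rightarrow> V6" where "e_vec F i = column (Inl i) F"
definition f_vec :: "frame \<Rightarrow> 3 \<Rightarrow> V6" where "f_vec F i = column (Inr i) F"

definition Sp3 :: "frame set" where
  "Sp3 = {F. \<forall>i j. varpi (e_vec F i) (e_vec F j) = 0 \<and> varpi (f_vec F i) (f_vec F j) = 0 \<and>
                  varpi (e_vec F i) (f_vec F j) = (if i = j then 1 else 0)}"

definition frame_flag :: "frame \<Rightarrow> V6 set \<times> V6 set" where
  "frame_flag F = (vec.span {e_vec F 0}, vec.span {e_vec F 0, e_vec F 1, e_vec F 2})"

definition local_lift :: "(surf \<Rightarrow> V6 set) \<Rightarrow> surf set \<Rightarrow> (surf \<Rightarrow> V6) \<Rightarrow> bool" where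
  "local_lift x U X \<longleftrightarrow> holo X U \<and> (\<forall>q\<in>U. X q \<noteq> 0 \<and> x q = vec.span {X q})"

text \<open>
  In terms of a lift \<open>X\<close>, the differential of \<open>x\<close> is that of \<open>X\<close> modulo \<open>X\<close>. It has to be
  injective, with values in \<open>\<H>\<close>.
\<close>

definition immersed_legendrian :: "surf set \<Rightarrow> (surf \<Rightarrow> V6 set) \<Rightarrow> bool" where
  "immersed_legendrian M x \<longleftrightarrow> open M \<and>
     (\<forall>p\<in>M. \<exists>U X. p \<in> U \<and> U \<subseteq> M \<and> local_lift x U X \<and>
        (\<forall>q\<in>U. \<forall>v. (diff_at X q v \<in> vec.span {X q} \<longrightarrow> v = 0) \<and>
                    varpi (X q) (diff_at X q v) = 0))"

text \<open>
  The lift to \<open>\<Lambda>\<close>: a point is sent to its line and its projective tangent plane, as a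
  3-dimensional subspace of \<open>V\<close>. The latter does not depend on the lift \<open>X\<close>.
\<close>

definition legendre_lift :: "(surf \<Rightarrow> V6 set) \<Rightarrow> surf \<Rightarrow> V6 set \<times> V6 set" where
  "legendre_lift x p =
     (x p, {c *s X p + diff_at X p v |c v X. \<exists>U. p \<in> U \<and> local_lift x U X})"

definition frame_bundle :: "surf set \<Rightarrow> (surf \<Rightarrow> V6 set) \<Rightarrow> (surf \<times> frame) set" where
  "frame_bundle M x = {(p, F). p \<in> M \<and> F \<in> Sp3 \<and> frame_flag F = legendre_lift x p}"

text \<open>
  Differential forms on a complex submanifold \<open>S\<close> of \<open>surf \<times> frame\<close> are evaluated on the
  velocities at \<open>0\<close> of holomorphic discs in \<open>S\<close>, which are all the tangent vectors of \<open>S\<close>.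
\<close>

definition disc_in :: "(surf \<times> frame) set \<Rightarrow> (complex \<Rightarrow> surf \<times> frame) \<Rightarrow> bool" where
  "disc_in S \<gamma> \<longleftrightarrow> (\<exists>r>0. holo \<gamma> (ball 0 r) \<and> \<gamma> ` ball 0 r \<subseteq> S)"

definition maurer_cartan :: "(complex \<Rightarrow> surf \<times> frame) \<Rightarrow> frame" where
  "maurer_cartan \<gamma> = matrix_inv (snd (\<gamma> 0)) ** snd (diff_at \<gamma> 0 1)"

definition mc_omega :: "(complex \<Rightarrow> surf \<times> frame) \<Rightarrow> 3 \<Rightarrow> 3 \<Rightarrow> complex" where
  "mc_omega \<gamma> i j = maurer_cartan \<gamma> $ Inl i $ Inl j"
definition mc_eta :: "(complex \<Rightarrow> surf \<times> frame) \<Rightarrow> 3 \<Rightarrow> 3 \<Rightarrow> complex" where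
  "mc_eta \<gamma> i j = maurer_cartan \<gamma> $ Inl i $ Inr j"
definition mc_theta :: "(complex \<Rightarrow> surf \<times> frame) \<Rightarrow> 3 \<Rightarrow> 3 \<Rightarrow> complex" where
  "mc_theta \<gamma> i j = maurer_cartan \<gamma> $ Inr i $ Inl j"

definition cubic_coeffs ::
  "surf set \<Rightarrow> (surf \<Rightarrow> V6 set) \<Rightarrow> surf \<times> frame \<Rightarrow> (3 \<Rightarrow> 3 \<Rightarrow> 3 \<Rightarrow> complex) \<Rightarrow> bool" where
  "cubic_coeffs M x b t \<longleftrightarrow> (\<forall>\<gamma>. disc_in (frame_bundle M x) \<gamma> \<and> \<gamma> 0 = b \<longrightarrow>
     (\<forall>i\<in>{1,2}. \<forall>j\<in>{1,2}. mc_theta \<gamma> i j = (\<Sum>k\<in>{1,2}. t i j k * mc_omega \<gamma> k 0)))"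

text \<open>Only the indices \<open>1\<close> and \<open>2\<close> matter for the binary forms below.\<close>

definition linear_form :: "(3 \<Rightarrow> complex) \<Rightarrow> (3 \<Rightarrow> complex) \<Rightarrow> complex" where
  "linear_form l y = (\<Sum>i\<in>{1,2}. l i * y i)"

definition cubic_form :: "(3 \<Rightarrow> 3 \<Rightarrow> 3 \<Rightarrow> complex) \<Rightarrow> (3 \<Rightarrow> complex) \<Rightarrow> complex" where
  "cubic_form t y = (\<Sum>i\<in>{1,2}. \<Sum>j\<in>{1,2}. \<Sum>k\<in>{1,2}. t i j k * y i * y j * y k)"

definition proportional :: "(3 \<Rightarrow> complex) \<Rightarrow> (3 \<Rightarrow> complex) \<Rightarrow> bool" where
  "proportional l m \<longleftrightarrow> (\<exists>\<alpha> \<beta>. (\<alpha>, \<beta>) \<noteq> (0, 0) \<and>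
     (\<forall>y. \<alpha> * linear_form l y = \<beta> * linear_form m y))"

definition generic_cubic :: "((3 \<Rightarrow> complex) \<Rightarrow> complex) \<Rightarrow> bool" where
  "generic_cubic \<Phi> \<longleftrightarrow> (\<exists>l m n.
     (\<forall>y. \<Phi> y = linear_form l y * linear_form m y * linear_form n y) \<and>
     \<not> proportional l m \<and> \<not> proportional l n \<and> \<not> proportional m n)"

text \<open>
  The cubic at \<open>p\<close> is written in the coframe \<open>\<omega>\<^sup>1, \<omega>\<^sup>2\<close> of a frame \<open>F\<close> over \<open>p\<close>. Another
  frame over \<open>p\<close> changes it by a linear substitution and a nonzero factor, so that the
  condition does not depend on \<open>F\<close>.
\<close>

definition nondegenerate :: "surf set \<Rightarrow> (surf \<Rightarrow> V6 set) \<Rightarrow> bool" where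
  "nondegenerate M x \<longleftrightarrow> (\<forall>p\<in>M. \<exists>F t. (p, F) \<in> frame_bundle M x \<and>
     cubic_coeffs M x (p, F) t \<and> generic_cubic (cubic_form t))"

text \<open>Closed subgroups that are embedded complex curves.\<close>

definition one_dim_subgroup :: "frame set \<Rightarrow> bool" where
  "one_dim_subgroup G \<longleftrightarrow>
     G \<subseteq> Sp3 \<and> closed G \<and> mat 1 \<in> G \<and>
     (\<forall>g\<in>G. matrix_inv g \<in> G) \<and> (\<forall>g\<in>G. \<forall>h\<in>G. g ** h \<in> G) \<and>
     (\<forall>g\<in>G. \<exists>W (D :: complex set) k k'. open W \<and> g \<in> W \<and> holo k D \<and>
        (\<forall>z\<in>D. diff_at k z 1 \<noteq> 0) \<and> homeomorphism D (G \<inter> W) k k')"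

text \<open>
  \<open>B\<close> is a principal \<open>G\<close>-subbundle of the frame bundle over \<open>U\<close>: it is locally \<open>s \<cdot> G\<close> for a
  holomorphic section \<open>s\<close>.
\<close>

definition reduction ::
  "surf set \<Rightarrow> (surf \<Rightarrow> V6 set) \<Rightarrow> frame set \<Rightarrow> (surf \<times> frame) set \<Rightarrow> bool" where
  "reduction U x G B \<longleftrightarrow> B \<subseteq> frame_bundle U x \<and>
     (\<forall>p\<in>U. \<exists>N s. p \<in> N \<and> N \<subseteq> U \<and> holo s N \<and>
        (\<forall>q\<in>N. {F. (q, F) \<in> B} = {s q ** g |g. g \<in> G}))"

definition holo_fun_on :: "(surf \<times> frame) set \<Rightarrow> (surf \<times> frame \<Rightarrow> complex) \<Rightarrow> bool" where
  "holo_fun_on B h \<longleftrightarrow> (\<forall>b\<in>B. \<exists>W g. b \<in> W \<and> holo g W \<and> (\<forall>y\<in>B \<inter> W. h y = g y))"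

end

(* Elie Cartan's method of moving frames. A symplectic frame field s is encoded by the components
   mcf s X u w, the value at the vector field X of the pairing of d(column u) with column w; they are
   symmetric in u and w, and the Maurer-Cartan equation becomes a relation between their derivatives.
   Since the cubic form has simple roots, these depend holomorphically on the point, which normalizes
   theta. Differentiating the normalized equations yields linear relations between the remaining
   components, and these show that the translations e_i + p_i e_0 and the shears f_j + S_kj e_k
   suffice to normalize omega and eta in turn. Differentiating once more gives the asserted relations
   for one section s. The scalings diag(z^3, z, z, z^-3, z^-1, z^-1) preserve the normal form,
   and on the bundle s * G every coefficient is a power of z times a function on the surface. *)

theory Submission
  imports Defs "HOL-Complex_Analysis.Cauchy_Integral_Formula"
begin

text \<open>Over one local section a 1-form is a pair of values on the fields \<open>V\<close>,
  \<open>W\<close> dual to omega^1, omega^2, and the structure equations are evaluated on this pair.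
  They then contain the unknown components of the bracket of \<open>V\<close> and \<open>W\<close>.
  The equations for omega^1 and omega^2, whose values on \<open>V\<close>, \<open>W\<close> are
  constant, determine these two components, and the other equations become linear in what is sought.
  Mixed second derivatives must commute for this, although holomorphic only means complex
  differentiable at every point; Cauchy's formula on complex lines supplies the missing regularity.

  The order of normalizations is forced: shears change omega by multiples of theta but leave two
  combinations of its values untouched, and translations must remove these beforehand.

  The numbers 4/3, 2, 8/3 are weights divided by 3: scaling by z multiplies omega^1, omega^2 by z^2
  and the eta_ij, eta_i0, eta_00 with i, j = 1, 2 by z^-2, z^-4, z^-6, so a, b, c have degrees -4,
  -6, -8, while omega_00 gains 3 dz/z.\<close>

section \<open>Calculus of holomorphic maps between complex spaces\<close>

definition cscale :: "complex \<Rightarrow> 'a::complex_space \<Rightarrow> 'a" where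
  "cscale c v = Re c *\<^sub>R v + Im c *\<^sub>R imult v"

lemma cscale_complex [simp]: "cscale c (z::complex) = c * z"
  by (simp add: cscale_def imult_complex_def complex_eq_iff)

lemma cscale_vec: "cscale c v $ i = cscale c (v $ i)"
  by (simp add: cscale_def imult_vec_def)

lemma cscale_vector: "cscale c (v :: complex ^ 'n) = c *s v"
  by (simp add: vec_eq_iff cscale_vec)

lemma cscale_prod: "cscale c v = (cscale c (fst v), cscale c (snd v))"
  by (simp add: cscale_def imult_prod_def prod_eq_iff)

lemma imult_zero [simp]: "imult (0::'a::complex_space) = 0"
  using imult_scaleR[of 0 "0::'a"] by simp

lemma imult_minus: "imult (- v :: 'a::complex_space) = - imult v"
  using imult_scaleR[of "-1" v] by simp

lemma cscale_zero [simp]: "cscale 0 v = 0"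
  by (simp add: cscale_def)

lemma cscale_zero_right [simp]: "cscale c 0 = 0"
  by (simp add: cscale_def)

lemma cscale_has_derivative:
  "((\<lambda>c. cscale c v) has_derivative (\<lambda>c. cscale c v)) F"
  unfolding cscale_def by (auto intro!: derivative_eq_intros)

lemma norm_cscale_le: "norm (cscale c v) \<le> norm c * (norm v + norm (imult v))"
proof -
  have "norm (cscale c v) \<le> norm (Re c *\<^sub>R v) + norm (Im c *\<^sub>R imult v)"
    unfolding cscale_def by (rule norm_triangle_ineq)
  also have "\<dots> \<le> norm c * norm v + norm c * norm (imult v)"
    by (intro add_mono) (auto intro!: mult_right_mono simp: abs_Re_le_cmod abs_Im_le_cmod)
  finally show ?thesis by (simp add: algebra_simps)
qed

lemma holo_has_derivative:
  assumes "holo f U" "p \<in> U"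
  shows "(f has_derivative diff_at f p) (at p)"
  using assms unfolding holo_def by (metis frechet_derivative_at)

lemma holo_diff_imult:
  assumes "holo f U" "p \<in> U"
  shows "diff_at f p (imult v) = imult (diff_at f p v)"
  using assms unfolding holo_def by (metis frechet_derivative_at)

lemma diff_at_eq: "(f has_derivative D) (at p) \<Longrightarrow> diff_at f p = D"
  by (metis frechet_derivative_at)

lemma holo_bounded_linear:
  assumes "holo f U" "p \<in> U"
  shows "bounded_linear (diff_at f p)"
  using holo_has_derivative[OF assms] by (rule has_derivative_bounded_linear)

lemma holo_diff_add:
  assumes "holo f U" "p \<in> U"
  shows "diff_at f p (v + w) = diff_at f p v + diff_at f p w"
  using holo_bounded_linear[OF assms] by (simp add: linear_simps)

lemma holo_diff_cscale:
  assumes "holo f U" "p \<in> U"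
  shows "diff_at f p (cscale c v) = cscale c (diff_at f p v)"
  using holo_bounded_linear[OF assms] holo_diff_imult[OF assms]
  by (simp add: cscale_def linear_simps)

lemma holoI:
  assumes "open U" "\<And>p. p \<in> U \<Longrightarrow> (f has_derivative D p) (at p)"
    "\<And>p v. p \<in> U \<Longrightarrow> D p (imult v) = imult (D p v)"
  shows "holo f U"
  using assms unfolding holo_def by blast

lemma holo_open: "holo f U \<Longrightarrow> open U"
  by (simp add: holo_def)

lemma holo_subset: "holo f U \<Longrightarrow> open W \<Longrightarrow> W \<subseteq> U \<Longrightarrow> holo f W"
  by (auto simp: holo_def)

lemma holo_continuous_on: "holo f U \<Longrightarrow> continuous_on U f"
  by (meson continuous_at_imp_continuous_on has_derivative_continuous holo_has_derivative)

text \<open>The derivative is a choice among all candidates. Both functions have the same candidates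
  at \<open>p\<close>, so the choices agree even without differentiability.\<close>

lemma diff_at_cong:
  assumes "open U" "p \<in> U" "\<And>q. q \<in> U \<Longrightarrow> f q = g q"
  shows "diff_at f p = diff_at g p"
proof -
  have "(f has_derivative D) (at p) \<longleftrightarrow> (g has_derivative D) (at p)" for D
    using assms by (metis has_derivative_transform_within_open)
  then show ?thesis unfolding frechet_derivative_def by simp
qed

lemma holo_cong:
  assumes "holo f U" "\<And>q. q \<in> U \<Longrightarrow> f q = g q"
  shows "holo g U"
proof (rule holoI[OF holo_open[OF assms(1)]])
  fix p assume p: "p \<in> U"
  show "(g has_derivative diff_at f p) (at p)"
    using holo_has_derivative[OF assms(1) p] holo_open[OF assms(1)] p assms(2)
    by (metis has_derivative_transform_within_open)
  show "diff_at f p (imult v) = imult (diff_at f p v)" for v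
    using holo_diff_imult[OF assms(1) p] .
qed

lemma holo_const: "open U \<Longrightarrow> holo (\<lambda>_. c) U"
  by (rule holoI) (auto intro: derivative_intros)

lemma diff_at_const [simp]: "diff_at (\<lambda>_. c) p = (\<lambda>_. 0)"
  by (rule diff_at_eq) (auto intro: derivative_intros)

lemma holo_complex_linear:
  assumes "open U" "bounded_linear L" "\<And>v. L (imult v) = imult (L v)"
  shows "holo L U"
  using assms by (intro holoI[where D = "\<lambda>_. L"]) (auto intro: bounded_linear.has_derivative)

lemma holo_add:
  assumes f: "holo f U" and g: "holo g U"
  shows "holo (\<lambda>q. f q + g q) U"
  by (rule holoI[where D = "\<lambda>p v. diff_at f p v + diff_at g p v"])
    (auto intro!: derivative_eq_intros holo_has_derivative[OF f] holo_has_derivative[OF g]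
      simp: holo_open[OF f] holo_diff_imult[OF f] holo_diff_imult[OF g] imult_add)

lemma diff_at_add:
  assumes "holo f U" "holo g U" "p \<in> U"
  shows "diff_at (\<lambda>q. f q + g q) p v = diff_at f p v + diff_at g p v"
  by (subst diff_at_eq[OF has_derivative_add[OF holo_has_derivative[OF assms(1,3)]
          holo_has_derivative[OF assms(2,3)]]]) simp

lemma holo_minus:
  assumes f: "holo f U"
  shows "holo (\<lambda>q. - f q) U"
  by (rule holoI[where D = "\<lambda>p v. - diff_at f p v"])
    (auto intro!: derivative_eq_intros holo_has_derivative[OF f]
      simp: holo_open[OF f] holo_diff_imult[OF f] imult_minus)

lemma diff_at_minus:
  assumes "holo f U" "p \<in> U"
  shows "diff_at (\<lambda>q. - f q) p v = - diff_at f p v"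
  by (subst diff_at_eq[OF has_derivative_minus[OF holo_has_derivative[OF assms]]]) simp

lemma holo_diff:
  assumes f: "holo f U" and g: "holo g U"
  shows "holo (\<lambda>q. f q - g q) U"
  using holo_add[OF f holo_minus[OF g]] by simp

lemma diff_at_diff:
  assumes "holo f U" "holo g U" "p \<in> U"
  shows "diff_at (\<lambda>q. f q - g q) p v = diff_at f p v - diff_at g p v"
  by (subst diff_at_eq[OF has_derivative_diff[OF holo_has_derivative[OF assms(1,3)]
          holo_has_derivative[OF assms(2,3)]]]) simp

lemma holo_sum:
  assumes "open U" "\<And>i. i \<in> I \<Longrightarrow> holo (f i) U"
  shows "holo (\<lambda>q. \<Sum>i\<in>I. f i q) U"
  using assms by (induction I rule: infinite_finite_induct) (auto intro: holo_const holo_add)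

lemma diff_at_sum:
  assumes "\<And>i. i \<in> I \<Longrightarrow> holo (f i) U" "p \<in> U"
  shows "diff_at (\<lambda>q. \<Sum>i\<in>I. f i q) p v = (\<Sum>i\<in>I. diff_at (f i) p v)"
  by (subst diff_at_eq[OF has_derivative_sum[OF holo_has_derivative[OF assms]]]) simp_all

lemma holo_mult:
  fixes f g :: "'a::complex_space \<Rightarrow> complex"
  assumes f: "holo f U" and g: "holo g U"
  shows "holo (\<lambda>q. f q * g q) U"
  by (rule holoI[where D = "\<lambda>p v. f p * diff_at g p v + diff_at f p v * g p"])
    (auto intro!: derivative_eq_intros holo_has_derivative[OF f] holo_has_derivative[OF g]
      simp: holo_open[OF f] holo_diff_imult[OF f] holo_diff_imult[OF g] imult_complex_def
        algebra_simps)

lemma diff_at_mult: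
  fixes f g :: "'a::complex_space \<Rightarrow> complex"
  assumes "holo f U" "holo g U" "p \<in> U"
  shows "diff_at (\<lambda>q. f q * g q) p v = f p * diff_at g p v + diff_at f p v * g p"
  by (subst diff_at_eq[OF has_derivative_mult[OF holo_has_derivative[OF assms(1,3)]
          holo_has_derivative[OF assms(2,3)]]]) simp

lemma holo_power:
  fixes f :: "'a::complex_space \<Rightarrow> complex"
  assumes f: "holo f U"
  shows "holo (\<lambda>q. f q ^ n) U"
  by (induction n) (auto intro!: holo_const holo_mult f holo_open[OF f])

lemma holo_inverse:
  fixes f :: "'a::complex_space \<Rightarrow> complex"
  assumes f: "holo f U" and "\<And>q. q \<in> U \<Longrightarrow> f q \<noteq> 0"
  shows "holo (\<lambda>q. inverse (f q)) U"
proof (rule holoI[OF holo_open[OF f]])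
  fix p assume p: "p \<in> U"
  show "((\<lambda>q. inverse (f q)) has_derivative (\<lambda>v. - (inverse (f p) * diff_at f p v * inverse (f p)))) (at p)"
    by (rule Deriv.has_derivative_inverse[OF assms(2)[OF p] holo_has_derivative[OF f p]])
qed (simp add: holo_diff_imult[OF f] imult_complex_def)

lemma holo_divide:
  fixes f g :: "'a::complex_space \<Rightarrow> complex"
  assumes "holo f U" "holo g U" "\<And>q. q \<in> U \<Longrightarrow> g q \<noteq> 0"
  shows "holo (\<lambda>q. f q / g q) U"
  unfolding divide_inverse by (intro holo_mult holo_inverse assms)

lemma has_derivative_vec:
  fixes f :: "'a::real_normed_vector \<Rightarrow> 'b::euclidean_space ^ 'n"
  assumes "\<And>i. ((\<lambda>q. f q $ i) has_derivative (\<lambda>v. D v $ i)) (at p)"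
  shows "(f has_derivative D) (at p)"
proof (subst has_derivative_componentwise_within, intro ballI)
  fix b :: "'b ^ 'n" assume "b \<in> Basis"
  then obtain i c where b: "b = axis i c" by (auto simp: Basis_vec_def)
  show "((\<lambda>x. f x \<bullet> b) has_derivative (\<lambda>x. D x \<bullet> b)) (at p)"
    unfolding b inner_axis by (intro derivative_intros assms)
qed

lemma holo_vec_nth:
  fixes f :: "'a::complex_space \<Rightarrow> 'b::complex_space ^ 'n"
  assumes f: "holo f U"
  shows "holo (\<lambda>q. f q $ i) U"
  by (rule holoI[where D = "\<lambda>p v. diff_at f p v $ i"])
    (auto intro!: bounded_linear.has_derivative[OF bounded_linear_vec_nth] holo_has_derivative[OF f]
      simp: holo_open[OF f] holo_diff_imult[OF f] imult_vec_def)

lemma diff_at_vec_nth: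
  fixes f :: "'a::complex_space \<Rightarrow> 'b::complex_space ^ 'n"
  assumes "holo f U" "p \<in> U"
  shows "diff_at (\<lambda>q. f q $ i) p v = diff_at f p v $ i"
  by (subst diff_at_eq[OF bounded_linear.has_derivative[OF bounded_linear_vec_nth
          holo_has_derivative[OF assms]]]) simp

lemma holo_vecI:
  fixes f :: "'a::complex_space \<Rightarrow> 'b::{complex_space,euclidean_space} ^ 'n"
  assumes f: "\<And>i. holo (\<lambda>q. f q $ i) U"
  shows "holo f U"
proof (rule holoI[where D = "\<lambda>p v. \<chi> i. diff_at (\<lambda>q. f q $ i) p v"])
  show "(f has_derivative (\<lambda>v. \<chi> i. diff_at (\<lambda>q. f q $ i) p v)) (at p)" if "p \<in> U" for p
    by (rule has_derivative_vec) (simp add: holo_has_derivative[OF f that] eta_contract_eq)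
qed (auto simp: holo_open[OF f] holo_diff_imult[OF f] imult_vec_def)

lemma holo_Pair:
  assumes f: "holo f U" and g: "holo g U"
  shows "holo (\<lambda>q. (f q, g q)) U"
  by (rule holoI[where D = "\<lambda>p v. (diff_at f p v, diff_at g p v)"])
    (auto intro!: has_derivative_Pair holo_has_derivative[OF f] holo_has_derivative[OF g]
      simp: holo_open[OF f] holo_diff_imult[OF f] holo_diff_imult[OF g] imult_prod_def)

lemma holo_compose:
  assumes f: "holo f U" and g: "holo g W" and "g ` W \<subseteq> U"
  shows "holo (\<lambda>q. f (g q)) W"
proof (rule holoI[where D = "\<lambda>p v. diff_at f (g p) (diff_at g p v)"])
  fix p assume p: "p \<in> W"
  then have gp: "g p \<in> U" using assms(3) by auto
  show "((\<lambda>q. f (g q)) has_derivative (\<lambda>v. diff_at f (g p) (diff_at g p v))) (at p)"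
    using has_derivative_compose[OF holo_has_derivative[OF g p] holo_has_derivative[OF f gp]] .
  show "diff_at f (g p) (diff_at g p (imult v)) = imult (diff_at f (g p) (diff_at g p v))" for v
    by (simp add: holo_diff_imult[OF f gp] holo_diff_imult[OF g p])
qed (simp add: holo_open[OF g])

lemma diff_at_compose:
  assumes "holo f U" "holo g W" "p \<in> W" "g p \<in> U"
  shows "diff_at (\<lambda>q. f (g q)) p v = diff_at f (g p) (diff_at g p v)"
  by (subst diff_at_eq[OF has_derivative_compose[OF holo_has_derivative[OF assms(2,3)]
          holo_has_derivative[OF assms(1,4)]]]) simp

lemma holo_fst: "open U \<Longrightarrow> holo fst U"
  by (rule holo_complex_linear) (simp_all add: bounded_linear_fst imult_prod_def)

lemma holo_snd: "open U \<Longrightarrow> holo snd U"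
  by (rule holo_complex_linear) (simp_all add: bounded_linear_snd imult_prod_def)

lemma holo_ident: "open U \<Longrightarrow> holo (\<lambda>q. q) U"
  by (rule holo_complex_linear) (simp_all add: bounded_linear_ident)

section \<open>Derivatives of holomorphic functions\<close>

text \<open>Restriction to a complex line reduces several variables to the single variable \<zeta>,
  where Cauchy's formula applies.\<close>

lemma holo_line: "holo (\<lambda>\<zeta>. q + cscale \<zeta> v) UNIV"
  and line_has_derivative: "((\<lambda>\<zeta>. q + cscale \<zeta> v) has_derivative (\<lambda>\<zeta>. cscale \<zeta> v)) F"
proof -
  show der: "((\<lambda>\<zeta>. q + cscale \<zeta> v) has_derivative (\<lambda>\<zeta>. cscale \<zeta> v)) F" for F
    by (auto intro!: derivative_eq_intros cscale_has_derivative)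
  show "holo (\<lambda>\<zeta>. q + cscale \<zeta> v) UNIV"
    by (intro holoI[OF _ der]) (auto simp: imult_complex_def cscale_def imult_add imult_scaleR imult_imult)
qed

text \<open>Cauchy's formula for h'(0) with h(\<zeta>) = f(q + \<zeta> v). On the circle \<zeta> = r
  exp(2 pi i t) one has d\<zeta> = 2 pi i \<zeta> dt, which cancels 2 pi i and one of the two
  factors \<zeta> in the denominator. A directional derivative becomes an integral of values of
  \<open>f\<close> that can be differentiated in \<open>q\<close>.\<close>

lemma diff_at_has_integral:
  fixes f :: "'a::complex_space \<Rightarrow> complex"
  assumes f: "holo f N" and r: "r > 0" and N: "\<forall>\<zeta>. norm \<zeta> \<le> r \<longrightarrow> q + cscale \<zeta> v \<in> N"
  shows "((\<lambda>t. f (q + cscale (circlepath 0 r t) v) / circlepath 0 r t) has_integral diff_at f q v)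
    {0..1}"
proof -
  define h where "h \<zeta> = f (q + cscale \<zeta> v)" for \<zeta>
  define S where "S = (\<lambda>\<zeta>. q + cscale \<zeta> v) -` N"
  have "open S" unfolding S_def
    using continuous_open_vimage[OF holo_open[OF f]] holo_continuous_on[OF holo_line]
    by (metis continuous_on_eq_continuous_at open_UNIV UNIV_I)
  then have "holo h S" unfolding h_def
    by (intro holo_compose[OF f]) (auto simp: S_def intro!: holo_subset[OF holo_line])
  then have hol: "h holomorphic_on S" by (simp add: holo_iff_holomorphic_on)
  have sub: "cball 0 r \<subseteq> S" using N by (auto simp: S_def)
  have "((\<lambda>u. h u / (u - 0) ^ Suc 1) has_contour_integral
      (2 * pi * \<i>) / fact 1 * (deriv ^^ 1) h 0) (circlepath 0 r)"
    using r holomorphic_on_subset[OF hol sub]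
    by (intro Cauchy_has_contour_integral_higher_derivative_circlepath)
       (auto intro: holomorphic_on_imp_continuous_on elim: holomorphic_on_subset)
  then have "((\<lambda>t. h (circlepath 0 r t) / (circlepath 0 r t)\<^sup>2 *
      vector_derivative (circlepath 0 r) (at t within {0..1}))
      has_integral 2 * pi * \<i> * deriv h 0) {0..1}"
    by (simp add: has_contour_integral_def power2_eq_square)
  then have "((\<lambda>t. (1 / (2 * pi * \<i>)) * (h (circlepath 0 r t) / (circlepath 0 r t)\<^sup>2 *
      vector_derivative (circlepath 0 r) (at t within {0..1})))
      has_integral (1 / (2 * pi * \<i>)) * (2 * pi * \<i> * deriv h 0)) {0..1}"
    by (rule has_integral_mult_right)
  then have "((\<lambda>t. h (circlepath 0 r t) / circlepath 0 r t) has_integral deriv h 0) {0..1}"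
  proof (rule has_integral_eq_rhs[OF has_integral_eq, rotated])
    fix t :: real assume "t \<in> {0..1}"
    then show "(1 / (2 * pi * \<i>)) * (h (circlepath 0 r t) / (circlepath 0 r t)\<^sup>2 *
      vector_derivative (circlepath 0 r) (at t within {0..1})) =
      h (circlepath 0 r t) / circlepath 0 r t"
      using r by (simp add: vector_derivative_circlepath01)
        (simp add: circlepath field_simps power2_eq_square)
  qed simp
  moreover have "deriv h 0 = diff_at f q v"
  proof -
    have q: "q \<in> N" using N[rule_format, of 0] r by simp
    have "(h has_derivative (\<lambda>\<zeta>. diff_at f q (cscale \<zeta> v))) (at 0)"
      unfolding h_def
      by (rule has_derivative_compose[OF line_has_derivative]) (simp add: holo_has_derivative[OF f q])
    then have "(h has_field_derivative diff_at f q v) (at 0)"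
      by (simp add: has_field_derivative_def holo_diff_cscale[OF f q] mult_commute_abs)
    then show ?thesis by (rule DERIV_imp_deriv)
  qed
  ultimately show ?thesis unfolding h_def by simp
qed

context
  fixes f :: "'a::{complex_space,euclidean_space} \<Rightarrow> complex" and N :: "'a set"
  assumes f: "holo f N"
begin

text \<open>One radius serves all \<open>q\<close> near \<open>p\<close>, so that the circle
  integral is a parameter integral in \<open>q\<close>.\<close>

lemma uniform_disc:
  assumes "p \<in> N"
  obtains d r where "d > 0" "r > 0" "ball p d \<subseteq> N"
    "\<forall>q\<in>ball p d. \<forall>\<zeta>. norm \<zeta> \<le> r \<longrightarrow> q + cscale \<zeta> v \<in> N"
proof -
  obtain e where e: "e > 0" "ball p e \<subseteq> N"
    using holo_open[OF f] assms openE by blast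
  \<comment> \<open>The summand 1 keeps \<open>m\<close> positive when v = 0.\<close>
  define m where "m = 1 + norm v + norm (imult v)"
  have m: "m > 0" by (simp add: m_def add_pos_nonneg)
  show ?thesis
  proof (rule that[of "e/2" "e/(2*m)"], safe)
    fix q \<zeta> assume q: "q \<in> ball p (e/2)" and \<zeta>: "norm (\<zeta>::complex) \<le> e/(2*m)"
    have "norm (cscale \<zeta> v) \<le> norm \<zeta> * (norm v + norm (imult v))" by (rule norm_cscale_le)
    also have "\<dots> \<le> e/(2*m) * m"
      using \<zeta> e m by (intro mult_mono) (auto simp: m_def)
    also have "\<dots> = e/2" using m by simp
    finally have "dist q (q + cscale \<zeta> v) \<le> e/2" by (simp add: dist_norm)
    moreover have "dist p q < e/2" using q by simp
    ultimately have "dist p (q + cscale \<zeta> v) < e"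
      using dist_triangle[of p "q + cscale \<zeta> v" q] by linarith
    then show "q + cscale \<zeta> v \<in> N" using e by auto
  next
    show "x \<in> N" if "x \<in> ball p (e/2)" for x using that e by (intro subsetD[OF e(2)]) simp
  qed (use e m in simp_all)
qed

text \<open>Stated for an arbitrary continuous \<open>g\<close> because it serves twice: for
  \<open>f\<close> itself, and for the directional derivatives of \<open>f\<close> once they are
  known to be continuous.\<close>

lemma circle_integrand_continuous:
  assumes g: "continuous_on N g" and r: "r > 0"
    and W: "\<forall>q\<in>W. \<forall>\<zeta>. norm \<zeta> \<le> r \<longrightarrow> q + cscale \<zeta> v \<in> N"
  shows "continuous_on (W \<times> {0..1})
    (\<lambda>(q, t). g (q + cscale (circlepath 0 r t) v) / circlepath 0 r t :: complex)"
  unfolding split_beta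
proof (intro continuous_on_divide continuous_on_compose2[OF g])
  show "continuous_on (W \<times> {0..1}) (\<lambda>x. circlepath 0 r (snd x))"
    unfolding circlepath by (intro continuous_intros)
  show "continuous_on (W \<times> {0..1}) (\<lambda>x. fst x + cscale (circlepath 0 r (snd x)) v)"
    unfolding circlepath cscale_def by (intro continuous_intros)
  show "(\<lambda>x. fst x + cscale (circlepath 0 r (snd x)) v) ` (W \<times> {0..1}) \<subseteq> N"
    using r by (auto intro!: W[rule_format] simp: circlepath norm_mult)
  show "\<forall>x\<in>W \<times> {0..1}. circlepath 0 r (snd x) \<noteq> 0"
    using r by (simp add: circlepath)
qed

lemma diff_at_continuous: "continuous_on N (\<lambda>q. diff_at f q v)"
proof (rule continuous_at_imp_continuous_on, rule ballI)
  fix p assume "p \<in> N"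
  then obtain d r where dr: "d > 0" "r > 0" "ball p d \<subseteq> N"
    "\<forall>q\<in>ball p d. \<forall>\<zeta>. norm \<zeta> \<le> r \<longrightarrow> q + cscale \<zeta> v \<in> N"
    by (rule uniform_disc[where v = v]) blast
  let ?g = "\<lambda>q t. f (q + cscale (circlepath 0 r t) v) / circlepath 0 r t"
  have "continuous_on (ball p d) (\<lambda>q. integral (cbox 0 1) (?g q))"
    using circle_integrand_continuous[OF holo_continuous_on[OF f] dr(2,4)]
    by (intro integral_continuous_on_param) simp
  moreover have "integral (cbox 0 1) (?g q) = diff_at f q v" if "q \<in> ball p d" for q
    using diff_at_has_integral[OF f dr(2) bspec[OF dr(4) that]] by (simp add: integral_unique)
  ultimately have "continuous_on (ball p d) (\<lambda>q. diff_at f q v)"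
    by (rule continuous_on_eq)
  then show "isCont (\<lambda>q. diff_at f q v) p"
    using dr(1) by (simp add: continuous_on_eq_continuous_at)
qed

text \<open>Differentiation under the circle integral, whose integrand has a jointly continuous
  derivative by \<open>diff_at_continuous\<close>. The integral formula for \<open>D\<close> is
  recorded because both the complex linearity of \<open>D\<close> and the symmetry of second
  derivatives are read off from it.\<close>

lemma diff_at_differentiable:
  assumes "p \<in> N"
  shows "\<exists>D. ((\<lambda>q. diff_at f q v) has_derivative D) (at p) \<and>
    (\<exists>r>0. (\<forall>\<zeta>. norm \<zeta> \<le> r \<longrightarrow> p + cscale \<zeta> v \<in> N) \<and>
      (\<forall>w. D w = integral {0..1}
        (\<lambda>t. diff_at f (p + cscale (circlepath 0 r t) v) w / circlepath 0 r t)))"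
proof -
  obtain d r where dr: "d > 0" "r > 0" "ball p d \<subseteq> N"
    "\<forall>q\<in>ball p d. \<forall>\<zeta>. norm \<zeta> \<le> r \<longrightarrow> q + cscale \<zeta> v \<in> N"
    by (rule uniform_disc[OF assms, where v = v]) blast
  let ?z = "circlepath 0 r"
  have z: "norm (?z t) = r" for t using dr(2) by (simp add: circlepath norm_mult)
  let ?g = "\<lambda>q t. f (q + cscale (?z t) v) / ?z t"
  define fx where "fx q t = Blinfun (\<lambda>w. diff_at f (q + cscale (?z t) v) w / ?z t)" for q t
  have bl: "bounded_linear (\<lambda>w. diff_at f (q + cscale (?z t) v) w / ?z t)"
    if "q \<in> ball p d" for q t
    using holo_bounded_linear[OF f dr(4)[rule_format, OF that, of "?z t"]] z
    by (simp add: bounded_linear_divide bounded_linear_compose[OF bounded_linear_divide])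
  have fx: "blinfun_apply (fx q t) w = diff_at f (q + cscale (?z t) v) w / ?z t"
    if "q \<in> ball p d" for q t w
    unfolding fx_def by (simp add: bounded_linear_Blinfun_apply[OF bl[OF that]])
  have cont: "continuous_on (ball p d \<times> cbox 0 1) (\<lambda>(q, t). fx q t)"
  proof (rule continuous_on_blinfun_componentwise)
    fix i :: 'a
    show "continuous_on (ball p d \<times> cbox 0 1) (\<lambda>x. blinfun_apply (case x of (q, t) \<Rightarrow> fx q t) i)"
      by (rule continuous_on_eq[OF circle_integrand_continuous[OF diff_at_continuous dr(2,4), of i,
            folded cbox_interval]]) (auto simp: fx)
  qed
  have "((\<lambda>q. integral (cbox 0 1) (?g q)) has_derivative integral (cbox 0 1) (fx p))
      (at p within ball p d)"
  proof (rule leibniz_rule[OF _ _ cont])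
    fix q t assume q: "q \<in> ball p d"
    have "((\<lambda>q. f (q + cscale (?z t) v)) has_derivative diff_at f (q + cscale (?z t) v)) (at q)"
    proof (rule has_derivative_compose[where f = "\<lambda>q. q + cscale (?z t) v" and f' = "\<lambda>w. w"])
      show "((\<lambda>q. q + cscale (?z t) v) has_derivative (\<lambda>w. w)) (at q)"
        by (auto intro!: derivative_eq_intros)
      show "(f has_derivative diff_at f (q + cscale (?z t) v)) (at (q + cscale (?z t) v))"
        using holo_has_derivative[OF f dr(4)[rule_format, OF q, of "?z t"]] z by simp
    qed
    then show "((\<lambda>q. ?g q t) has_derivative blinfun_apply (fx q t)) (at q within ball p d)"
      unfolding fx[OF q, abs_def]
      by (rule has_derivative_at_withinI[OF bounded_linear.has_derivative[OF bounded_linear_divide]])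
    show "?g q integrable_on cbox 0 1"
      using diff_at_has_integral[OF f dr(2) bspec[OF dr(4) q]] by (auto simp: integrable_on_def)
  qed (use dr in auto)
  then have "((\<lambda>q. integral (cbox 0 1) (?g q)) has_derivative integral {0..1} (fx p)) (at p)"
    using dr(1) by (simp add: at_within_open[of p "ball p d"])
  then have "((\<lambda>q. diff_at f q v) has_derivative integral {0..1} (fx p)) (at p)"
  proof (rule has_derivative_transform_within_open[where s = "ball p d"])
    show "integral (cbox 0 1) (?g q) = diff_at f q v" if "q \<in> ball p d" for q
      using diff_at_has_integral[OF f dr(2) bspec[OF dr(4) that]] by (simp add: integral_unique)
  qed (use dr(1) in simp_all)
  moreover have "fx p integrable_on {0..1}"
    using continuous_on_compose2[OF cont, of "{0..1}" "\<lambda>t. (p, t)"] dr(1)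
    by (intro integrable_continuous_real) (simp add: continuous_on_Pair image_subset_iff)
  then have "blinfun_apply (integral {0..1} (fx p)) w = integral {0..1}
        (\<lambda>t. diff_at f (p + cscale (circlepath 0 r t) v) w / circlepath 0 r t)" for w
    using dr(1) by (subst blinfun_apply_integral) (auto simp: fx)
  ultimately show ?thesis
    using dr(1,2,4)
    by (intro exI[of _ "blinfun_apply (integral {0..1} (fx p))"] exI[of _ r] conjI) simp_all
qed

lemma holo_diff_at_complex: "holo (\<lambda>q. diff_at f q v) N"
proof (rule holoI[OF holo_open[OF f]])
  fix p assume p: "p \<in> N"
  let ?D = "diff_at (\<lambda>q. diff_at f q v) p"
  obtain D r where D: "((\<lambda>q. diff_at f q v) has_derivative D) (at p)" "r > 0"
    "\<forall>\<zeta>. norm \<zeta> \<le> r \<longrightarrow> p + cscale \<zeta> v \<in> N"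
    "\<forall>w. D w = integral {0..1}
        (\<lambda>t. diff_at f (p + cscale (circlepath 0 r t) v) w / circlepath 0 r t)"
    using diff_at_differentiable[OF p, of v] by blast
  have "D = ?D" using diff_at_eq[OF D(1)] by simp
  then show "((\<lambda>q. diff_at f q v) has_derivative ?D) (at p)" using D(1) by simp
  fix w
  have "diff_at f (p + cscale (circlepath 0 r t) v) (imult w) =
      \<i> * diff_at f (p + cscale (circlepath 0 r t) v) w" for t
    using D(2) by (subst holo_diff_imult[OF f D(3)[rule_format]])
      (auto simp: circlepath norm_mult imult_complex_def)
  then have "D (imult w) = \<i> * D w"
    unfolding D(4)[rule_format] by (simp flip: integral_mult_right)
  then show "?D (imult w) = imult (?D w)"
    using \<open>D = ?D\<close> by (simp add: imult_complex_def)
qed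

end

text \<open>Differentiating the circle formula for the \<open>v\<close>-derivative in direction
  \<open>w\<close> puts the \<open>w\<close>-derivative under the integral. The result is the circle
  formula for the \<open>v\<close>-derivative of \<open>\<lambda>q. diff_at f q w\<close>.\<close>

lemma second_diff_symmetric:
  fixes f :: "'a::{complex_space,euclidean_space} \<Rightarrow> complex"
  assumes f: "holo f N" and p: "p \<in> N"
  shows "diff_at (\<lambda>q. diff_at f q v) p w = diff_at (\<lambda>q. diff_at f q w) p v"
proof -
  obtain D r where D: "((\<lambda>q. diff_at f q v) has_derivative D) (at p)" "r > 0"
    "\<forall>\<zeta>. norm \<zeta> \<le> r \<longrightarrow> p + cscale \<zeta> v \<in> N"
    "\<forall>w. D w = integral {0..1}
        (\<lambda>t. diff_at f (p + cscale (circlepath 0 r t) v) w / circlepath 0 r t)"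
    using diff_at_differentiable[OF f p, of v] by blast
  show ?thesis
    using diff_at_has_integral[OF holo_diff_at_complex[OF f] D(2,3), of w]
      diff_at_eq[OF D(1)] by (simp add: D(4)[rule_format] integral_unique)
qed

lemma diff_at_expand:
  fixes f :: "complex ^ 'n \<Rightarrow> complex"
  assumes f: "holo f N" and q: "q \<in> N"
  shows "diff_at f q v = (\<Sum>i\<in>UNIV. v $ i * diff_at f q (axis i 1))"
proof -
  have "v = (\<Sum>i\<in>UNIV. cscale (v $ i) (axis i 1))"
    by (simp add: cscale_vector vec_eq_iff axis_def if_distrib[of "(*) _"] cong: if_cong)
  then have "diff_at f q v = diff_at f q (\<Sum>i\<in>UNIV. cscale (v $ i) (axis i 1))" by simp
  also have "\<dots> = (\<Sum>i\<in>UNIV. diff_at f q (cscale (v $ i) (axis i 1)))"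
    by (rule linear_sum[OF bounded_linear.linear[OF holo_bounded_linear[OF f q]]])
  also have "\<dots> = (\<Sum>i\<in>UNIV. v $ i * diff_at f q (axis i 1))"
    by (simp add: holo_diff_cscale[OF f q])
  finally show ?thesis .
qed

lemma holo_diff_at:
  fixes f :: "complex ^ 'n \<Rightarrow> complex"
  assumes f: "holo f N" and V: "holo V N"
  shows "holo (\<lambda>q. diff_at f q (V q)) N"
proof (rule holo_cong)
  show "holo (\<lambda>q. \<Sum>i\<in>UNIV. V q $ i * diff_at f q (axis i 1)) N"
    by (intro holo_sum holo_mult holo_vec_nth V holo_diff_at_complex f holo_open[OF f])
qed (simp add: diff_at_expand[OF f, symmetric])

text \<open>The product rule for df paired with a moving vector: the Hessian on \<open>V p\<close>
  and \<open>w\<close>, plus df on the derivative of \<open>V\<close>.\<close>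

lemma diff_at_diff_at:
  fixes f :: "complex ^ 'n \<Rightarrow> complex"
  assumes f: "holo f N" and V: "holo V N" and p: "p \<in> N"
  shows "diff_at (\<lambda>q. diff_at f q (V q)) p w =
    diff_at (\<lambda>q. diff_at f q (V p)) p w + diff_at f p (diff_at V p w)"
proof -
  note h = holo_mult[OF holo_vec_nth[OF V] holo_diff_at_complex[OF f]]
  have "diff_at (\<lambda>q. diff_at f q (V q)) p w =
      diff_at (\<lambda>q. \<Sum>i\<in>UNIV. V q $ i * diff_at f q (axis i 1)) p w"
    by (rule fun_cong[OF diff_at_cong[OF holo_open[OF f] p]]) (rule diff_at_expand[OF f])
  also have "\<dots> = (\<Sum>i\<in>UNIV. V p $ i * diff_at (\<lambda>q. diff_at f q (axis i 1)) p w)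
      + (\<Sum>i\<in>UNIV. diff_at V p w $ i * diff_at f p (axis i 1))"
    by (simp add: diff_at_sum[OF h p] sum.distrib diff_at_vec_nth[OF V p]
        diff_at_mult[OF holo_vec_nth[OF V] holo_diff_at_complex[OF f] p])
  also have "(\<Sum>i\<in>UNIV. diff_at V p w $ i * diff_at f p (axis i 1)) = diff_at f p (diff_at V p w)"
    by (simp add: diff_at_expand[OF f p, symmetric])
  also have "(\<Sum>i\<in>UNIV. V p $ i * diff_at (\<lambda>q. diff_at f q (axis i 1)) p w)
      = diff_at (\<lambda>q. diff_at f q w) p (V p)"
    by (subst diff_at_expand[OF holo_diff_at_complex[OF f] p])
      (simp add: second_diff_symmetric[OF f p, of w])
  finally show ?thesis by (simp add: second_diff_symmetric[OF f p, of w])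
qed

text \<open>The Hessian terms cancel by symmetry, leaving the derivative along the Lie bracket of
  \<open>V\<close> and \<open>W\<close>.\<close>

lemma diff_at_commutator:
  fixes f :: "complex ^ 'n \<Rightarrow> complex"
  assumes f: "holo f N" and V: "holo V N" and W: "holo W N" and p: "p \<in> N"
  shows "diff_at (\<lambda>q. diff_at f q (W q)) p (V p) - diff_at (\<lambda>q. diff_at f q (V q)) p (W p) =
    diff_at f p (diff_at W p (V p) - diff_at V p (W p))"
  unfolding diff_at_diff_at[OF f V p] diff_at_diff_at[OF f W p]
  using second_diff_symmetric[OF f p, of "V p" "W p"]
  by (simp add: linear_diff[OF bounded_linear.linear[OF holo_bounded_linear[OF f p]]])

section \<open>Implicit functions\<close>

text \<open>The inverse function theorem is applied to (q, z) \<mapsto> (q, P(q, z)); the graph of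
  the root is the image of the points (q, 0) under the inverse map.\<close>

lemma holo_implicit:
  fixes P :: "'a::{complex_space,euclidean_space} \<times> complex \<Rightarrow> complex"
  assumes P: "holo P S" and p: "(p, z) \<in> S" "P (p, z) = 0" and d: "diff_at P (p, z) (0, 1) \<noteq> 0"
  obtains N e where "p \<in> N" "holo e N" "e p = z" "\<And>q. q \<in> N \<Longrightarrow> (q, e q) \<in> S \<and> P (q, e q) = 0"
proof -
  define f where "f x = (fst x, P x)" for x
  define f' where "f' x = Blinfun (\<lambda>w. (fst w, diff_at P x w))" for x
  have f': "blinfun_apply (f' x) = (\<lambda>w. (fst w, diff_at P x w))" if "x \<in> S" for x
    unfolding f'_def
    by (intro bounded_linear_Blinfun_apply bounded_linear_Pair bounded_linear_fst
        holo_bounded_linear[OF P that])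
  have der: "(f has_derivative blinfun_apply (f' x)) (at x)" if "x \<in> S" for x
    unfolding f'[OF that] f_def
    by (intro has_derivative_Pair holo_has_derivative[OF P that] has_derivative_fst has_derivative_ident)
  have cont: "continuous_on S f'"
  proof (rule continuous_on_blinfun_componentwise)
    fix i :: "'a \<times> complex"
    show "continuous_on S (\<lambda>x. blinfun_apply (f' x) i)"
      by (rule continuous_on_eq[of _ "\<lambda>x. (fst i, diff_at P x i)"])
        (auto simp: f' intro!: continuous_on_Pair continuous_on_const diff_at_continuous[OF P])
  qed
  let ?L = "diff_at P (p, z)"
  note lin = bounded_linear.linear[OF holo_bounded_linear[OF P p(1)]]
  \<comment> \<open>The inverse of the differential \<open>\<lambda>w. (fst w, ?L w)\<close>: the
    first component is known, and the second results from division by the partial derivative in the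
    last variable.\<close>
  define h where "h = (\<lambda>w. (fst w, (snd w - ?L (fst w, 0)) / ?L (0, 1)))"
  have "bounded_linear h"
    unfolding h_def
    by (intro bounded_linear_Pair bounded_linear_fst
        bounded_linear_compose[OF bounded_linear_divide] bounded_linear_sub bounded_linear_snd
        bounded_linear_compose[OF holo_bounded_linear[OF P p(1)]] bounded_linear_zero)
  then have "blinfun_apply (Blinfun h) = h" by (rule bounded_linear_Blinfun_apply)
  moreover have "h (fst w, ?L w) = w" for w
  proof -
    have "?L w = ?L ((fst w, 0) + cscale (snd w) (0, 1))" by (simp add: cscale_prod)
    also have "\<dots> = ?L (fst w, 0) + snd w * ?L (0, 1)"
      by (simp only: linear_add[OF lin] holo_diff_cscale[OF P p(1)] cscale_complex)
    finally show ?thesis using d by (simp add: h_def prod_eq_iff)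
  qed
  ultimately have inv: "Blinfun h o\<^sub>L f' (p, z) = id_blinfun"
    by (intro blinfun_eqI) (simp add: f'[OF p(1)])
  obtain U' V g g' where U': "open U'" "U' \<subseteq> S" "(p, z) \<in> U'" and V: "open V" "f (p, z) \<in> V"
    and hom: "homeomorphism U' V f g"
    and g: "\<And>y. y \<in> V \<Longrightarrow> (g has_derivative g' y) (at y)"
    and g': "\<And>y. y \<in> V \<Longrightarrow> g' y = inv (blinfun_apply (f' (g y)))"
    and bij: "\<And>y. y \<in> V \<Longrightarrow> bij (blinfun_apply (f' (g y)))"
    using inverse_function_theorem[OF holo_open[OF P] der cont p(1) inv] by blast
  have gV: "g y \<in> S" "f (g y) = y" if "y \<in> V" for y
    using hom U'(2) that unfolding homeomorphism_def by auto
  \<comment> \<open>The theorem yields real derivatives only; the inverse of a complex linear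
    bijection is complex linear.\<close>
  have hg: "holo g V"
  proof (rule holoI[OF V(1) g])
    fix y v assume y: "y \<in> V"
    let ?f = "\<lambda>w. (fst w, diff_at P (g y) w)"
    have b: "bij ?f" using bij[OF y] by (simp add: f'[OF gV(1)[OF y]])
    have lin: "?f (imult w) = imult (?f w)" for w
      unfolding holo_diff_imult[OF P gV(1)[OF y]] by (simp add: imult_prod_def)
    have "?f (inv ?f v) = v" by (rule surj_f_inv_f[OF bij_is_surj[OF b]])
    then have "imult v = ?f (imult (inv ?f v))" by (simp only: lin)
    then have "inv ?f (imult v) = imult (inv ?f v)"
      by (simp only: inv_f_f[OF bij_is_inj[OF b]])
    then show "g' y (imult v) = imult (g' y v)"
      by (simp add: g'[OF y] f'[OF gV(1)[OF y]])
  qed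
  define N where "N = (\<lambda>q. (q, 0)) -` V"
  have oN: "open N" unfolding N_def
    by (rule continuous_open_vimage[OF V(1)]) (auto intro!: continuous_intros)
  show ?thesis
  proof (rule that[of N "\<lambda>q. snd (g (q, 0))"])
    show "p \<in> N" using V(2) p(2) by (simp add: N_def f_def)
    have "holo (\<lambda>q. (q, 0)) N" by (intro holo_Pair holo_ident holo_const oN)
    then have "holo (\<lambda>q. g (q, 0)) N" by (rule holo_compose[OF hg]) (auto simp: N_def)
    then show "holo (\<lambda>q. snd (g (q, 0))) N"
      by (rule holo_compose[OF holo_snd[OF open_UNIV]]) simp
    have "g (f (p, z)) = (p, z)" using hom U'(3) unfolding homeomorphism_def by auto
    then show "snd (g (p, 0)) = z" using p(2) by (simp add: f_def)
    fix q assume "q \<in> N"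
    then have "(q, 0) \<in> V" by (simp add: N_def)
    from gV[OF this] show "(q, snd (g (q, 0))) \<in> S \<and> P (q, snd (g (q, 0))) = 0"
      by (simp add: f_def prod_eq_iff) (metis prod.collapse)
  qed
qed

text \<open>At \<open>p\<close> the root 0 is simple, since the derivative in the root variable is
  \<open>c1 p\<close> there. The leading coefficient may vanish: in the application it is zero at
  \<open>p\<close>, another root being at infinity.\<close>

lemma holo_cubic_root:
  fixes c0 c1 c2 c3 :: "'a::{complex_space,euclidean_space} \<Rightarrow> complex"
  assumes c: "holo c0 N" "holo c1 N" "holo c2 N" "holo c3 N" and p: "p \<in> N" "c0 p = 0" "c1 p \<noteq> 0"
  obtains N' e where "p \<in> N'" "N' \<subseteq> N" "holo e N'" "e p = 0"
    "\<And>q. q \<in> N' \<Longrightarrow> c0 q + c1 q * e q + c2 q * e q ^ 2 + c3 q * e q ^ 3 = 0"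
proof -
  define P where "P x = c0 (fst x) + c1 (fst x) * snd x + c2 (fst x) * snd x ^ 2 + c3 (fst x) * snd x ^ 3"
    for x :: "'a \<times> complex"
  have o: "open (N \<times> (UNIV :: complex set))" using holo_open[OF c(1)] by (simp add: open_Times)
  have cf: "holo (\<lambda>x. c (fst x)) (N \<times> (UNIV :: complex set))" if "holo c N" for c :: "'a \<Rightarrow> complex"
    by (rule holo_compose[OF that holo_fst[OF o]]) auto
  have P: "holo P (N \<times> UNIV)" unfolding P_def
    by (intro holo_add holo_mult holo_power cf c holo_snd o)
  have "((\<lambda>z. P (p, z)) has_derivative (\<lambda>v. diff_at P (p, 0) (0, v))) (at 0)"
    by (rule has_derivative_compose[where f = "\<lambda>z. (p, z)" and f' = "\<lambda>v. (0, v)"])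
      (use holo_has_derivative[OF P, of "(p, 0)"] p(1) in \<open>auto intro!: derivative_eq_intros\<close>)
  moreover have "((\<lambda>z. P (p, z)) has_derivative (\<lambda>v. c1 p * v)) (at 0)"
    unfolding P_def by (auto intro!: derivative_eq_intros)
  ultimately have "(\<lambda>v. diff_at P (p, 0) (0, v)) = (\<lambda>v. c1 p * v)"
    by (rule has_derivative_unique)
  then have "diff_at P (p, 0) (0, 1) = c1 p" by (metis mult.right_neutral)
  then obtain N' e where "p \<in> N'" "holo e N'" "e p = 0"
    "\<And>q. q \<in> N' \<Longrightarrow> (q, e q) \<in> N \<times> UNIV \<and> P (q, e q) = 0"
    using holo_implicit[OF P, of p 0] p by (auto simp: P_def)
  then show ?thesis using that[of N' e] by (auto simp: P_def)
qed

section \<open>Symplectic frames and the Maurer-Cartan equation\<close>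

lemma UNIV_index: "(UNIV :: 3 set) = {0, 1, 2}"
proof -
  have "(3 :: 3) = 0" by simp
  then show ?thesis using UNIV_3 by auto
qed

lemma sum_index: "(\<Sum>i\<in>UNIV. f (i::3)) = f 0 + f 1 + f 2"
  unfolding UNIV_index by (simp add: add.assoc)

lemma all_index: "(\<forall>i::3. P i) \<longleftrightarrow> P 0 \<and> P 1 \<and> P 2"
  by (metis UNIV_I UNIV_index insertE singletonD)

lemma sum_index2: "(\<Sum>a\<in>UNIV. f (a::3+3)) = (\<Sum>i\<in>UNIV. f (Inl i)) + (\<Sum>i\<in>UNIV. f (Inr i))"
  unfolding UNIV_Plus_UNIV[symmetric] by (subst sum.Plus) auto

lemma all_index2: "(\<forall>a::3+3. P a) \<longleftrightarrow> (\<forall>i. P (Inl i)) \<and> (\<forall>i. P (Inr i))"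
  by (metis sumE)

lemma varpi_add_left: "varpi (x + y) z = varpi x z + varpi y z"
  by (simp add: varpi_def algebra_simps sum.distrib sum_subtractf)

lemma varpi_add_right: "varpi z (x + y) = varpi z x + varpi z y"
  by (simp add: varpi_def algebra_simps sum.distrib sum_subtractf)

lemma varpi_scale_left: "varpi (c *s x) z = c * varpi x z"
  by (simp add: varpi_def algebra_simps sum_distrib_left)

lemma varpi_scale_right: "varpi z (c *s x) = c * varpi z x"
  by (simp add: varpi_def algebra_simps sum_distrib_left)

lemma varpi_zero [simp]: "varpi 0 x = 0" "varpi x 0 = 0"
  by (simp_all add: varpi_def)

lemma varpi_diff_left: "varpi (x - y) z = varpi x z - varpi y z"
  by (simp add: varpi_def algebra_simps sum.distrib sum_subtractf)

lemma varpi_diff_right: "varpi z (x - y) = varpi z x - varpi z y"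
  by (simp add: varpi_def algebra_simps sum.distrib sum_subtractf)

lemma varpi_sum_left: "varpi (\<Sum>i\<in>I. f i) z = (\<Sum>i\<in>I. varpi (f i) z)"
  by (induction I rule: infinite_finite_induct) (simp_all add: varpi_add_left)

lemma varpi_sum_right: "varpi z (\<Sum>i\<in>I. f i) = (\<Sum>i\<in>I. varpi z (f i))"
  by (induction I rule: infinite_finite_induct) (simp_all add: varpi_add_right)

lemma varpi_swap: "varpi x y = - varpi y x"
  unfolding varpi_def sum_negf[symmetric] by (rule sum.cong) (simp_all add: algebra_simps)

lemma varpi_self [simp]: "varpi x x = 0"
  by (simp add: varpi_def algebra_simps)

lemma varpi_sum_sum: "varpi (\<Sum>a\<in>I. x a *s p a) (\<Sum>b\<in>K. y b *s r b) =
    (\<Sum>a\<in>I. \<Sum>b\<in>K. x a * y b * varpi (p a) (r b))"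
  by (simp only: varpi_sum_left varpi_scale_left)
    (simp only: varpi_sum_right varpi_scale_right sum_distrib_left mult.assoc)

text \<open>An index of F^-1 A lowered with the symplectic form. For \<open>A\<close> tangent to the
  group the result is symmetric, as the Lie algebra is the symmetric square of V, so omega, theta
  and eta become blocks of one symmetric matrix.\<close>

definition bform :: "frame \<Rightarrow> frame \<Rightarrow> 3 + 3 \<Rightarrow> 3 + 3 \<Rightarrow> complex" where
  "bform F A u w = varpi (column u A) (column w F)"

definition std :: "3 + 3 \<Rightarrow> 3 + 3 \<Rightarrow> complex" where
  "std u w = (case u of Inl i \<Rightarrow> (case w of Inl j \<Rightarrow> 0 | Inr j \<Rightarrow> if i = j then 1 else 0)
     | Inr i \<Rightarrow> (case w of Inl j \<Rightarrow> if i = j then - 1 else 0 | Inr j \<Rightarrow> 0))"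

lemma std_simps [simp]:
  "std (Inl i) (Inl j) = 0" "std (Inr i) (Inr j) = 0"
  "std (Inl i) (Inr j) = (if i = j then 1 else 0)"
  "std (Inr i) (Inl j) = (if i = j then - 1 else 0)"
  by (simp_all add: std_def)

lemma Sp3_iff: "F \<in> Sp3 \<longleftrightarrow> (\<forall>u w. varpi (column u F) (column w F) = std u w)"
proof safe
  fix u w assume F: "F \<in> Sp3"
  show "varpi (column u F) (column w F) = std u w"
  proof (cases u; cases w)
    fix i j assume "u = Inr i" "w = Inl j"
    then show ?thesis
      using F varpi_swap[of "column u F" "column w F"] by (simp add: Sp3_def e_vec_def f_vec_def)
  qed (use F in \<open>simp_all add: Sp3_def e_vec_def f_vec_def\<close>)
qed (simp add: Sp3_def e_vec_def f_vec_def)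

lemma Sp3_varpi: "F \<in> Sp3 \<Longrightarrow> varpi (column u F) (column w F) = std u w"
  by (simp add: Sp3_iff)

lemma column_mult: "column u ((A :: frame) ** g) = (\<Sum>a\<in>UNIV. g $ a $ u *s column a A)"
  by (simp add: vec_eq_iff column_def matrix_matrix_mult_def mult.commute[of "g $ _ $ u"])

lemma column_add: "column u (A + B) = column u A + column u B"
  by (simp add: vec_eq_iff column_def)

text \<open>The shape of \<open>A ** g + F ** g'\<close> is that of d(F g). In its second term
  \<open>F\<close> drops out because it preserves the symplectic form.\<close>

lemma bform_gauge:
  assumes "F \<in> Sp3"
  shows "bform (F ** g) (A ** g + F ** g') u w =
    (\<Sum>a\<in>UNIV. \<Sum>b\<in>UNIV. g $ a $ u * g $ b $ w * bform F A a b) +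
    (\<Sum>a\<in>UNIV. \<Sum>b\<in>UNIV. g' $ a $ u * g $ b $ w * std a b)"
  by (simp add: bform_def column_add column_mult varpi_add_left varpi_sum_sum Sp3_varpi[OF assms])

lemma Sp3_mult:
  assumes "F \<in> Sp3" "g \<in> Sp3"
  shows "F ** g \<in> Sp3"
proof -
  have "varpi (column u (F ** g)) (column w (F ** g)) = std u w" for u w
  proof -
    have "varpi (column u (F ** g)) (column w (F ** g)) =
        (\<Sum>a\<in>UNIV. \<Sum>b\<in>UNIV. g $ a $ u * g $ b $ w * std a b)"
      by (simp add: column_mult varpi_sum_sum Sp3_varpi[OF assms(1)])
    also have "\<dots> = varpi (column u g) (column w g)"
      by (simp add: sum_index2 varpi_def column_def if_distrib[of "(*) _"] sum.distrib sum_subtractf sum_negf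
          cong: if_cong)
    finally show ?thesis by (simp add: Sp3_varpi[OF assms(2)])
  qed
  then show ?thesis by (simp add: Sp3_iff)
qed

text \<open>For symplectic \<open>F\<close> this is the inverse: the coordinate of a vector along
  e_i is its pairing with f_i, and the coordinate along f_i is minus its pairing with e_i. In this
  form the entries of F^-1 dF are values of \<open>bform\<close>.\<close>

definition symp_inv :: "frame \<Rightarrow> frame" where
  "symp_inv F = (\<chi> a b. case a of Inl i \<Rightarrow> varpi (axis b 1) (column (Inr i) F)
     | Inr i \<Rightarrow> - varpi (axis b 1) (column (Inl i) F))"

lemma varpi_expand: "varpi v y = (\<Sum>b\<in>UNIV. v $ b * varpi (axis b 1) y)"
proof -
  have "v = (\<Sum>b\<in>UNIV. v $ b *s axis b 1)"
    by (simp add: vec_eq_iff axis_def if_distrib[of "(*) _"] cong: if_cong)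
  then have "varpi v y = varpi (\<Sum>b\<in>UNIV. v $ b *s axis b 1) y" by simp
  then show ?thesis by (simp add: varpi_sum_left varpi_scale_left)
qed

lemma symp_inv_mult:
  "(symp_inv F ** A) $ Inl i $ u = bform F A u (Inr i)"
  "(symp_inv F ** A) $ Inr i $ u = - bform F A u (Inl i)"
  unfolding bform_def varpi_expand[of "column u A"]
  by (simp_all add: symp_inv_def matrix_matrix_mult_def column_def mult.commute sum_negf)

lemma symp_inv_left:
  assumes "F \<in> Sp3"
  shows "symp_inv F ** F = mat 1"
proof -
  have "(symp_inv F ** F) $ a $ u = mat 1 $ a $ u" for a u
    by (cases a; cases u)
      (simp_all add: symp_inv_mult bform_def Sp3_varpi[OF assms] mat_def del: varpi_self)
  then show ?thesis by (simp add: vec_eq_iff)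
qed

lemma symp_inv_right: "F \<in> Sp3 \<Longrightarrow> F ** symp_inv F = mat 1"
  using symp_inv_left matrix_left_right_inverse by blast

lemma matrix_inv_Sp3: "F \<in> Sp3 \<Longrightarrow> matrix_inv F = symp_inv F"
proof -
  assume F: "F \<in> Sp3"
  have "F ** matrix_inv F = mat 1 \<and> matrix_inv F ** F = mat 1"
    unfolding matrix_inv_def by (rule someI[of _ "symp_inv F"]) (simp add: symp_inv_left symp_inv_right F)
  then show ?thesis
    using symp_inv_left[OF F] by (metis matrix_mul_assoc matrix_mul_lid matrix_mul_rid)
qed

lemma Sp3_expand:
  assumes "F \<in> Sp3"
  shows "v = (\<Sum>i\<in>UNIV. varpi v (column (Inr i) F) *s column (Inl i) F)
    - (\<Sum>i\<in>UNIV. varpi v (column (Inl i) F) *s column (Inr i) F)"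
proof -
  \<comment> \<open>All columns of \<open>A\<close> are \<open>v\<close>, so that F F^-1 A = A is
    the expansion of \<open>v\<close> in the frame.\<close>
  define A :: frame where "A = (\<chi> a b. v $ a )"
  have c: "column u A = v" for u by (simp add: A_def column_def vec_eq_iff)
  have "v = column (Inl 0) (F ** (symp_inv F ** A))"
    by (simp add: matrix_mul_assoc symp_inv_right[OF assms] c)
  also have "\<dots> = (\<Sum>i\<in>UNIV. varpi v (column (Inr i) F) *s column (Inl i) F)
    - (\<Sum>i\<in>UNIV. varpi v (column (Inl i) F) *s column (Inr i) F)"
    by (simp add: column_mult sum_index2 symp_inv_mult bform_def c sum_negf)
  finally show ?thesis .
qed

text \<open>The pairing in coordinates of a symplectic frame. It turns the pairings of first
  derivatives in the structure equation into products of Maurer-Cartan components.\<close>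

lemma varpi_frame:
  assumes "F \<in> Sp3"
  shows "varpi x y = (\<Sum>i\<in>UNIV. varpi x (column (Inl i) F) * varpi y (column (Inr i) F)
    - varpi x (column (Inr i) F) * varpi y (column (Inl i) F))"
proof -
  have "varpi x y = varpi x ((\<Sum>i\<in>UNIV. varpi y (column (Inr i) F) *s column (Inl i) F)
    - (\<Sum>i\<in>UNIV. varpi y (column (Inl i) F) *s column (Inr i) F))"
    by (subst Sp3_expand[OF assms, of y]) rule
  then show ?thesis
    by (simp add: varpi_diff_right varpi_sum_right varpi_scale_right sum_subtractf mult.commute)
qed

section \<open>The Maurer-Cartan form along a section\<close>

lemma holo_entry:
  fixes s :: "'a::complex_space \<Rightarrow> frame"
  shows "holo s N \<Longrightarrow> holo (\<lambda>q. s q $ a $ u) N"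
  by (intro holo_vec_nth)

lemma diff_at_entry:
  fixes s :: "'a::complex_space \<Rightarrow> frame"
  assumes "holo s N" "q \<in> N"
  shows "diff_at (\<lambda>q. s q $ a $ u) q v = diff_at s q v $ a $ u"
  by (simp add: diff_at_vec_nth[OF holo_vec_nth[OF assms(1)] assms(2)] diff_at_vec_nth[OF assms])

lemma bform_entries:
  "bform F A u w = (\<Sum>i\<in>UNIV. A $ Inl i $ u * F $ Inr i $ w - A $ Inr i $ u * F $ Inl i $ w)"
  by (simp add: bform_def varpi_def column_def)

text \<open>The pairing of columns \<open>u\<close> and \<open>w\<close> is constant. By
  antisymmetry of \<open>varpi\<close>, its derivative is the difference of the two sides.\<close>

lemma bform_tangent_sym:
  fixes s :: "'a::complex_space \<Rightarrow> frame"
  assumes s: "holo s N" "s ` N \<subseteq> Sp3" and q: "q \<in> N"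
  shows "bform (s q) (diff_at s q v) u w = bform (s q) (diff_at s q v) w u"
proof -
  note h = holo_entry[OF s(1)]
  let ?f = "\<lambda>q. \<Sum>i\<in>UNIV. s q $ Inl i $ u * s q $ Inr i $ w - s q $ Inr i $ u * s q $ Inl i $ w"
  have "?f q = std u w" if "q \<in> N" for q
    using Sp3_varpi[of "s q" u w] s(2) that by (auto simp: varpi_def column_def)
  then have "diff_at ?f q v = diff_at (\<lambda>_. std u w) q v"
    by (intro fun_cong[OF diff_at_cong[OF holo_open[OF s(1)] q]])
  then have "diff_at ?f q v = 0" by simp
  moreover have "diff_at ?f q v = bform (s q) (diff_at s q v) u w - bform (s q) (diff_at s q v) w u"
    unfolding bform_entries
    by (simp add: diff_at_sum[OF holo_diff[OF holo_mult[OF h h] holo_mult[OF h h]] q]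
        diff_at_diff[OF holo_mult[OF h h] holo_mult[OF h h] q] diff_at_mult[OF h h q]
        diff_at_entry[OF s(1) q] flip: sum_subtractf) (simp add: algebra_simps)
  ultimately show ?thesis by simp
qed

text \<open>With \<open>E\<^sub>i = Inl i\<close> and \<open>F\<^sub>i = Inr i\<close>, the entries of the Maurer-Cartan form on \<open>V\<close> are
  \<open>\<omega>\<^sub>i\<^sub>j = mcf s V E\<^sub>j F\<^sub>i\<close>, \<open>\<theta>\<^sub>i\<^sub>j = - mcf s V E\<^sub>j E\<^sub>i\<close> and \<open>\<eta>\<^sub>i\<^sub>j = mcf s V F\<^sub>j F\<^sub>i\<close>.\<close>

definition mcf :: "(surf \<Rightarrow> frame) \<Rightarrow> (surf \<Rightarrow> surf) \<Rightarrow> 3 + 3 \<Rightarrow> 3 + 3 \<Rightarrow> surf \<Rightarrow> complex" where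
  "mcf s V u w q = bform (s q) (diff_at s q (V q)) u w"

lemma mcf_eq:
  assumes "holo s N" "q \<in> N"
  shows "mcf s V u w q = (\<Sum>i\<in>UNIV. diff_at (\<lambda>q. s q $ Inl i $ u) q (V q) * s q $ Inr i $ w
    - diff_at (\<lambda>q. s q $ Inr i $ u) q (V q) * s q $ Inl i $ w)"
  by (simp add: mcf_def bform_entries diff_at_entry[OF assms])

lemma holo_mcf:
  assumes s: "holo s N" and V: "holo V N"
  shows "holo (mcf s V u w) N"
proof (rule holo_cong[OF _ mcf_eq[OF s, symmetric]])
  show "holo (\<lambda>q. \<Sum>i\<in>UNIV. diff_at (\<lambda>q. s q $ Inl i $ u) q (V q) * s q $ Inr i $ w
    - diff_at (\<lambda>q. s q $ Inr i $ u) q (V q) * s q $ Inl i $ w) N"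
    by (intro holo_sum holo_diff holo_mult holo_diff_at holo_entry s V holo_open[OF s])
qed simp

lemma mcf_sym:
  assumes "holo s N" "s ` N \<subseteq> Sp3" "q \<in> N"
  shows "mcf s V u w q = mcf s V w u q"
  unfolding mcf_def by (rule bform_tangent_sym[OF assms])

text \<open>The product rule, with second derivatives of column \<open>u\<close> in the sum and two
  first derivatives paired in the last term. On antisymmetrizing in two fields, the sum becomes a
  derivative along the bracket and the last term becomes the quadratic part of the structure
  equation.\<close>

lemma diff_at_mcf:
  assumes s: "holo s N" and V: "holo V N" and q: "q \<in> N"
  shows "diff_at (mcf s V u w) q v =
    (\<Sum>i\<in>UNIV. diff_at (\<lambda>q. diff_at (\<lambda>q. s q $ Inl i $ u) q (V q)) q v * s q $ Inr i $ w
      - diff_at (\<lambda>q. diff_at (\<lambda>q. s q $ Inr i $ u) q (V q)) q v * s q $ Inl i $ w)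
    + varpi (column u (diff_at s q (V q))) (column w (diff_at s q v))"
proof -
  note h = holo_entry[OF s]
  note d = holo_diff_at[OF h V]
  have "diff_at (mcf s V u w) q v = diff_at (\<lambda>q. \<Sum>i\<in>UNIV. diff_at (\<lambda>q. s q $ Inl i $ u) q (V q) * s q $ Inr i $ w
    - diff_at (\<lambda>q. s q $ Inr i $ u) q (V q) * s q $ Inl i $ w) q v"
    by (rule fun_cong[OF diff_at_cong[OF holo_open[OF s] q mcf_eq[OF s]]])
  also have "\<dots> = (\<Sum>i\<in>UNIV. diff_at (\<lambda>q. diff_at (\<lambda>q. s q $ Inl i $ u) q (V q)) q v * s q $ Inr i $ w
      - diff_at (\<lambda>q. diff_at (\<lambda>q. s q $ Inr i $ u) q (V q)) q v * s q $ Inl i $ w)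
    + (\<Sum>i\<in>UNIV. diff_at (\<lambda>q. s q $ Inl i $ u) q (V q) * diff_at (\<lambda>q. s q $ Inr i $ w) q v
      - diff_at (\<lambda>q. s q $ Inr i $ u) q (V q) * diff_at (\<lambda>q. s q $ Inl i $ w) q v)"
    unfolding sum.distrib[symmetric]
    by (simp add: diff_at_sum[OF holo_diff[OF holo_mult[OF d h] holo_mult[OF d h]] q]
        diff_at_diff[OF holo_mult[OF d h] holo_mult[OF d h] q] diff_at_mult[OF d h q])
      (simp add: algebra_simps)
  finally show ?thesis
    by (simp add: varpi_def column_def diff_at_entry[OF s q])
qed

text \<open>The Maurer-Cartan equation \<open>d\<phi> + \<phi> \<and> \<phi> = 0\<close>, evaluated on the fields \<open>V\<close> and \<open>W\<close>.\<close>

lemma mcf_structure: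
  assumes s: "holo s N" "s ` N \<subseteq> Sp3" and V: "holo V N" and W: "holo W N" and q: "q \<in> N"
    and span: "\<And>v. \<exists>c d. v = c *s V q + d *s W q"
  obtains c d where "\<And>u w. diff_at (mcf s W u w) q (V q) - diff_at (mcf s V u w) q (W q) =
    c * mcf s V u w q + d * mcf s W u w q +
    (\<Sum>i\<in>UNIV. mcf s W u (Inl i) q * mcf s V w (Inr i) q - mcf s W u (Inr i) q * mcf s V w (Inl i) q
      - mcf s V u (Inl i) q * mcf s W w (Inr i) q + mcf s V u (Inr i) q * mcf s W w (Inl i) q)"
proof -
  \<comment> \<open>The Lie bracket of \<open>V\<close> and \<open>W\<close> at \<open>q\<close>.
    Its components do not depend on the indices \<open>u\<close>, \<open>w\<close>, so two equations
    suffice to find them.\<close>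
  let ?Z = "diff_at W q (V q) - diff_at V q (W q)"
  obtain c d where Z: "?Z = c *s V q + d *s W q" using span by blast
  note h = holo_entry[OF s(1)]
  have sq: "s q \<in> Sp3" using s(2) q by auto
  show ?thesis
  proof (rule that[of c d])
    fix u w
    let ?D = "\<lambda>a. diff_at (\<lambda>q. s q $ a $ u) q"
    have Z': "?D a ?Z = c * ?D a (V q) + d * ?D a (W q)" for a
      unfolding Z cscale_vector[symmetric] holo_diff_add[OF h q] holo_diff_cscale[OF h q]
      by simp
    have "diff_at (mcf s W u w) q (V q) - diff_at (mcf s V u w) q (W q) =
      (\<Sum>i\<in>UNIV. ?D (Inl i) ?Z * s q $ Inr i $ w - ?D (Inr i) ?Z * s q $ Inl i $ w)
      + varpi (column u (diff_at s q (W q))) (column w (diff_at s q (V q)))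
      - varpi (column u (diff_at s q (V q))) (column w (diff_at s q (W q)))"
      unfolding diff_at_mcf[OF s(1) V q] diff_at_mcf[OF s(1) W q]
        diff_at_commutator[OF h V W q, symmetric]
      by (simp add: sum_index) (simp add: algebra_simps)
    also have "(\<Sum>i\<in>UNIV. ?D (Inl i) ?Z * s q $ Inr i $ w - ?D (Inr i) ?Z * s q $ Inl i $ w) =
        c * mcf s V u w q + d * mcf s W u w q"
      unfolding Z' mcf_eq[OF s(1) q] by (simp add: sum_index) (simp add: algebra_simps)
    moreover have "varpi (column u (diff_at s q x)) (column w (diff_at s q y)) =
        (\<Sum>i\<in>UNIV. bform (s q) (diff_at s q x) u (Inl i) * bform (s q) (diff_at s q y) w (Inr i)
          - bform (s q) (diff_at s q x) u (Inr i) * bform (s q) (diff_at s q y) w (Inl i))" for x y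
      unfolding bform_def by (rule varpi_frame[OF sq])
    ultimately show "diff_at (mcf s W u w) q (V q) - diff_at (mcf s V u w) q (W q) =
      c * mcf s V u w q + d * mcf s W u w q +
      (\<Sum>i\<in>UNIV. mcf s W u (Inl i) q * mcf s V w (Inr i) q - mcf s W u (Inr i) q * mcf s V w (Inl i) q
      - mcf s V u (Inl i) q * mcf s W w (Inr i) q + mcf s V u (Inr i) q * mcf s W w (Inl i) q)"
      unfolding mcf_def by (simp add: sum_subtractf sum.distrib)
  qed
qed

section \<open>Adapted frames and gauge transformations\<close>

abbreviation E0 :: "3 + 3" where "E0 \<equiv> Inl 0"
abbreviation E1 :: "3 + 3" where "E1 \<equiv> Inl 1"
abbreviation E2 :: "3 + 3" where "E2 \<equiv> Inl 2"
abbreviation F0 :: "3 + 3" where "F0 \<equiv> Inr 0"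
abbreviation F1 :: "3 + 3" where "F1 \<equiv> Inr 1"
abbreviation F2 :: "3 + 3" where "F2 \<equiv> Inr 2"

lemma has_derivative_matrix_mult:
  fixes s g :: "'a::real_normed_vector \<Rightarrow> frame"
  assumes "(s has_derivative s') (at q)" "(g has_derivative g') (at q)"
  shows "((\<lambda>q. s q ** g q) has_derivative (\<lambda>v. s' v ** g q + s q ** g' v)) (at q)"
proof (intro has_derivative_vec)
  fix a u
  have e: "((\<lambda>q. s q $ a $ b) has_derivative (\<lambda>v. s' v $ a $ b)) (at q)"
    "((\<lambda>q. g q $ a $ b) has_derivative (\<lambda>v. g' v $ a $ b)) (at q)" for a b
    using assms by (auto intro!: bounded_linear.has_derivative[OF bounded_linear_vec_nth])
  show "((\<lambda>q. (s q ** g q) $ a $ u) has_derivative (\<lambda>v. (s' v ** g q + s q ** g' v) $ a $ u)) (at q)"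
    unfolding matrix_matrix_mult_def
    by (auto intro!: derivative_eq_intros e simp: sum.distrib algebra_simps)
qed

lemma matrix_entry: "((A :: frame) ** B) $ a $ u = (\<Sum>b\<in>UNIV. A $ a $ b * B $ b $ u)"
  by (simp add: matrix_matrix_mult_def)

lemma holo_frameI:
  fixes s :: "'a::complex_space \<Rightarrow> frame"
  shows "(\<And>a u. holo (\<lambda>q. s q $ a $ u) N) \<Longrightarrow> holo s N"
  by (intro holo_vecI)

lemma holo_matrix_mult:
  fixes s g :: "'a::complex_space \<Rightarrow> frame"
  assumes "holo s N" "holo g N"
  shows "holo (\<lambda>q. s q ** g q) N"
  by (rule holo_frameI) (auto simp: matrix_entry intro!: holo_sum holo_mult holo_entry assms holo_open[OF assms(1)])

lemma mcf_gauge: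
  assumes s: "holo s N" "s ` N \<subseteq> Sp3" and g: "holo g N" and q: "q \<in> N"
  shows "mcf (\<lambda>q. s q ** g q) X u w q =
    (\<Sum>a\<in>UNIV. \<Sum>b\<in>UNIV. g q $ a $ u * g q $ b $ w * mcf s X a b q) +
    (\<Sum>a\<in>UNIV. \<Sum>b\<in>UNIV. diff_at (\<lambda>q. g q $ a $ u) q (X q) * g q $ b $ w * std a b)"
proof -
  have "diff_at (\<lambda>q. s q ** g q) q (X q) = diff_at s q (X q) ** g q + s q ** diff_at g q (X q)"
    using diff_at_eq[OF has_derivative_matrix_mult[OF holo_has_derivative[OF s(1) q]
      holo_has_derivative[OF g q]]] by simp
  then show ?thesis
    unfolding mcf_def using s(2) q by (simp add: bform_gauge diff_at_entry[OF g q] image_subset_iff)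
qed

text \<open>The form is tensorial in its field argument: a change of the dual fields by functions
  produces no derivatives of these functions.\<close>

lemma mcf_linear:
  assumes "holo s N" "q \<in> N"
  shows "mcf s (\<lambda>q. c q *s V q + d q *s W q) u w q = c q * mcf s V u w q + d q * mcf s W u w q"
proof -
  have "diff_at s q (c q *s V q + d q *s W q) $ a = c q *s diff_at s q (V q) $ a + d q *s diff_at s q (W q) $ a" for a
    unfolding cscale_vector[symmetric] holo_diff_add[OF assms] holo_diff_cscale[OF assms]
    by (simp add: cscale_vec)
  then show ?thesis
    unfolding mcf_def bform_entries by (simp add: sum_index) (simp add: algebra_simps)
qed

text \<open>\<open>V\<close> and \<open>W\<close> are the vector fields dual to the coframe \<open>\<omega>\<^sup>1, \<omega>\<^sup>2\<close>.\<close>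

definition adapted :: "(surf \<Rightarrow> V6 set) \<Rightarrow> (surf \<Rightarrow> frame) \<Rightarrow> (surf \<Rightarrow> surf) \<Rightarrow> (surf \<Rightarrow> surf)
    \<Rightarrow> surf set \<Rightarrow> bool" where
  "adapted x s V W N \<longleftrightarrow> holo s N \<and> holo V N \<and> holo W N \<and> s ` N \<subseteq> Sp3 \<and>
    (\<forall>q\<in>N. frame_flag (s q) = legendre_lift x q \<and>
      (\<forall>v. \<exists>c d. v = c *s V q + d *s W q) \<and>
      (\<forall>X\<in>{V, W}. mcf s X E0 E0 q = 0 \<and> mcf s X E0 E1 q = 0 \<and> mcf s X E0 E2 q = 0) \<and>
      mcf s V E0 F1 q = 1 \<and> mcf s W E0 F1 q = 0 \<and> mcf s V E0 F2 q = 0 \<and> mcf s W E0 F2 q = 1)"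

lemma adapted_holo: "adapted x s V W N \<Longrightarrow> holo s N \<and> holo V N \<and> holo W N \<and> s ` N \<subseteq> Sp3"
  by (simp add: adapted_def)

lemma adapted_subset: "adapted x s V W N \<Longrightarrow> open N' \<Longrightarrow> N' \<subseteq> N \<Longrightarrow> adapted x s V W N'"
  unfolding adapted_def by (meson holo_subset image_mono order_trans subsetD)

text \<open>The stabilizer of the flag formed by the line of e_0 and the Lagrangian subspace of e_0,
  e_1, e_2, which is the structure group of the frame bundle.\<close>

definition parabolic :: "frame \<Rightarrow> bool" where
  "parabolic g \<longleftrightarrow> g \<in> Sp3 \<and> (\<forall>i j. g $ Inr i $ Inl j = 0) \<and> g $ E1 $ E0 = 0 \<and> g $ E2 $ E0 = 0"

text \<open>As the lower left block vanishes, the symplectic condition makes the lower right block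
  the inverse transpose of the upper left one.\<close>

lemma parabolic_dual:
  assumes "parabolic g"
  shows "(\<Sum>k\<in>UNIV. g $ Inl k $ Inl i * g $ Inr k $ Inr j) = (if i = j then 1 else 0)"
  using assms Sp3_varpi[of g "Inl i" "Inr j"] unfolding parabolic_def
  by (simp add: varpi_def column_def)

lemma parabolic_entries:
  assumes "parabolic g"
  shows "g $ E0 $ E0 \<noteq> 0" "g $ F0 $ F1 = 0" "g $ F0 $ F2 = 0"
    "g $ E1 $ E1 * g $ F1 $ F1 + g $ E2 $ E1 * g $ F2 $ F1 = 1"
    "g $ E1 $ E2 * g $ F1 $ F1 + g $ E2 $ E2 * g $ F2 $ F1 = 0"
    "g $ E1 $ E1 * g $ F1 $ F2 + g $ E2 $ E1 * g $ F2 $ F2 = 0"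
    "g $ E1 $ E2 * g $ F1 $ F2 + g $ E2 $ E2 * g $ F2 $ F2 = 1"
    "g $ E1 $ E1 * g $ E2 $ E2 - g $ E1 $ E2 * g $ E2 $ E1 \<noteq> 0"
proof -
  have z: "g $ E1 $ E0 = 0" "g $ E2 $ E0 = 0" using assms by (auto simp: parabolic_def)
  have d: "g $ E0 $ Inl i * g $ F0 $ Inr j + g $ E1 $ Inl i * g $ F1 $ Inr j + g $ E2 $ Inl i * g $ F2 $ Inr j
      = (if i = j then 1 else 0)" for i j
    using parabolic_dual[OF assms, of i j] by (simp add: sum_index)
  show h: "g $ E0 $ E0 \<noteq> 0" using d[of 0 0] z by auto
  show f: "g $ F0 $ F1 = 0" "g $ F0 $ F2 = 0" using d[of 0 1] d[of 0 2] z h by auto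
  show r: "g $ E1 $ E1 * g $ F1 $ F1 + g $ E2 $ E1 * g $ F2 $ F1 = 1"
    "g $ E1 $ E2 * g $ F1 $ F1 + g $ E2 $ E2 * g $ F2 $ F1 = 0"
    "g $ E1 $ E1 * g $ F1 $ F2 + g $ E2 $ E1 * g $ F2 $ F2 = 0"
    "g $ E1 $ E2 * g $ F1 $ F2 + g $ E2 $ E2 * g $ F2 $ F2 = 1"
    using d[of 1 1] d[of 2 1] d[of 1 2] d[of 2 2] f by auto
  \<comment> \<open>Multiplicativity of the determinant: the two by two blocks on e_1, e_2 and on
    f_1, f_2 have determinants with product 1.\<close>
  have "(g $ E1 $ E1 * g $ E2 $ E2 - g $ E1 $ E2 * g $ E2 $ E1) *
      (g $ F1 $ F1 * g $ F2 $ F2 - g $ F1 $ F2 * g $ F2 $ F1) =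
      (g $ E1 $ E1 * g $ F1 $ F1 + g $ E2 $ E1 * g $ F2 $ F1) *
        (g $ E1 $ E2 * g $ F1 $ F2 + g $ E2 $ E2 * g $ F2 $ F2) -
      (g $ E1 $ E2 * g $ F1 $ F1 + g $ E2 $ E2 * g $ F2 $ F1) *
        (g $ E1 $ E1 * g $ F1 $ F2 + g $ E2 $ E1 * g $ F2 $ F2)"
    by (simp add: algebra_simps)
  also have "\<dots> = 1" unfolding r by simp
  finally show "g $ E1 $ E1 * g $ E2 $ E2 - g $ E1 $ E2 * g $ E2 $ E1 \<noteq> 0" by auto
qed

lemma inverse_scale: "c \<noteq> 0 \<Longrightarrow> inverse c *s (c *s v) = (v :: complex ^ 'n)"
  by (simp add: vector_smult_assoc)

lemma span_scale_singleton: "c \<noteq> 0 \<Longrightarrow> vec.span {c *s v} = vec.span {v :: V6}"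
proof
  assume c: "c \<noteq> 0"
  show "vec.span {c *s v} \<subseteq> vec.span {v}"
    by (intro vec.span_minimal vec.subspace_span) (auto intro: vec.span_scale vec.span_base)
  have "v = inverse c *s (c *s v)" using c by simp
  then have "v \<in> vec.span {c *s v}" by (metis vec.span_scale vec.span_base insertI1)
  then show "vec.span {v} \<subseteq> vec.span {c *s v}"
    by (intro vec.span_minimal vec.subspace_span) auto
qed

text \<open>One inclusion of spans is immediate. For the other, e_1 and e_2 are recovered from the
  new vectors by Cramer's rule in the two by two block.\<close>

lemma frame_flag_parabolic:
  assumes g: "parabolic g"
  shows "frame_flag (F ** g) = frame_flag F"
proof -
  note p = parabolic_entries[OF g]
  have z: "g $ Inr i $ Inl j = 0" "g $ E1 $ E0 = 0" "g $ E2 $ E0 = 0" for i j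
    using g by (auto simp: parabolic_def)
  have c: "e_vec (F ** g) i = g $ E0 $ Inl i *s e_vec F 0 + g $ E1 $ Inl i *s e_vec F 1
      + g $ E2 $ Inl i *s e_vec F 2" for i
    by (simp add: e_vec_def column_mult sum_index2 sum_index z)
  have sub: "vec.span (e_vec (F ** g) ` UNIV) \<subseteq> vec.span (e_vec F ` UNIV)" (is "?A \<subseteq> ?B")
  proof (rule vec.span_minimal[OF image_subsetI vec.subspace_span])
    show "e_vec (F ** g) i \<in> vec.span (e_vec F ` UNIV)" for i
      unfolding c by (intro vec.span_add vec.span_scale vec.span_base rangeI)
  qed
  have e0: "e_vec (F ** g) 0 = g $ E0 $ E0 *s e_vec F 0" by (simp add: c z)
  have "e_vec F 0 = inverse (g $ E0 $ E0) *s e_vec (F ** g) 0"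
    using p(1) by (simp add: e0)
  then have i0: "e_vec F 0 \<in> ?A" by (metis vec.span_scale vec.span_base rangeI)
  let ?d = "g $ E1 $ E1 * g $ E2 $ E2 - g $ E1 $ E2 * g $ E2 $ E1"
  have e1: "?d *s e_vec F 1 = g $ E2 $ E2 *s (e_vec (F ** g) 1 - g $ E0 $ E1 *s e_vec F 0)
      - g $ E2 $ E1 *s (e_vec (F ** g) 2 - g $ E0 $ E2 *s e_vec F 0)"
    by (simp add: vec_eq_iff c algebra_simps)
  have e2: "?d *s e_vec F 2 = g $ E1 $ E1 *s (e_vec (F ** g) 2 - g $ E0 $ E2 *s e_vec F 0)
      - g $ E1 $ E2 *s (e_vec (F ** g) 1 - g $ E0 $ E1 *s e_vec F 0)"
    by (simp add: vec_eq_iff c algebra_simps)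
  have A: "?d *s e_vec F 1 \<in> ?A" "?d *s e_vec F 2 \<in> ?A"
    unfolding e1 e2 by (intro vec.span_diff vec.span_scale vec.span_base i0 rangeI)+
  have "inverse ?d *s (?d *s v) = v" for v :: V6 by (rule inverse_scale[OF p(8)])
  then have "e_vec F 1 \<in> ?A" "e_vec F 2 \<in> ?A"
    using A[THEN vec.span_scale, of "inverse ?d"] by simp_all
  then have "vec.span (e_vec F ` UNIV) \<subseteq> ?A"
    using i0 by (intro vec.span_minimal vec.subspace_span) (auto simp: UNIV_index)
  with sub have "vec.span {e_vec (F ** g) 0, e_vec (F ** g) 1, e_vec (F ** g) 2} =
      vec.span {e_vec F 0, e_vec F 1, e_vec F 2}"
    by (auto simp: UNIV_index)
  then show ?thesis
    unfolding frame_flag_def e0 using span_scale_singleton[OF p(1)] by simp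
qed

text \<open>With h the first diagonal entry and A the block on e_1, e_2, the column (omega^1,
  omega^2) is multiplied by h A^-1; the dual fields are therefore transformed by the columns of A /
  h.\<close>

lemma adapted_gauge:
  assumes ad: "adapted x s V W N" and g: "holo g N" "\<And>q. q \<in> N \<Longrightarrow> parabolic (g q)"
  shows "adapted x (\<lambda>q. s q ** g q)
    (\<lambda>q. (g q $ E1 $ E1 / g q $ E0 $ E0) *s V q + (g q $ E2 $ E1 / g q $ E0 $ E0) *s W q)
    (\<lambda>q. (g q $ E1 $ E2 / g q $ E0 $ E0) *s V q + (g q $ E2 $ E2 / g q $ E0 $ E0) *s W q) N"
    (is "adapted x ?s ?V ?W N")
proof -
  have s: "holo s N" "s ` N \<subseteq> Sp3" and V: "holo V N" and W: "holo W N"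
    using ad by (auto simp: adapted_def)
  note e = holo_entry[OF g(1)]
  have div: "holo (\<lambda>q. g q $ Inl i $ Inl j / g q $ E0 $ E0) N" for i j
    by (intro holo_divide e) (rule parabolic_entries(1)[OF g(2)])
  have lin: "holo (\<lambda>q. c q *s V q + d q *s W q) N" if "holo c N" "holo d N" for c d
    using that by (intro holo_vecI) (auto intro!: holo_add holo_mult holo_vec_nth V W)
  have sp: "?s ` N \<subseteq> Sp3"
    using s(2) g(2) by (auto simp: parabolic_def intro!: Sp3_mult)
  have fl: "frame_flag (?s q) = legendre_lift x q" if "q \<in> N" for q
    using ad that by (simp add: frame_flag_parabolic[OF g(2)] adapted_def)
  have spn: "\<exists>c d. v = c *s ?V q + d *s ?W q" if q: "q \<in> N" for v q
  proof -
    note p = parabolic_entries[OF g(2)[OF q]]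
    obtain a b where v: "v = a *s V q + b *s W q"
      using ad q unfolding adapted_def by blast
    let ?g = "g q" let ?h = "?g $ E0 $ E0"
    let ?d = "?g $ E1 $ E1 * ?g $ E2 $ E2 - ?g $ E1 $ E2 * ?g $ E2 $ E1"
    have v1: "?h *s ?V q = ?g $ E1 $ E1 *s V q + ?g $ E2 $ E1 *s W q"
      and w1: "?h *s ?W q = ?g $ E1 $ E2 *s V q + ?g $ E2 $ E2 *s W q"
      using p(1) by (simp_all add: vec_eq_iff distrib_left)
    have "?d *s v = (a * ?g $ E2 $ E2 - b * ?g $ E1 $ E2) *s (?h *s ?V q)
        + (b * ?g $ E1 $ E1 - a * ?g $ E2 $ E1) *s (?h *s ?W q)"
      unfolding v1 w1 v by (simp add: vec_eq_iff algebra_simps)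
    then have "inverse ?d *s (?d *s v) = (inverse ?d * (a * ?g $ E2 $ E2 - b * ?g $ E1 $ E2) * ?h) *s ?V q
        + (inverse ?d * (b * ?g $ E1 $ E1 - a * ?g $ E2 $ E1) * ?h) *s ?W q"
      by (simp only: vector_smult_assoc vector_add_ldistrib mult.assoc)
    moreover have "inverse ?d *s (?d *s v) = v" by (rule inverse_scale[OF p(8)])
    ultimately show ?thesis by metis
  qed
  have contact: "mcf ?s X E0 E0 q = 0 \<and> mcf ?s X E0 E1 q = 0 \<and> mcf ?s X E0 E2 q = 0 \<and>
      mcf ?s X E0 F1 q = g q $ E0 $ E0 * (g q $ F1 $ F1 * mcf s X E0 F1 q + g q $ F2 $ F1 * mcf s X E0 F2 q) \<and>
      mcf ?s X E0 F2 q = g q $ E0 $ E0 * (g q $ F1 $ F2 * mcf s X E0 F1 q + g q $ F2 $ F2 * mcf s X E0 F2 q)"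
    if q: "q \<in> N" and X: "X = (\<lambda>q. c q *s V q + d q *s W q)" for X q c d
  proof -
    have z: "g q $ Inr i $ Inl j = 0" "g q $ E1 $ E0 = 0" "g q $ E2 $ E0 = 0"
      if "q \<in> N" for i j q
      using g(2)[OF that] by (auto simp: parabolic_def)
    \<comment> \<open>The entries vanish on the whole open set \<open>N\<close>, so their
      derivatives vanish too and the inhomogeneous term of \<open>mcf_gauge\<close> has no
      contribution from them.\<close>
    have dz: "diff_at (\<lambda>q. g q $ a $ E0) q v = 0" if "a \<noteq> E0" for a v
    proof -
      have "diff_at (\<lambda>q. g q $ a $ E0) q = diff_at (\<lambda>_. 0 :: complex) q"
      proof (rule diff_at_cong[OF holo_open[OF s(1)] q])
        fix q assume "q \<in> N"
        show "g q $ a $ E0 = 0"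
        proof (cases a)
          case (Inl i)
          moreover have "i = 0 \<or> i = 1 \<or> i = 2" using UNIV_index by auto
          ultimately show ?thesis using z[OF \<open>q \<in> N\<close>] that by auto
        qed (simp add: z[OF \<open>q \<in> N\<close>])
      qed
      then show ?thesis by simp
    qed
    have c: "mcf s X E0 E0 q = 0" "mcf s X E0 E1 q = 0" "mcf s X E0 E2 q = 0"
      using ad q unfolding X adapted_def by (simp_all add: mcf_linear[OF s(1) q])
    note p = parabolic_entries[OF g(2)[OF q]]
    show ?thesis
      by (simp add: mcf_gauge[OF s g(1) q] sum_index2 sum_index z[OF q] dz c p(2,3))
         (simp add: algebra_simps)
  qed
  have cf: "mcf ?s ?V E0 F1 q = 1 \<and> mcf ?s ?W E0 F1 q = 0 \<and> mcf ?s ?V E0 F2 q = 0 \<and> mcf ?s ?W E0 F2 q = 1"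
    if q: "q \<in> N" for q
  proof -
    have c: "mcf s V E0 F1 q = 1" "mcf s W E0 F1 q = 0" "mcf s V E0 F2 q = 0" "mcf s W E0 F2 q = 1"
      using ad q by (simp_all add: adapted_def)
    note p = parabolic_entries[OF g(2)[OF q]]
    show ?thesis
      using contact[OF q refl] p
      by (simp add: mcf_linear[OF s(1) q] c mult.commute add_divide_distrib[symmetric])
  qed
  show ?thesis
    unfolding adapted_def
  proof (intro conjI ballI)
    fix q X assume q: "q \<in> N" and "X \<in> {?V, ?W}"
    then show "mcf ?s X E0 E0 q = 0" "mcf ?s X E0 E1 q = 0" "mcf ?s X E0 E2 q = 0"
      by (elim insertE emptyE; simp only: contact[OF q refl])+
  qed (use cf in \<open>simp_all only: holo_matrix_mult[OF s(1) g(1)] lin[OF div div] sp fl spn simp_thms\<close>)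
qed

section \<open>Shears, translations and the Levi factor of the parabolic group\<close>

definition shear :: "(3 \<Rightarrow> 3 \<Rightarrow> complex) \<Rightarrow> frame" where
  "shear S = (\<chi> a b. case b of
     Inl j \<Rightarrow> (case a of Inl i \<Rightarrow> if i = j then 1 else 0 | Inr i \<Rightarrow> 0)
   | Inr j \<Rightarrow> (case a of Inl i \<Rightarrow> S i j | Inr i \<Rightarrow> if i = j then 1 else 0))"

text \<open>Moves e_1 and e_2 along e_0; the entries -p and -r in the column of f_0 are forced by
  duality.\<close>

definition transl :: "complex \<Rightarrow> complex \<Rightarrow> frame" where
  "transl p r = (\<chi> a b. case b of
     Inl j \<Rightarrow> (case a of Inl i \<Rightarrow> if i = j then 1 else if i = 0 then (if j = 1 then p else r) else 0
       | Inr i \<Rightarrow> 0)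
   | Inr j \<Rightarrow> (case a of Inl i \<Rightarrow> 0
       | Inr i \<Rightarrow> if i = j then 1 else if j = 0 then (if i = 1 then - p else - r) else 0))"

text \<open>Block diagonal: \<open>h\<close> on e_0, the matrix with rows (a, b) and (c, d) on e_1,
  e_2, and the inverse transpose on the \<open>f\<close> vectors.\<close>

definition levi :: "complex \<Rightarrow> complex \<Rightarrow> complex \<Rightarrow> complex \<Rightarrow> complex \<Rightarrow> frame" where
  "levi h a b c d = (\<chi> k l. case l of
     Inl j \<Rightarrow> (case k of Inl i \<Rightarrow> if i = 0 then (if j = 0 then h else 0) else if j = 0 then 0
         else if i = 1 then (if j = 1 then a else b) else (if j = 1 then c else d)
       | Inr i \<Rightarrow> 0)
   | Inr j \<Rightarrow> (case k of Inl i \<Rightarrow> 0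
       | Inr i \<Rightarrow> if i = 0 then (if j = 0 then inverse h else 0) else if j = 0 then 0
         else (if i = 1 then (if j = 1 then d else - c) else (if j = 1 then - b else a)) / (a * d - b * c)))"

lemma shear_entries [simp]:
  "shear S $ Inl i $ Inl j = (if i = j then 1 else 0)" "shear S $ Inr i $ Inl j = 0"
  "shear S $ Inl i $ Inr j = S i j" "shear S $ Inr i $ Inr j = (if i = j then 1 else 0)"
  by (simp_all add: shear_def)

lemma transl_entries:
  "transl p r $ Inl i $ Inl j = (if i = j then 1 else if i = 0 then (if j = 1 then p else r) else 0)"
  "transl p r $ Inr i $ Inl j = 0" "transl p r $ Inl i $ Inr j = 0"
  "transl p r $ Inr i $ Inr j = (if i = j then 1 else if j = 0 then (if i = 1 then - p else - r) else 0)"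
  by (simp_all add: transl_def)

lemma levi_entries:
  "levi h a b c d $ Inl i $ Inl j = (if i = 0 then (if j = 0 then h else 0) else if j = 0 then 0
         else if i = 1 then (if j = 1 then a else b) else (if j = 1 then c else d))"
  "levi h a b c d $ Inr i $ Inl j = 0" "levi h a b c d $ Inl i $ Inr j = 0"
  "levi h a b c d $ Inr i $ Inr j = (if i = 0 then (if j = 0 then inverse h else 0) else if j = 0 then 0
         else (if i = 1 then (if j = 1 then d else - c) else (if j = 1 then - b else a)) / (a * d - b * c))"
  by (simp_all add: levi_def)

lemma parabolic_shear: "(\<And>i j. S i j = S j i) \<Longrightarrow> parabolic (shear S)"
  unfolding parabolic_def Sp3_iff all_index2
  by (auto simp: varpi_def column_def if_distrib[of "\<lambda>x. x * _"] if_distrib[of "(*) _"] sum_subtractf sum_negf cong: if_cong)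

lemma parabolic_transl: "parabolic (transl p r)"
  unfolding parabolic_def Sp3_iff all_index2 all_index
  by (simp add: varpi_def column_def transl_entries sum_index)

lemma parabolic_levi: "h \<noteq> 0 \<Longrightarrow> a * d - b * c \<noteq> 0 \<Longrightarrow> parabolic (levi h a b c d)"
  unfolding parabolic_def Sp3_iff all_index2 all_index
  by (simp add: varpi_def column_def levi_entries sum_index divide_simps)

lemma holo_if: "(P \<Longrightarrow> holo f N) \<Longrightarrow> (\<not> P \<Longrightarrow> holo g N) \<Longrightarrow> holo (\<lambda>q. if P then f q else g q) N"
  by (cases P) auto

lemma sum_if: "(\<Sum>b\<in>A. if P then f b else 0) = (if P then sum f A else (0 :: complex))"
  by simp

lemma holo_shear:
  assumes "open N" "\<And>i j. holo (S i j) N"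
  shows "holo (\<lambda>q. shear (\<lambda>i j. S i j q)) N"
proof (rule holo_frameI)
  show "holo (\<lambda>q. shear (\<lambda>i j. S i j q) $ a $ u) N" for a u
    by (cases a; cases u) (simp_all add: holo_const assms)
qed

lemma holo_transl:
  assumes "holo p N" "holo r N"
  shows "holo (\<lambda>q. transl (p q) (r q)) N"
proof (rule holo_frameI)
  show "holo (\<lambda>q. transl (p q) (r q) $ a $ u) N" for a u
    by (cases a; cases u) (auto simp: transl_entries intro!: holo_if holo_const holo_minus assms holo_open[OF assms(1)])
qed

lemma holo_levi:
  assumes "holo h N" "holo a N" "holo b N" "holo c N" "holo d N"
    "\<And>q. q \<in> N \<Longrightarrow> h q \<noteq> 0 \<and> a q * d q - b q * c q \<noteq> 0"
  shows "holo (\<lambda>q. levi (h q) (a q) (b q) (c q) (d q)) N"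
proof (rule holo_frameI)
  note D = holo_divide[OF _ holo_diff[OF holo_mult[OF assms(2,5)] holo_mult[OF assms(3,4)]]]
  show "holo (\<lambda>q. levi (h q) (a q) (b q) (c q) (d q) $ k $ u) N" for k u
    by (cases k; cases u)
      (use assms(6) in \<open>auto simp: levi_entries
        intro!: holo_if holo_const holo_inverse holo_minus D assms(1-5) holo_open[OF assms(1)]\<close>)
qed

text \<open>Theta is unchanged, omega moves by a product of theta and \<open>S\<close>, and eta by
  terms in omega, a quadratic term in \<open>S\<close> with coefficients from theta, and dS. A shear
  thus respects a normalization of theta and can act on omega and eta.\<close>

lemma adapted_shear:
  assumes ad: "adapted x s V W N" and S: "\<And>i j. holo (S i j) N" "\<And>i j q. S i j q = S j i q"
  defines "s' \<equiv> \<lambda>q. s q ** shear (\<lambda>i j. S i j q)"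
  shows "adapted x s' V W N"
    and "q \<in> N \<Longrightarrow> mcf s' X (Inl i) (Inl j) q = mcf s X (Inl i) (Inl j) q"
    and "q \<in> N \<Longrightarrow> mcf s' X (Inl i) (Inr j) q =
      mcf s X (Inl i) (Inr j) q + (\<Sum>k\<in>UNIV. S k j q * mcf s X (Inl i) (Inl k) q)"
    and "q \<in> N \<Longrightarrow> mcf s' X (Inr i) (Inr j) q = mcf s X (Inr i) (Inr j) q
      + (\<Sum>k\<in>UNIV. S k i q * mcf s X (Inl k) (Inr j) q) + (\<Sum>k\<in>UNIV. S k j q * mcf s X (Inr i) (Inl k) q)
      + (\<Sum>k\<in>UNIV. \<Sum>l\<in>UNIV. S k i q * S l j q * mcf s X (Inl k) (Inl l) q) + diff_at (S j i) q (X q)"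
proof -
  have s: "holo s N" "s ` N \<subseteq> Sp3" using adapted_holo[OF ad] by auto
  have h: "holo (\<lambda>q. shear (\<lambda>i j. S i j q)) N"
    by (rule holo_shear[OF holo_open[OF s(1)] S(1)])
  show "adapted x s' V W N"
    using adapted_gauge[OF ad h parabolic_shear[OF S(2)]] by (simp add: s'_def eta_contract_eq)
  note r = mcf_gauge[OF s h] sum_index2 sum.distrib sum_if if_distrib[of "\<lambda>x. x * _"] if_distrib[of "(*) _"]
  show "q \<in> N \<Longrightarrow> mcf s' X (Inl i) (Inl j) q = mcf s X (Inl i) (Inl j) q"
    by (simp add: s'_def r cong: if_cong)
  show "q \<in> N \<Longrightarrow> mcf s' X (Inl i) (Inr j) q =
      mcf s X (Inl i) (Inr j) q + (\<Sum>k\<in>UNIV. S k j q * mcf s X (Inl i) (Inl k) q)"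
    by (simp add: s'_def r cong: if_cong)
  show "q \<in> N \<Longrightarrow> mcf s' X (Inr i) (Inr j) q = mcf s X (Inr i) (Inr j) q
      + (\<Sum>k\<in>UNIV. S k i q * mcf s X (Inl k) (Inr j) q) + (\<Sum>k\<in>UNIV. S k j q * mcf s X (Inr i) (Inl k) q)
      + (\<Sum>k\<in>UNIV. \<Sum>l\<in>UNIV. S k i q * S l j q * mcf s X (Inl k) (Inl l) q) + diff_at (S j i) q (X q)"
    by (simp add: s'_def r cong: if_cong)
qed

text \<open>The entries theta_11, theta_12, theta_22 could change only by multiples of theta_00,
  theta_10, theta_20, which vanish, whereas omega moves by multiples of omega^1 and omega^2.\<close>

lemma adapted_transl:
  assumes ad: "adapted x s V W N" and p: "holo p N" "holo r N"
  defines "s' \<equiv> \<lambda>q. s q ** transl (p q) (r q)"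
  shows "adapted x s' V W N"
    and "q \<in> N \<Longrightarrow> X \<in> {V, W} \<Longrightarrow>
      mcf s' X E1 E1 q = mcf s X E1 E1 q \<and> mcf s' X E1 E2 q = mcf s X E1 E2 q \<and>
      mcf s' X E2 E2 q = mcf s X E2 E2 q \<and>
      mcf s' X E0 F0 q = mcf s X E0 F0 q - p q * mcf s X E0 F1 q - r q * mcf s X E0 F2 q \<and>
      mcf s' X E1 F1 q = mcf s X E1 F1 q + p q * mcf s X E0 F1 q \<and>
      mcf s' X E1 F2 q = mcf s X E1 F2 q + p q * mcf s X E0 F2 q \<and>
      mcf s' X E2 F1 q = mcf s X E2 F1 q + r q * mcf s X E0 F1 q \<and>
      mcf s' X E2 F2 q = mcf s X E2 F2 q + r q * mcf s X E0 F2 q"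
proof -
  have s: "holo s N" "s ` N \<subseteq> Sp3" using adapted_holo[OF ad] by auto
  have h: "holo (\<lambda>q. transl (p q) (r q)) N" by (rule holo_transl[OF p])
  show "adapted x s' V W N"
    using adapted_gauge[OF ad h parabolic_transl] by (simp add: s'_def transl_entries eta_contract_eq)
  assume q: "q \<in> N" and X: "X \<in> {V, W}"
  have "mcf s X E0 E0 q = 0" "mcf s X E0 E1 q = 0" "mcf s X E0 E2 q = 0"
    using ad q X unfolding adapted_def by blast+
  moreover from this have "mcf s X E1 E0 q = 0" "mcf s X E2 E0 q = 0"
    by (simp_all add: mcf_sym[OF s q, of X E1 E0] mcf_sym[OF s q, of X E2 E0])
  ultimately show "mcf s' X E1 E1 q = mcf s X E1 E1 q \<and> mcf s' X E1 E2 q = mcf s X E1 E2 q \<and>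
      mcf s' X E2 E2 q = mcf s X E2 E2 q \<and>
      mcf s' X E0 F0 q = mcf s X E0 F0 q - p q * mcf s X E0 F1 q - r q * mcf s X E0 F2 q \<and>
      mcf s' X E1 F1 q = mcf s X E1 F1 q + p q * mcf s X E0 F1 q \<and>
      mcf s' X E1 F2 q = mcf s X E1 F2 q + p q * mcf s X E0 F2 q \<and>
      mcf s' X E2 F1 q = mcf s X E2 F1 q + r q * mcf s X E0 F1 q \<and>
      mcf s' X E2 F2 q = mcf s X E2 F2 q + r q * mcf s X E0 F2 q"
    by (simp add: s'_def mcf_gauge[OF s h q] sum_index2 sum_index transl_entries)
qed

lemma diff_at_constant_on:
  assumes "open N" "q \<in> N" "\<And>q. q \<in> N \<Longrightarrow> f q = k"
  shows "diff_at f q v = 0"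
proof -
  have "diff_at f q = diff_at (\<lambda>_. k) q" by (rule diff_at_cong[OF assms(1,2)]) (rule assms(3))
  then show ?thesis by simp
qed

text \<open>The structure equations for theta_10 = theta_20 = 0: the derivatives vanish, and the
  quadratic terms express the total symmetry of t_ijk.\<close>

lemma cubic_sym:
  assumes ad: "adapted x s V W N" and q: "q \<in> N"
  shows "mcf s W E1 E1 q = mcf s V E1 E2 q" "mcf s W E1 E2 q = mcf s V E2 E2 q"
proof -
  have s: "holo s N" "s ` N \<subseteq> Sp3" "holo V N" "holo W N" using adapted_holo[OF ad] by auto
  have span: "\<exists>c d. v = c *s V q + d *s W q" for v using ad q unfolding adapted_def by blast
  obtain c d where st: "\<And>u w. diff_at (mcf s W u w) q (V q) - diff_at (mcf s V u w) q (W q) =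
    c * mcf s V u w q + d * mcf s W u w q +
    (\<Sum>i\<in>UNIV. mcf s W u (Inl i) q * mcf s V w (Inr i) q - mcf s W u (Inr i) q * mcf s V w (Inl i) q
      - mcf s V u (Inl i) q * mcf s W w (Inr i) q + mcf s V u (Inr i) q * mcf s W w (Inl i) q)"
    by (rule mcf_structure[OF s q span]) blast
  have c: "mcf s X E0 E0 q = 0" "mcf s X E0 E1 q = 0" "mcf s X E0 E2 q = 0"
    if "X \<in> {V, W}" "q \<in> N" for X q using ad that unfolding adapted_def by blast+
  have z: "mcf s X E1 E0 q = 0" "mcf s X E2 E0 q = 0" if "X \<in> {V, W}" for X
    using c[OF that q] by (simp_all add: mcf_sym[OF s(1,2) q, of X E1 E0] mcf_sym[OF s(1,2) q, of X E2 E0])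
  have d: "diff_at (mcf s X E0 E1) q v = 0" "diff_at (mcf s X E0 E2) q v = 0" if "X \<in> {V, W}" for X v
    by (rule diff_at_constant_on[OF holo_open[OF s(1)] q], rule c[OF that], assumption)+
  have f: "mcf s V E0 F1 q = 1" "mcf s W E0 F1 q = 0" "mcf s V E0 F2 q = 0" "mcf s W E0 F2 q = 1"
    using ad q by (simp_all add: adapted_def)
  show "mcf s W E1 E1 q = mcf s V E1 E2 q" using st[of E0 E1]
    by (simp add: sum_index d c[OF _ q] z f)
  show "mcf s W E1 E2 q = mcf s V E2 E2 q" using st[of E0 E2] mcf_sym[OF s(1,2) q, of W E1 E2]
    by (simp add: sum_index d c[OF _ q] z f)
qed


text \<open>Up to sign, t1 to t4 are the coefficients of the cubic with binomial factors 1, 3, 3, 1.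
  The substitution with columns (a, c) and (b, d) acts twice through the frame and once through the
  dual fields, which also bring the factor 1/h.\<close>

lemma adapted_levi:
  assumes ad: "adapted x s V W N"
    and g: "holo h N" "holo a N" "holo b N" "holo c N" "holo d N"
      "\<And>q. q \<in> N \<Longrightarrow> h q \<noteq> 0 \<and> a q * d q - b q * c q \<noteq> 0"
  defines "t1 \<equiv> mcf s V E1 E1" and "t2 \<equiv> mcf s V E1 E2" and "t3 \<equiv> mcf s V E2 E2" and "t4 \<equiv> mcf s W E2 E2"
  obtains s' V' W' where "adapted x s' V' W' N"
    "\<And>q. q \<in> N \<Longrightarrow> mcf s' V' E1 E1 q = (a q ^ 3 * t1 q + 3 * a q ^ 2 * c q * t2 q
      + 3 * a q * c q ^ 2 * t3 q + c q ^ 3 * t4 q) / h q"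
    "\<And>q. q \<in> N \<Longrightarrow> mcf s' V' E1 E2 q = (a q ^ 2 * b q * t1 q + (a q ^ 2 * d q + 2 * a q * b q * c q) * t2 q
      + (2 * a q * c q * d q + b q * c q ^ 2) * t3 q + c q ^ 2 * d q * t4 q) / h q"
    "\<And>q. q \<in> N \<Longrightarrow> mcf s' V' E2 E2 q = (a q * b q ^ 2 * t1 q + (2 * a q * b q * d q + b q ^ 2 * c q) * t2 q
      + (a q * d q ^ 2 + 2 * b q * c q * d q) * t3 q + c q * d q ^ 2 * t4 q) / h q"
    "\<And>q. q \<in> N \<Longrightarrow> mcf s' W' E2 E2 q = (b q ^ 3 * t1 q + 3 * b q ^ 2 * d q * t2 q
      + 3 * b q * d q ^ 2 * t3 q + d q ^ 3 * t4 q) / h q"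
proof -
  have s: "holo s N" "s ` N \<subseteq> Sp3" using adapted_holo[OF ad] by auto
  have L: "holo (\<lambda>q. levi (h q) (a q) (b q) (c q) (d q)) N" by (rule holo_levi[OF g])
  have P: "parabolic (levi (h q) (a q) (b q) (c q) (d q))" if "q \<in> N" for q
    using g(6)[OF that] by (intro parabolic_levi) auto
  let ?s = "\<lambda>q. s q ** levi (h q) (a q) (b q) (c q) (d q)"
  let ?V = "\<lambda>q. (a q / h q) *s V q + (c q / h q) *s W q"
  let ?W = "\<lambda>q. (b q / h q) *s V q + (d q / h q) *s W q"
  have r: "mcf s V E2 E1 q = t2 q" "mcf s W E1 E1 q = t2 q" "mcf s W E1 E2 q = t3 q" "mcf s W E2 E1 q = t3 q"
    if "q \<in> N" for q
    using cubic_sym[OF ad that] mcf_sym[OF s that, of V E2 E1] mcf_sym[OF s that, of W E2 E1]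
    by (simp_all add: t1_def t2_def t3_def t4_def)
  note u = mcf_gauge[OF s L] sum_index2 sum_index levi_entries mcf_linear[OF s(1)]
    t1_def[symmetric] t2_def[symmetric] t3_def[symmetric] t4_def[symmetric] r
  show ?thesis
  proof (rule that[of ?s ?V ?W])
    show "adapted x ?s ?V ?W N"
      using adapted_gauge[OF ad L P] by (simp add: levi_entries)
    fix q assume q: "q \<in> N"
    then have h: "h q \<noteq> 0" using g(6) by blast
    show "mcf ?s ?V E1 E1 q = (a q ^ 3 * t1 q + 3 * a q ^ 2 * c q * t2 q
      + 3 * a q * c q ^ 2 * t3 q + c q ^ 3 * t4 q) / h q"
      using q h by (simp add: u divide_simps) (simp add: algebra_simps power2_eq_square power3_eq_cube)
    show "mcf ?s ?V E1 E2 q = (a q ^ 2 * b q * t1 q + (a q ^ 2 * d q + 2 * a q * b q * c q) * t2 q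
      + (2 * a q * c q * d q + b q * c q ^ 2) * t3 q + c q ^ 2 * d q * t4 q) / h q"
      using q h by (simp add: u divide_simps) (simp add: algebra_simps power2_eq_square power3_eq_cube)
    show "mcf ?s ?V E2 E2 q = (a q * b q ^ 2 * t1 q + (2 * a q * b q * d q + b q ^ 2 * c q) * t2 q
      + (a q * d q ^ 2 + 2 * b q * c q * d q) * t3 q + c q * d q ^ 2 * t4 q) / h q"
      using q h by (simp add: u divide_simps) (simp add: algebra_simps power2_eq_square power3_eq_cube)
    show "mcf ?s ?W E2 E2 q = (b q ^ 3 * t1 q + 3 * b q ^ 2 * d q * t2 q
      + 3 * b q * d q ^ 2 * t3 q + d q ^ 3 * t4 q) / h q"
      using q h by (simp add: u divide_simps) (simp add: algebra_simps power2_eq_square power3_eq_cube)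
  qed
qed

section \<open>Normalization of the frame\<close>

locale adapted_frame =
  fixes x :: "surf \<Rightarrow> V6 set" and s V W N
  assumes ad: "adapted x s V W N"
begin

lemma holos: "holo s N" "s ` N \<subseteq> Sp3" "holo V N" "holo W N" "open N"
  using adapted_holo[OF ad] holo_open by auto

lemma contact [simp]:
  assumes "q \<in> N"
  shows "mcf s V E0 E0 q = 0" "mcf s V E0 E1 q = 0" "mcf s V E0 E2 q = 0"
    "mcf s W E0 E0 q = 0" "mcf s W E0 E1 q = 0" "mcf s W E0 E2 q = 0"
    "mcf s V E0 F1 q = 1" "mcf s W E0 F1 q = 0" "mcf s V E0 F2 q = 0" "mcf s W E0 F2 q = 1"
  using ad assms unfolding adapted_def by auto

text \<open>Oriented instances of \<open>mcf_sym\<close> that give each pair of indices one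
  canonical order.\<close>

lemma sym [simp]:
  assumes "q \<in> N"
  shows "mcf s X E1 E0 q = mcf s X E0 E1 q" "mcf s X E2 E0 q = mcf s X E0 E2 q"
    "mcf s X E2 E1 q = mcf s X E1 E2 q" "mcf s X (Inr i) (Inl j) q = mcf s X (Inl j) (Inr i) q"
    "mcf s X F1 F0 q = mcf s X F0 F1 q" "mcf s X F2 F0 q = mcf s X F0 F2 q"
    "mcf s X F2 F1 q = mcf s X F1 F2 q"
  by (rule mcf_sym[OF holos(1,2) assms])+

lemma diff_at_const_contact [simp]:
  assumes "q \<in> N"
  shows "diff_at (mcf s V E0 F1) q v = 0" "diff_at (mcf s W E0 F1) q v = 0"
    "diff_at (mcf s V E0 F2) q v = 0" "diff_at (mcf s W E0 F2) q v = 0"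
  by (rule diff_at_constant_on[OF holos(5) assms], rule contact, assumption)+

lemma structure_eq:
  assumes q: "q \<in> N"
  obtains c d where "\<And>u w. diff_at (mcf s W u w) q (V q) - diff_at (mcf s V u w) q (W q) =
    c * mcf s V u w q + d * mcf s W u w q +
    (\<Sum>i\<in>UNIV. mcf s W u (Inl i) q * mcf s V w (Inr i) q - mcf s W u (Inr i) q * mcf s V w (Inl i) q
      - mcf s V u (Inl i) q * mcf s W w (Inr i) q + mcf s V u (Inr i) q * mcf s W w (Inl i) q)"
proof -
  have "\<exists>c d. v = c *s V q + d *s W q" for v using ad q unfolding adapted_def by blast
  then show ?thesis by (rule mcf_structure[OF holos(1,2,3,4) q]) (rule that)
qed

end

text \<open>Since theta is minus \<open>mcf\<close> on two \<open>e\<close> indices, this says that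
  the cubic is Phi = 3 omega^1 omega^2 (omega^1 + omega^2).\<close>

definition theta_normal :: "(surf \<Rightarrow> frame) \<Rightarrow> (surf \<Rightarrow> surf) \<Rightarrow> (surf \<Rightarrow> surf) \<Rightarrow> surf set \<Rightarrow> bool" where
  "theta_normal s V W N \<longleftrightarrow> (\<forall>q\<in>N.
    mcf s V E1 E1 q = 0 \<and> mcf s V E1 E2 q = - 1 \<and> mcf s V E2 E2 q = - 1 \<and>
    mcf s W E1 E1 q = - 1 \<and> mcf s W E1 E2 q = - 1 \<and> mcf s W E2 E2 q = 0)"

definition omega_normal :: "(surf \<Rightarrow> frame) \<Rightarrow> (surf \<Rightarrow> surf) \<Rightarrow> (surf \<Rightarrow> surf) \<Rightarrow> surf set \<Rightarrow> bool" where
  "omega_normal s V W N \<longleftrightarrow> (\<forall>q\<in>N. \<forall>X\<in>{V, W}.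
    mcf s X E1 F1 q = 1/3 * mcf s X E0 F0 q \<and> mcf s X E2 F2 q = 1/3 * mcf s X E0 F0 q \<and>
    mcf s X E1 F2 q = 0 \<and> mcf s X E2 F1 q = 0)"

text \<open>Once theta is normal, the two combinations are invariant under shears, so only a
  translation can remove them. It changes them by -p and -r; hence \<open>p\<close> and
  \<open>r\<close> are chosen as the combinations themselves.\<close>

lemma transl_normalization:
  assumes ad: "adapted x s V W N" and n: "theta_normal s V W N"
  obtains s' where "adapted x s' V W N" "theta_normal s' V W N"
    "\<And>q. q \<in> N \<Longrightarrow> 3 * (mcf s' W E1 F2 q - mcf s' V E1 F1 q - mcf s' V E1 F2 q) + mcf s' V E0 F0 q = 0"
    "\<And>q. q \<in> N \<Longrightarrow> 3 * (mcf s' V E2 F1 q - mcf s' W E2 F2 q - mcf s' W E2 F1 q) + mcf s' W E0 F0 q = 0"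
proof -
  interpret adapted_frame x s V W N by standard (rule ad)
  define p where "p q = 3 * (mcf s W E1 F2 q - mcf s V E1 F1 q - mcf s V E1 F2 q) + mcf s V E0 F0 q" for q
  define r where "r q = 3 * (mcf s V E2 F1 q - mcf s W E2 F2 q - mcf s W E2 F1 q) + mcf s W E0 F0 q" for q
  have "holo p N" "holo r N"
    unfolding p_def r_def
    by (intro holo_add holo_mult holo_diff holo_const holo_mcf holos)+
  note t = adapted_transl[OF ad this]
  note t2 = t(2)[of _ V, simplified] t(2)[of _ W, simplified]
  show ?thesis
    by (rule that[OF t(1)])
      (use n in \<open>simp_all add: theta_normal_def t2\<close>, simp_all add: p_def r_def)
qed

text \<open>For the eight values of omega_ij, i, j = 1, 2, on \<open>V\<close> and \<open>W\<close>,
  the structure equations of the constant theta and the two hypotheses \<open>p\<close> yield five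
  relations involving omega_00. The three entries of a symmetric two by two \<open>S\<close> adjust
  the rest.\<close>

lemma omega_normalization:
  assumes ad: "adapted x s V W N" and n: "theta_normal s V W N"
    and p: "\<And>q. q \<in> N \<Longrightarrow> 3 * (mcf s W E1 F2 q - mcf s V E1 F1 q - mcf s V E1 F2 q) + mcf s V E0 F0 q = 0"
    "\<And>q. q \<in> N \<Longrightarrow> 3 * (mcf s V E2 F1 q - mcf s W E2 F2 q - mcf s W E2 F1 q) + mcf s W E0 F0 q = 0"
  obtains s' where "adapted x s' V W N" "theta_normal s' V W N" "omega_normal s' V W N"
proof -
  interpret adapted_frame x s V W N by standard (rule ad)
  \<comment> \<open>With theta normal, the shear subtracts S_11 from omega_12(W), S_22 from
    omega_21(V) and S_12 from omega_11(V), while omega_00 is unchanged. These entries make the first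
    two values 0 and the third omega_00(V)/3.\<close>
  define S where "S i j q = (if i = 0 \<or> j = 0 then 0 else if i = 1 \<and> j = 1 then mcf s W E2 F1 q
    else if i = 2 \<and> j = 2 then mcf s V E1 F2 q else mcf s V E1 F1 q - 1/3 * mcf s V E0 F0 q)"
    for i j :: 3 and q
  have "holo (S i j) N" for i j
    unfolding S_def by (intro holo_if holo_mult holo_diff holo_const holo_mcf holos)
  moreover have "S i j q = S j i q" for i j q by (auto simp: S_def)
  ultimately have "(\<And>i j. holo (S i j) N)" "(\<And>i j q. S i j q = S j i q)" by blast+
  note t = adapted_shear[OF ad this]
  have n1: "mcf s V E1 E1 q = 0" "mcf s V E1 E2 q = - 1" "mcf s V E2 E2 q = - 1"
    "mcf s W E1 E1 q = - 1" "mcf s W E1 E2 q = - 1" "mcf s W E2 E2 q = 0" if "q \<in> N" for q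
    using n that by (auto simp: theta_normal_def)
  have d: "diff_at (mcf s X (Inl i) (Inl j)) q v = 0"
    if "q \<in> N" "X = V \<or> X = W" "i = 1 \<or> i = 2" "j = 1 \<or> j = 2" for X i j q v
  proof -
    have "\<exists>k. \<forall>q\<in>N. mcf s X (Inl i) (Inl j) q = k"
      using that(2-4) n1 by auto
    then show ?thesis by (auto intro: diff_at_constant_on[OF holos(5) that(1)])
  qed
  show ?thesis
  proof (rule that[OF t(1)])
    show "theta_normal (\<lambda>q. s q ** shear (\<lambda>i j. S i j q)) V W N"
      using n by (simp add: theta_normal_def t(2))
    show "omega_normal (\<lambda>q. s q ** shear (\<lambda>i j. S i j q)) V W N"
      unfolding omega_normal_def
    proof (intro ballI)
      fix q X assume q: "q \<in> N" and X: "X \<in> {V, W}"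
      obtain c d where st: "\<And>u w. diff_at (mcf s W u w) q (V q) - diff_at (mcf s V u w) q (W q) =
    c * mcf s V u w q + d * mcf s W u w q +
    (\<Sum>i\<in>UNIV. mcf s W u (Inl i) q * mcf s V w (Inr i) q - mcf s W u (Inr i) q * mcf s V w (Inl i) q
      - mcf s V u (Inl i) q * mcf s W w (Inr i) q + mcf s V u (Inr i) q * mcf s W w (Inl i) q)"
        using structure_eq[OF q] by blast
      note r = q n1[OF q] d[OF q] sum_index
      \<comment> \<open>The two coframe equations give the bracket components \<open>c\<close>,
        \<open>d\<close>. The three after them, for theta_11, theta_12 and theta_22, have vanishing
        left sides and are linear in omega.\<close>
      have "c + (mcf s W E1 F1 q - mcf s W E0 F0 q - mcf s V E2 F1 q) = 0"
        using st[of E0 F1] by (simp add: r)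
      moreover have "d + (mcf s V E0 F0 q + mcf s W E1 F2 q - mcf s V E2 F2 q) = 0"
        using st[of E0 F2] by (simp add: r)
      moreover have "0 = 2 * mcf s W E1 F2 q - 2 * mcf s V E1 F2 q - 2 * mcf s V E1 F1 q - d"
        using st[of E1 E1] by (simp add: r)
      moreover have "0 = - c - d + (mcf s W E1 F1 q - mcf s V E2 F1 q - mcf s V E1 F1 q +
          (mcf s W E1 F2 q - mcf s V E2 F2 q + mcf s W E2 F2 q))"
        using st[of E1 E2] by (simp add: r)
      moreover have "0 = 2 * mcf s W E2 F1 q - 2 * mcf s V E2 F1 q + 2 * mcf s W E2 F2 q - c"
        using st[of E2 E2] by (simp add: r)
      moreover note p[OF q]
      ultimately have rel: "mcf s V E2 F2 q = mcf s V E1 F1 q + mcf s V E1 F2 q"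
        "mcf s V E2 F1 q = mcf s V E1 F1 q - 1/3 * mcf s V E0 F0 q + mcf s W E2 F1 q"
        "mcf s W E1 F1 q = mcf s V E1 F1 q + mcf s W E2 F1 q + 1/3 * (mcf s W E0 F0 q - mcf s V E0 F0 q)"
        "mcf s W E1 F2 q = mcf s V E1 F1 q - 1/3 * mcf s V E0 F0 q + mcf s V E1 F2 q"
        "mcf s W E2 F2 q = mcf s V E1 F1 q + 1/3 * (mcf s W E0 F0 q - mcf s V E0 F0 q)"
        by algebra+
      show "mcf (\<lambda>q. s q ** shear (\<lambda>i j. S i j q)) X E1 F1 q =
        1/3 * mcf (\<lambda>q. s q ** shear (\<lambda>i j. S i j q)) X E0 F0 q \<and>
        mcf (\<lambda>q. s q ** shear (\<lambda>i j. S i j q)) X E2 F2 q =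
        1/3 * mcf (\<lambda>q. s q ** shear (\<lambda>i j. S i j q)) X E0 F0 q \<and>
        mcf (\<lambda>q. s q ** shear (\<lambda>i j. S i j q)) X E1 F2 q = 0 \<and>
        mcf (\<lambda>q. s q ** shear (\<lambda>i j. S i j q)) X E2 F1 q = 0"
        unfolding t(3)[OF q] using X by (auto simp: r S_def rel field_simps)
    qed
  qed
qed

definition eta_normal :: "(surf \<Rightarrow> frame) \<Rightarrow> (surf \<Rightarrow> surf) \<Rightarrow> (surf \<Rightarrow> surf) \<Rightarrow> surf set \<Rightarrow> bool" where
  "eta_normal s V W N \<longleftrightarrow> (\<forall>q\<in>N. mcf s V F1 F1 q = 0 \<and> mcf s W F2 F2 q = 0)"

definition eta0_normal :: "(surf \<Rightarrow> frame) \<Rightarrow> (surf \<Rightarrow> surf) \<Rightarrow> (surf \<Rightarrow> surf) \<Rightarrow> surf set \<Rightarrow> bool" where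
  "eta0_normal s V W N \<longleftrightarrow> (\<forall>q\<in>N. mcf s W F0 F2 q = - mcf s V F0 F1 q)"

text \<open>Shears with only S_01 and S_02 leave theta, omega_00 and omega_ij, i, j = 1, 2, alone.
  They add 2 S_01 omega^1 to eta_11 and 2 S_02 omega^2 to eta_22, whence the factor -1/2.\<close>

lemma eta_normalization:
  assumes ad: "adapted x s V W N" and n: "theta_normal s V W N" "omega_normal s V W N"
  obtains s' where "adapted x s' V W N" "theta_normal s' V W N" "omega_normal s' V W N" "eta_normal s' V W N"
proof -
  interpret adapted_frame x s V W N by standard (rule ad)
  define S where "S i j q = (if i = 0 \<and> j = 1 \<or> i = 1 \<and> j = 0 then - 1/2 * mcf s V F1 F1 q
    else if i = 0 \<and> j = 2 \<or> i = 2 \<and> j = 0 then - 1/2 * mcf s W F2 F2 q else 0)" for i j :: 3 and q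
  have "(\<And>i j. holo (S i j) N)" "(\<And>i j q. S i j q = S j i q)"
    unfolding S_def by (intro holo_if holo_mult holo_minus holo_const holo_mcf holos) auto
  note t = adapted_shear[OF ad this]
  have d: "diff_at (S 1 1) q v = 0" "diff_at (S 2 2) q v = 0" for q v
    unfolding S_def by simp_all
  have n': "mcf s V E1 E1 q = 0" "mcf s V E1 E2 q = - 1" "mcf s V E2 E2 q = - 1"
    "mcf s W E1 E1 q = - 1" "mcf s W E1 E2 q = - 1" "mcf s W E2 E2 q = 0"
    "mcf s V E1 F1 q = 1/3 * mcf s V E0 F0 q" "mcf s V E2 F2 q = 1/3 * mcf s V E0 F0 q"
    "mcf s V E1 F2 q = 0" "mcf s V E2 F1 q = 0"
    "mcf s W E1 F1 q = 1/3 * mcf s W E0 F0 q" "mcf s W E2 F2 q = 1/3 * mcf s W E0 F0 q"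
    "mcf s W E1 F2 q = 0" "mcf s W E2 F1 q = 0" if "q \<in> N" for q
    using n that by (auto simp: theta_normal_def omega_normal_def)
  have S: "S 0 0 q = 0" "S 1 1 q = 0" "S 2 2 q = 0" "S 1 2 q = 0" "S 2 1 q = 0"
    "S 1 0 q = S 0 1 q" "S 2 0 q = S 0 2 q"
    "mcf s V F1 F1 q = - 2 * S 0 1 q" "mcf s W F2 F2 q = - 2 * S 0 2 q" for q
    by (simp_all add: S_def)
  show ?thesis
  proof (rule that[OF t(1)])
    show "theta_normal (\<lambda>q. s q ** shear (\<lambda>i j. S i j q)) V W N"
      unfolding theta_normal_def by (simp add: t(2) n')
    show "omega_normal (\<lambda>q. s q ** shear (\<lambda>i j. S i j q)) V W N"
      unfolding omega_normal_def by (simp add: t(3) n' sum_index S)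
    show "eta_normal (\<lambda>q. s q ** shear (\<lambda>i j. S i j q)) V W N"
      unfolding eta_normal_def by (simp add: t(4) n' sum_index S d)
  qed
qed

text \<open>The last parameter S_00 adds S_00 omega^1 to eta_10 and S_00 omega^2 to eta_20, so it
  shifts eta_10(V) + eta_20(W) by 2 S_00. Making this sum zero is the origin of the coefficient -b_1
  in eta_20.\<close>

lemma eta0_normalization:
  assumes ad: "adapted x s V W N" and n: "theta_normal s V W N" "omega_normal s V W N" "eta_normal s V W N"
  obtains s' where "adapted x s' V W N" "theta_normal s' V W N" "omega_normal s' V W N" "eta_normal s' V W N" "eta0_normal s' V W N"
proof -
  interpret adapted_frame x s V W N by standard (rule ad)
  define S where "S i j q = (if i = 0 \<and> j = 0 then - 1/2 * (mcf s V F0 F1 q + mcf s W F0 F2 q) else 0)"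
    for i j :: 3 and q
  have "(\<And>i j. holo (S i j) N)" "(\<And>i j q. S i j q = S j i q)"
    unfolding S_def by (intro holo_if holo_add holo_mult holo_minus holo_const holo_mcf holos) auto
  note t = adapted_shear[OF ad this]
  have d: "diff_at (S i j) q v = 0" if "i \<noteq> 0" for i j q v
    unfolding S_def using that by simp
  have n': "mcf s V E1 E1 q = 0" "mcf s V E1 E2 q = - 1" "mcf s V E2 E2 q = - 1"
    "mcf s W E1 E1 q = - 1" "mcf s W E1 E2 q = - 1" "mcf s W E2 E2 q = 0"
    "mcf s V E1 F1 q = 1/3 * mcf s V E0 F0 q" "mcf s V E2 F2 q = 1/3 * mcf s V E0 F0 q"
    "mcf s V E1 F2 q = 0" "mcf s V E2 F1 q = 0"
    "mcf s W E1 F1 q = 1/3 * mcf s W E0 F0 q" "mcf s W E2 F2 q = 1/3 * mcf s W E0 F0 q"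
    "mcf s W E1 F2 q = 0" "mcf s W E2 F1 q = 0" if "q \<in> N" for q
    using n that by (auto simp: theta_normal_def omega_normal_def)
  have n3: "mcf s V F1 F1 q = 0" "mcf s W F2 F2 q = 0" if "q \<in> N" for q
    using n that by (auto simp: eta_normal_def)
  have S: "S 0 1 q = 0" "S 0 2 q = 0" "S 1 0 q = 0" "S 2 0 q = 0"
    "S 1 1 q = 0" "S 2 2 q = 0" "S 1 2 q = 0" "S 2 1 q = 0"
    "mcf s W F0 F2 q = - mcf s V F0 F1 q - 2 * S 0 0 q" for q
    by (simp_all add: S_def field_simps)
  show ?thesis
  proof (rule that[OF t(1)])
    show "theta_normal (\<lambda>q. s q ** shear (\<lambda>i j. S i j q)) V W N"
      unfolding theta_normal_def by (simp add: t(2) n')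
    show "omega_normal (\<lambda>q. s q ** shear (\<lambda>i j. S i j q)) V W N"
      unfolding omega_normal_def by (simp add: t(3) n' sum_index S)
    show "eta_normal (\<lambda>q. s q ** shear (\<lambda>i j. S i j q)) V W N"
      unfolding eta_normal_def by (simp add: t(4) n3 sum_index S d)
    show "eta0_normal (\<lambda>q. s q ** shear (\<lambda>i j. S i j q)) V W N"
      unfolding eta0_normal_def by (simp add: t(4) sum_index S d)
  qed
qed

section \<open>Consequences of the structure equations in a normal frame\<close>

locale normal_frame = adapted_frame +
  assumes norm: "theta_normal s V W N" "omega_normal s V W N" "eta_normal s V W N" "eta0_normal s V W N"
begin

lemma norms:
  assumes "q \<in> N"
  shows "mcf s V E1 E1 q = 0" "mcf s V E1 E2 q = - 1" "mcf s V E2 E2 q = - 1"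
    "mcf s W E1 E1 q = - 1" "mcf s W E1 E2 q = - 1" "mcf s W E2 E2 q = 0"
    "mcf s V E1 F1 q = 1/3 * mcf s V E0 F0 q" "mcf s V E2 F2 q = 1/3 * mcf s V E0 F0 q"
    "mcf s V E1 F2 q = 0" "mcf s V E2 F1 q = 0"
    "mcf s W E1 F1 q = 1/3 * mcf s W E0 F0 q" "mcf s W E2 F2 q = 1/3 * mcf s W E0 F0 q"
    "mcf s W E1 F2 q = 0" "mcf s W E2 F1 q = 0"
    "mcf s V F1 F1 q = 0" "mcf s W F2 F2 q = 0" "mcf s W F0 F2 q = - mcf s V F0 F1 q"
  using norm assms by (auto simp: theta_normal_def omega_normal_def eta_normal_def eta0_normal_def)

lemma diff_at_eq_on:
  assumes "q \<in> N" "\<And>q. q \<in> N \<Longrightarrow> f q = g q"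
  shows "diff_at f q v = diff_at g q v"
  by (rule fun_cong[OF diff_at_cong[OF holos(5) assms(1)]]) (rule assms(2))

lemma diff_at_const_mult:
  fixes f :: "surf \<Rightarrow> complex"
  assumes "q \<in> N" "holo f N"
  shows "diff_at (\<lambda>q. k * f q) q v = k * diff_at f q v"
  using diff_at_mult[OF holo_const[OF holos(5)] assms(2,1)] by simp

lemma diff_norms:
  assumes q: "q \<in> N"
  shows "diff_at (mcf s V E1 F1) q v = 1/3 * diff_at (mcf s V E0 F0) q v"
    "diff_at (mcf s V E2 F2) q v = 1/3 * diff_at (mcf s V E0 F0) q v"
    "diff_at (mcf s W E1 F1) q v = 1/3 * diff_at (mcf s W E0 F0) q v"
    "diff_at (mcf s W E2 F2) q v = 1/3 * diff_at (mcf s W E0 F0) q v"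
    "diff_at (mcf s V E1 F2) q v = 0" "diff_at (mcf s V E2 F1) q v = 0"
    "diff_at (mcf s W E1 F2) q v = 0" "diff_at (mcf s W E2 F1) q v = 0"
    "diff_at (mcf s V F1 F1) q v = 0" "diff_at (mcf s W F2 F2) q v = 0"
    "diff_at (mcf s W F0 F2) q v = - diff_at (mcf s V F0 F1) q v"
  unfolding diff_at_const_mult[OF q holo_mcf[OF holos(1) holos(3)], symmetric]
    diff_at_const_mult[OF q holo_mcf[OF holos(1) holos(4)], symmetric]
    diff_at_minus[OF holo_mcf[OF holos(1) holos(3)] q, symmetric]
  by (rule diff_at_eq_on[OF q], erule norms | rule diff_at_constant_on[OF holos(5) q], erule norms)+

text \<open>The derivative of omega_00 occurs in the equations for omega_00, omega_11 and omega_22.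
  With x = omega_01(W), y = omega_02(V), e = a_3 - a_2, comparison gives x - y = 3 (e - x) = 3 (e +
  y), hence x = -y = 3/5 e. The equations for omega_21 and omega_12 give the other two
  values.\<close>

lemma omega_0j:
  assumes q: "q \<in> N"
  shows "mcf s V E1 F0 q = mcf s V F1 F2 q + mcf s V F2 F2 q"
    "mcf s W E1 F0 q = 3/5 * (mcf s W F1 F2 q - mcf s V F1 F2 q)"
    "mcf s V E2 F0 q = 3/5 * (mcf s V F1 F2 q - mcf s W F1 F2 q)"
    "mcf s W E2 F0 q = mcf s W F1 F1 q + mcf s W F1 F2 q"
proof -
  obtain c d where st: "\<And>u w. diff_at (mcf s W u w) q (V q) - diff_at (mcf s V u w) q (W q) =
    c * mcf s V u w q + d * mcf s W u w q +
    (\<Sum>i\<in>UNIV. mcf s W u (Inl i) q * mcf s V w (Inr i) q - mcf s W u (Inr i) q * mcf s V w (Inl i) q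
      - mcf s V u (Inl i) q * mcf s W w (Inr i) q + mcf s V u (Inr i) q * mcf s W w (Inl i) q)"
    using structure_eq[OF q] by blast
  note r = q norms[OF q] diff_norms[OF q] sum_index
  have "c * 3 = 2 * mcf s W E0 F0 q"
    using st[of E0 F1] by (simp add: r)
  moreover have "d * 3 = - 2 * mcf s V E0 F0 q"
    using st[of E0 F2] by (simp add: r; algebra)
  moreover have "diff_at (mcf s W E0 F0) q (V q) - diff_at (mcf s V E0 F0) q (W q) =
      c * mcf s V E0 F0 q + d * mcf s W E0 F0 q + (mcf s W E1 F0 q - mcf s V E2 F0 q)"
    using st[of E0 F0] by (simp add: r)
  moreover have "diff_at (mcf s W E0 F0) q (V q) - diff_at (mcf s V E0 F0) q (W q) =
      c * mcf s V E0 F0 q + d * mcf s W E0 F0 q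
      + 3 * (mcf s W F1 F2 q - mcf s V F1 F2 q - mcf s W E1 F0 q)"
    using st[of E1 F1] by (simp add: r; algebra)
  moreover have "mcf s V E1 F0 q - mcf s V F1 F2 q = mcf s V F2 F2 q"
    using st[of E1 F2] by (simp add: r)
  moreover have "mcf s W F1 F1 q - mcf s W E2 F0 q + mcf s W F1 F2 q = 0"
    using st[of E2 F1] by (simp add: r)
  moreover have "diff_at (mcf s W E0 F0) q (V q) - diff_at (mcf s V E0 F0) q (W q) =
      c * mcf s V E0 F0 q + d * mcf s W E0 F0 q
      + 3 * (mcf s W F1 F2 q - mcf s V F1 F2 q + mcf s V E2 F0 q)"
    using st[of E2 F2] by (simp add: r; algebra)
  ultimately show "mcf s V E1 F0 q = mcf s V F1 F2 q + mcf s V F2 F2 q"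
    "mcf s W E1 F0 q = 3/5 * (mcf s W F1 F2 q - mcf s V F1 F2 q)"
    "mcf s V E2 F0 q = 3/5 * (mcf s V F1 F2 q - mcf s W F1 F2 q)"
    "mcf s W E2 F0 q = mcf s W F1 F1 q + mcf s W F1 F2 q"
    by algebra+
qed

lemma diff_omega_0j:
  assumes q: "q \<in> N"
  shows "diff_at (mcf s V E1 F0) q v = diff_at (mcf s V F1 F2) q v + diff_at (mcf s V F2 F2) q v"
    "diff_at (mcf s W E1 F0) q v = 3/5 * (diff_at (mcf s W F1 F2) q v - diff_at (mcf s V F1 F2) q v)"
    "diff_at (mcf s V E2 F0) q v = 3/5 * (diff_at (mcf s V F1 F2) q v - diff_at (mcf s W F1 F2) q v)"
    "diff_at (mcf s W E2 F0) q v = diff_at (mcf s W F1 F1) q v + diff_at (mcf s W F1 F2) q v"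
proof -
  note h = holo_mcf[OF holos(1) holos(3)] holo_mcf[OF holos(1) holos(4)]
  note r = diff_at_add[OF h(1) h(1) q, symmetric] diff_at_add[OF h(2) h(2) q, symmetric]
    diff_at_diff[OF h(1) h(2) q, symmetric] diff_at_diff[OF h(2) h(1) q, symmetric]
    diff_at_const_mult[OF q holo_diff[OF h(1) h(2)], symmetric] diff_at_const_mult[OF q holo_diff[OF h(2) h(1)], symmetric]
  show "diff_at (mcf s V E1 F0) q v = diff_at (mcf s V F1 F2) q v + diff_at (mcf s V F2 F2) q v"
    "diff_at (mcf s W E1 F0) q v = 3/5 * (diff_at (mcf s W F1 F2) q v - diff_at (mcf s V F1 F2) q v)"
    "diff_at (mcf s V E2 F0) q v = 3/5 * (diff_at (mcf s V F1 F2) q v - diff_at (mcf s W F1 F2) q v)"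
    "diff_at (mcf s W E2 F0) q v = diff_at (mcf s W F1 F1) q v + diff_at (mcf s W F1 F2) q v"
    unfolding r by (rule diff_at_eq_on[OF q], erule omega_0j)+
qed

text \<open>The value on \<open>X\<close> of \<open>df + k f \<omega>\<^sub>0\<^sub>0\<close>, that is, the functions \<open>a\<^sub>i\<^sub>k\<close>, \<open>b\<^sub>i\<^sub>k\<close>, \<open>c\<^sub>i\<^sub>k\<close>.\<close>

definition cov :: "(surf \<Rightarrow> complex) \<Rightarrow> (surf \<Rightarrow> surf) \<Rightarrow> complex \<Rightarrow> surf \<Rightarrow> complex" where
  "cov f X k q = diff_at f q (X q) + k * f q * mcf s X E0 F0 q"

text \<open>The equations for eta_11 and eta_22 give a_11 and a_42. Those for eta_12, omega_01 and
  omega_02 are three linear equations for a_21, a_22, a_31, a_32, solved in terms of a_21. Those for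
  eta_10, eta_20 and eta_00 give the relations for b and c. The constants in \<open>cov\<close>
  absorb the terms with omega_00.\<close>

lemma relations:
  assumes q: "q \<in> N"
  defines "a1 \<equiv> mcf s W F1 F1" and "a2 \<equiv> mcf s V F1 F2" and "a3 \<equiv> mcf s W F1 F2" and "a4 \<equiv> mcf s V F2 F2"
    and "b1 \<equiv> mcf s V F0 F1" and "b2 \<equiv> mcf s W F0 F1" and "b3 \<equiv> mcf s V F0 F2"
    and "c1 \<equiv> mcf s V F0 F0" and "c2 \<equiv> mcf s W F0 F0"
  shows "cov a1 V (4/3) q = - 2 * b2 q"
    "cov a2 W (4/3) q = - (3/2) * cov a2 V (4/3) q + 15/2 * b3 q + 8 * b1 q"
    "cov a3 V (4/3) q = - (3/2) * cov a2 V (4/3) q + 15/2 * b3 q + 10 * b1 q"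
    "cov a3 W (4/3) q = cov a2 V (4/3) q + 5 * b2 q - 12 * b1 q - 5 * b3 q"
    "cov a4 W (4/3) q = - 2 * b3 q"
    "cov b1 W 2 q = cov b2 V 2 q - 3/5 * (a3 q)\<^sup>2 + c2 q + a4 q * a1 q - 2/5 * a2 q * a3 q"
    "cov b3 W 2 q = - cov b1 V 2 q - c1 q + 3/5 * (a2 q)\<^sup>2 + 2/5 * a2 q * a3 q - a4 q * a1 q"
    "cov c1 W (8/3) q = cov c2 V (8/3) q - 2 * a1 q * b3 q - 2 * a3 q * b3 q + 2 * a2 q * b2 q + 2 * a4 q * b2 q"
proof -
  obtain c d where st: "\<And>u w. diff_at (mcf s W u w) q (V q) - diff_at (mcf s V u w) q (W q) =
    c * mcf s V u w q + d * mcf s W u w q +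
    (\<Sum>i\<in>UNIV. mcf s W u (Inl i) q * mcf s V w (Inr i) q - mcf s W u (Inr i) q * mcf s V w (Inl i) q
      - mcf s V u (Inl i) q * mcf s W w (Inr i) q + mcf s V u (Inr i) q * mcf s W w (Inl i) q)"
    using structure_eq[OF q] by blast
  note r = q norms[OF q] diff_norms[OF q] omega_0j[OF q] diff_omega_0j[OF q] sum_index
    a1_def[symmetric] a2_def[symmetric] a3_def[symmetric] a4_def[symmetric]
    b1_def[symmetric] b2_def[symmetric] b3_def[symmetric] c1_def[symmetric] c2_def[symmetric]
  have c: "c = 2/3 * mcf s W E0 F0 q" 
    using st[of E0 F1] by (simp add: r)
  have d: "d = - 2/3 * mcf s V E0 F0 q"
    using st[of E0 F2] by (simp add: r; algebra)
  note e = st[unfolded c d]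
  show 1: "cov a1 V (4/3) q = - 2 * b2 q"
    using e[of F1 F1] unfolding cov_def by (simp add: r; algebra)
  show 5: "cov a4 W (4/3) q = - 2 * b3 q"
    using e[of F2 F2] unfolding cov_def by (simp add: r; algebra)
  have 31: "cov a3 V (4/3) q = cov a2 W (4/3) q + 2 * b1 q"
    using e[of F1 F2] unfolding cov_def by (simp add: r; algebra)
  have 01: "- 3/5 * cov a2 V (4/3) q - cov a2 W (4/3) q + 3/5 * cov a3 V (4/3) q - cov a4 W (4/3) q
      + 2 * b1 q + b3 q = 0"
    using e[of E1 F0] unfolding cov_def by (simp add: r; algebra)
  have 02: "cov a1 V (4/3) q - 3/5 * cov a2 W (4/3) q + cov a3 V (4/3) q + 3/5 * cov a3 W (4/3) q
      + 2 * b1 q - b2 q = 0"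
    using e[of E2 F0] unfolding cov_def by (simp add: r; algebra)
  show "cov a2 W (4/3) q = - (3/2) * cov a2 V (4/3) q + 15/2 * b3 q + 8 * b1 q"
    "cov a3 V (4/3) q = - (3/2) * cov a2 V (4/3) q + 15/2 * b3 q + 10 * b1 q"
    "cov a3 W (4/3) q = cov a2 V (4/3) q + 5 * b2 q - 12 * b1 q - 5 * b3 q"
    using 1 5 31 01 02 by algebra+
  show "cov b1 W 2 q = cov b2 V 2 q - 3/5 * (a3 q)\<^sup>2 + c2 q + a4 q * a1 q - 2/5 * a2 q * a3 q"
    using e[of F0 F1] unfolding cov_def by (simp add: r; algebra)
  show "cov b3 W 2 q = - cov b1 V 2 q - c1 q + 3/5 * (a2 q)\<^sup>2 + 2/5 * a2 q * a3 q - a4 q * a1 q"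
    using e[of F0 F2] unfolding cov_def by (simp add: r; algebra)
  show "cov c1 W (8/3) q = cov c2 V (8/3) q - 2 * a1 q * b3 q - 2 * a3 q * b3 q + 2 * a2 q * b2 q + 2 * a4 q * b2 q"
    using e[of F0 F0] unfolding cov_def by (simp add: r; algebra)
qed

end

section \<open>Existence of normal frames near a point\<close>

lemma open_nonzero:
  fixes f :: "'a::complex_space \<Rightarrow> complex"
  assumes "holo f N"
  shows "open {q \<in> N. f q \<noteq> 0}"
proof -
  have "{q \<in> N. f q \<noteq> 0} = N \<inter> f -` (- {0})" by auto
  then show ?thesis
    using continuous_open_preimage[OF holo_continuous_on[OF assms] holo_open[OF assms], of "- {0}"]
    by (simp add: open_Compl)
qed

text \<open>At \<open>p\<close> two roots of the cubic lie on the axes, and the nonzero middle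
  coefficients make them simple. Their holomorphic continuations (1, e) and (f, 1) become the new
  axes; a diagonal factor then scales the middle coefficients to -1.\<close>

lemma theta_normalization:
  assumes ad: "adapted x s V W N" and p: "p \<in> N"
    and t: "mcf s V E1 E1 p = 0" "mcf s W E2 E2 p = 0" "mcf s V E1 E2 p \<noteq> 0" "mcf s V E2 E2 p \<noteq> 0"
  obtains N' s' V' W' where "p \<in> N'" "N' \<subseteq> N" "adapted x s' V' W' N'" "theta_normal s' V' W' N'"
proof -
  interpret adapted_frame x s V W N by standard (rule ad)
  note h = holo_mcf[OF holos(1) holos(3)] holo_mcf[OF holos(1) holos(4)]
  have k: "holo (\<lambda>q. 3 * mcf s V i j q) N" for i j by (intro holo_mult holo_const holos h)
  have k3: "3 * mcf s V E1 E2 p \<noteq> 0" "3 * mcf s V E2 E2 p \<noteq> 0" using t by simp_all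
  obtain A e where A: "p \<in> A" "A \<subseteq> N" "holo e A" "e p = 0"
    "\<And>q. q \<in> A \<Longrightarrow> mcf s V E1 E1 q + 3 * mcf s V E1 E2 q * e q + 3 * mcf s V E2 E2 q * e q ^ 2
      + mcf s W E2 E2 q * e q ^ 3 = 0"
    using holo_cubic_root[OF h(1) k k h(2) p t(1) k3(1)] by metis
  obtain C f where C: "p \<in> C" "C \<subseteq> N" "holo f C" "f p = 0"
    "\<And>q. q \<in> C \<Longrightarrow> mcf s W E2 E2 q + 3 * mcf s V E2 E2 q * f q + 3 * mcf s V E1 E2 q * f q ^ 2
      + mcf s V E1 E1 q * f q ^ 3 = 0"
    using holo_cubic_root[OF h(2) k k h(1) p t(2) k3(2)] by metis
  have oAC: "open (A \<inter> C)" using holo_open A(3) C(3) by blast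
  have ef: "holo e (A \<inter> C)" "holo f (A \<inter> C)"
    using holo_subset[OF A(3) oAC] holo_subset[OF C(3) oAC] by auto
  \<comment> \<open>The new axes are independent where this determinant is nonzero, in particular at
    \<open>p\<close>, where e = f = 0.\<close>
  define D where "D = {q \<in> A \<inter> C. 1 * 1 - f q * e q \<noteq> 0}"
  have oD: "open D" unfolding D_def
    by (intro open_nonzero holo_diff holo_mult holo_const ef oAC)
  have pD: "p \<in> D" using A(1,4) C(1,4) by (simp add: D_def)
  have ef: "holo e D" "holo f D"
    using holo_subset[OF ef(1) oD] holo_subset[OF ef(2) oD] by (auto simp: D_def)
  have adD: "adapted x s V W D" by (rule adapted_subset[OF ad oD]) (use A(2) D_def in auto)
  obtain s1 V1 W1 where ad1: "adapted x s1 V1 W1 D"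
    and t1: "\<And>q. q \<in> D \<Longrightarrow> mcf s1 V1 E1 E1 q = (1 ^ 3 * mcf s V E1 E1 q + 3 * 1 ^ 2 * e q * mcf s V E1 E2 q
      + 3 * 1 * e q ^ 2 * mcf s V E2 E2 q + e q ^ 3 * mcf s W E2 E2 q) / 1"
    "\<And>q. q \<in> D \<Longrightarrow> mcf s1 V1 E1 E2 q = (1 ^ 2 * f q * mcf s V E1 E1 q + (1 ^ 2 * 1 + 2 * 1 * f q * e q) * mcf s V E1 E2 q
      + (2 * 1 * e q * 1 + f q * e q ^ 2) * mcf s V E2 E2 q + e q ^ 2 * 1 * mcf s W E2 E2 q) / 1"
    "\<And>q. q \<in> D \<Longrightarrow> mcf s1 V1 E2 E2 q = (1 * f q ^ 2 * mcf s V E1 E1 q + (2 * 1 * f q * 1 + f q ^ 2 * e q) * mcf s V E1 E2 q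
      + (1 * 1 ^ 2 + 2 * f q * e q * 1) * mcf s V E2 E2 q + e q * 1 ^ 2 * mcf s W E2 E2 q) / 1"
    "\<And>q. q \<in> D \<Longrightarrow> mcf s1 W1 E2 E2 q = (f q ^ 3 * mcf s V E1 E1 q + 3 * f q ^ 2 * 1 * mcf s V E1 E2 q
      + 3 * f q * 1 ^ 2 * mcf s V E2 E2 q + 1 ^ 3 * mcf s W E2 E2 q) / 1"
    using adapted_levi[OF adD holo_const[OF oD, of 1] holo_const[OF oD, of 1] ef(2) ef(1) holo_const[OF oD, of 1]]
    by (auto simp: D_def)
  have z1: "mcf s1 V1 E1 E1 q = 0" "mcf s1 W1 E2 E2 q = 0" if "q \<in> D" for q
    using t1(1,4)[OF that] A(5)[of q] C(5)[of q] that by (auto simp: D_def algebra_simps)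
  have nz: "mcf s1 V1 E1 E2 p \<noteq> 0" "mcf s1 V1 E2 E2 p \<noteq> 0"
    using t1(2,3)[OF pD] t by (simp_all add: A(4) C(4))
  interpret D: adapted_frame x s1 V1 W1 D by standard (rule ad1)
  note h1 = holo_mcf[OF D.holos(1) D.holos(3)]
  define N' where "N' = {q \<in> D. mcf s1 V1 E1 E2 q * mcf s1 V1 E2 E2 q \<noteq> 0}"
  have oN': "open N'" unfolding N'_def by (intro open_nonzero holo_mult h1)
  have hN': "holo (mcf s1 V1 i j) N'" for i j by (rule holo_subset[OF h1 oN']) (auto simp: N'_def)
  have adN: "adapted x s1 V1 W1 N'" by (rule adapted_subset[OF ad1 oN']) (auto simp: N'_def)
  \<comment> \<open>This choice of the scalings of \<open>e\<^sub>0, e\<^sub>1, e\<^sub>2\<close> avoids roots.\<close>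
  let ?u = "mcf s1 V1 E1 E2" and ?v = "mcf s1 V1 E2 E2"
  have H: "holo (\<lambda>q. - ((?u q * ?v q) ^ 2)) N'" by (intro holo_minus holo_power holo_mult hN')
  obtain s2 V2 W2 where ad2: "adapted x s2 V2 W2 N'"
    and t2: "\<And>q. q \<in> N' \<Longrightarrow> mcf s2 V2 E1 E1 q = (?v q ^ 3 * mcf s1 V1 E1 E1 q + 3 * ?v q ^ 2 * 0 * mcf s1 V1 E1 E2 q
      + 3 * ?v q * 0 ^ 2 * mcf s1 V1 E2 E2 q + 0 ^ 3 * mcf s1 W1 E2 E2 q) / - ((?u q * ?v q) ^ 2)"
    "\<And>q. q \<in> N' \<Longrightarrow> mcf s2 V2 E1 E2 q = (?v q ^ 2 * 0 * mcf s1 V1 E1 E1 q + (?v q ^ 2 * ?u q + 2 * ?v q * 0 * 0) * mcf s1 V1 E1 E2 q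
      + (2 * ?v q * 0 * ?u q + 0 * 0 ^ 2) * mcf s1 V1 E2 E2 q + 0 ^ 2 * ?u q * mcf s1 W1 E2 E2 q) / - ((?u q * ?v q) ^ 2)"
    "\<And>q. q \<in> N' \<Longrightarrow> mcf s2 V2 E2 E2 q = (?v q * 0 ^ 2 * mcf s1 V1 E1 E1 q + (2 * ?v q * 0 * ?u q + 0 ^ 2 * 0) * mcf s1 V1 E1 E2 q
      + (?v q * ?u q ^ 2 + 2 * 0 * 0 * ?u q) * mcf s1 V1 E2 E2 q + 0 * ?u q ^ 2 * mcf s1 W1 E2 E2 q) / - ((?u q * ?v q) ^ 2)"
    "\<And>q. q \<in> N' \<Longrightarrow> mcf s2 W2 E2 E2 q = (0 ^ 3 * mcf s1 V1 E1 E1 q + 3 * 0 ^ 2 * ?u q * mcf s1 V1 E1 E2 q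
      + 3 * 0 * ?u q ^ 2 * mcf s1 V1 E2 E2 q + ?u q ^ 3 * mcf s1 W1 E2 E2 q) / - ((?u q * ?v q) ^ 2)"
    using adapted_levi[OF adN H hN'[of E2 E2] holo_const[OF oN', of 0] holo_const[OF oN', of 0] hN'[of E1 E2]]
    by (auto simp: N'_def)
  have uv: "?u q \<noteq> 0" "?v q \<noteq> 0" "q \<in> D" if "q \<in> N'" for q using that by (auto simp: N'_def)
  have "theta_normal s2 V2 W2 N'"
    unfolding theta_normal_def
  proof (intro ballI conjI)
    fix q assume q: "q \<in> N'"
    note u = uv[OF q]
    show "mcf s2 V2 E1 E1 q = 0" "mcf s2 W2 E2 E2 q = 0"
      unfolding t2(1)[OF q] t2(4)[OF q] by (simp_all add: z1[OF u(3)])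
    show m: "mcf s2 V2 E1 E2 q = - 1" "mcf s2 V2 E2 E2 q = - 1"
      unfolding t2(2)[OF q] t2(3)[OF q] using u by (simp_all add: field_simps power2_eq_square)
    show "mcf s2 W2 E1 E1 q = - 1" "mcf s2 W2 E1 E2 q = - 1"
      unfolding cubic_sym[OF ad2 q] by (rule m)+
  qed
  moreover have "p \<in> N'" "N' \<subseteq> N" using pD nz A(2) by (auto simp: N'_def D_def)
  ultimately show ?thesis using that ad2 by blast
qed

text \<open>A binary cubic is determined by its values at (1, 0), (0, 1), (1, 1) and (1,
  -1).\<close>

lemma cubic_coefficients:
  fixes t1 t2 t3 t4 :: complex
  assumes "\<And>y z. t1 * y ^ 3 + 3 * t2 * y ^ 2 * z + 3 * t3 * y * z ^ 2 + t4 * z ^ 3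
    = (l1 * y + l2 * z) * (m1 * y + m2 * z) * (n1 * y + n2 * z)"
  shows "t1 = l1 * m1 * n1" "3 * t2 = l1 * m1 * n2 + l1 * m2 * n1 + l2 * m1 * n1"
    "3 * t3 = l1 * m2 * n2 + l2 * m1 * n2 + l2 * m2 * n1" "t4 = l2 * m2 * n2"
proof -
  show 1: "t1 = l1 * m1 * n1" using assms[of 1 0] by simp
  show 4: "t4 = l2 * m2 * n2" using assms[of 0 1] by simp
  have "t1 + 3 * t2 + 3 * t3 + t4 = (l1 + l2) * (m1 + m2) * (n1 + n2)" using assms[of 1 1] by simp
  moreover have "t1 - 3 * t2 + 3 * t3 - t4 = (l1 - l2) * (m1 - m2) * (n1 - n2)"
    using assms[of 1 "-1"] by simp
  ultimately show "3 * t2 = l1 * m1 * n2 + l1 * m2 * n1 + l2 * m1 * n1"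
    "3 * t3 = l1 * m2 * n2 + l2 * m1 * n2 + l2 * m2 * n1"
    using 1 4 by algebra+
qed

text \<open>The first basis change takes the zeros (l2, -l1) and (m2, -m1) of two linear factors as
  axes. The middle coefficients become, up to the factor 1/3, products of pairwise determinants of
  the linear factors, which are nonzero.\<close>

lemma normal_frame_exists:
  assumes ad: "adapted x s V W N" and p: "p \<in> N"
    and fac: "\<And>y z. mcf s V E1 E1 p * y ^ 3 + 3 * mcf s V E1 E2 p * y ^ 2 * z + 3 * mcf s V E2 E2 p * y * z ^ 2
      + mcf s W E2 E2 p * z ^ 3 = (l1 * y + l2 * z) * (m1 * y + m2 * z) * (n1 * y + n2 * z)"
    and np: "l1 * m2 - l2 * m1 \<noteq> 0" "l1 * n2 - l2 * n1 \<noteq> 0" "m1 * n2 - m2 * n1 \<noteq> 0"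
  obtains N' s' V' W' where "p \<in> N'" "N' \<subseteq> N" "normal_frame x s' V' W' N'"
proof -
  interpret adapted_frame x s V W N by standard (rule ad)
  note c = holo_const[OF holos(5)]
  have det: "1 \<noteq> (0::complex) \<and> l2 * (- m1) - m2 * (- l1) \<noteq> 0" using np(1) by (simp add: algebra_simps)
  obtain s1 V1 W1 where ad1: "adapted x s1 V1 W1 N"
    and t: "mcf s1 V1 E1 E1 p = (l2 ^ 3 * mcf s V E1 E1 p + 3 * l2 ^ 2 * (- l1) * mcf s V E1 E2 p
      + 3 * l2 * (- l1) ^ 2 * mcf s V E2 E2 p + (- l1) ^ 3 * mcf s W E2 E2 p) / 1"
    "mcf s1 V1 E1 E2 p = (l2 ^ 2 * m2 * mcf s V E1 E1 p + (l2 ^ 2 * (- m1) + 2 * l2 * m2 * (- l1)) * mcf s V E1 E2 p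
      + (2 * l2 * (- l1) * (- m1) + m2 * (- l1) ^ 2) * mcf s V E2 E2 p + (- l1) ^ 2 * (- m1) * mcf s W E2 E2 p) / 1"
    "mcf s1 V1 E2 E2 p = (l2 * m2 ^ 2 * mcf s V E1 E1 p + (2 * l2 * m2 * (- m1) + m2 ^ 2 * (- l1)) * mcf s V E1 E2 p
      + (l2 * (- m1) ^ 2 + 2 * m2 * (- l1) * (- m1)) * mcf s V E2 E2 p + (- l1) * (- m1) ^ 2 * mcf s W E2 E2 p) / 1"
    "mcf s1 W1 E2 E2 p = (m2 ^ 3 * mcf s V E1 E1 p + 3 * m2 ^ 2 * (- m1) * mcf s V E1 E2 p
      + 3 * m2 * (- m1) ^ 2 * mcf s V E2 E2 p + (- m1) ^ 3 * mcf s W E2 E2 p) / 1"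
    using adapted_levi[OF ad c[of 1] c[of l2] c[of m2] c[of "- l1"] c[of "- m1"]] det p by metis
  note cf = cubic_coefficients[OF fac]
  have "mcf s1 V1 E1 E1 p = 0" "mcf s1 W1 E2 E2 p = 0" using t(1,4) cf by algebra+
  moreover have eq: "3 * mcf s1 V1 E1 E2 p = (l1 * m2 - l2 * m1) * (l1 * m2 - l2 * m1) * (l1 * n2 - l2 * n1)"
    "3 * mcf s1 V1 E2 E2 p = (l1 * m2 - l2 * m1) * (l1 * m2 - l2 * m1) * (m1 * n2 - m2 * n1)"
    using t(2,3) cf by algebra+
  have "3 * mcf s1 V1 E1 E2 p \<noteq> 0" "3 * mcf s1 V1 E2 E2 p \<noteq> 0"
    unfolding eq mult_eq_0_iff using np by blast+
  then have "mcf s1 V1 E1 E2 p \<noteq> 0" "mcf s1 V1 E2 E2 p \<noteq> 0" by simp_all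
  ultimately obtain N' s2 V2 W2 where 2: "p \<in> N'" "N' \<subseteq> N" "adapted x s2 V2 W2 N'" "theta_normal s2 V2 W2 N'"
    using theta_normalization[OF ad1 p] by metis
  from transl_normalization[OF 2(3,4)] obtain s3 where 3: "adapted x s3 V2 W2 N'" "theta_normal s3 V2 W2 N'"
    "\<And>q. q \<in> N' \<Longrightarrow> 3 * (mcf s3 W2 E1 F2 q - mcf s3 V2 E1 F1 q - mcf s3 V2 E1 F2 q) + mcf s3 V2 E0 F0 q = 0"
    "\<And>q. q \<in> N' \<Longrightarrow> 3 * (mcf s3 V2 E2 F1 q - mcf s3 W2 E2 F2 q - mcf s3 W2 E2 F1 q) + mcf s3 W2 E0 F0 q = 0"
    by metis
  from omega_normalization[OF 3] obtain s4 where 4: "adapted x s4 V2 W2 N'" "theta_normal s4 V2 W2 N'" "omega_normal s4 V2 W2 N'"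
    by metis
  from eta_normalization[OF 4] obtain s5 where 5: "adapted x s5 V2 W2 N'" "theta_normal s5 V2 W2 N'" "omega_normal s5 V2 W2 N'"
    "eta_normal s5 V2 W2 N'" by metis
  from eta0_normalization[OF 5] obtain s6 where 6: "adapted x s6 V2 W2 N'" "theta_normal s6 V2 W2 N'" "omega_normal s6 V2 W2 N'"
    "eta_normal s6 V2 W2 N'" "eta0_normal s6 V2 W2 N'" by metis
  show ?thesis
    by (rule that[OF 2(1,2)], unfold_locales) (rule 6)+
qed

section \<open>Frames adapted to a Legendrian surface\<close>

lemma holo_prod:
  fixes f :: "'i \<Rightarrow> 'a::complex_space \<Rightarrow> complex"
  assumes "open N" "\<And>i. i \<in> I \<Longrightarrow> holo (f i) N"
  shows "holo (\<lambda>q. \<Prod>i\<in>I. f i q) N"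
  using assms by (induction I rule: infinite_finite_induct) (auto intro: holo_const holo_mult)

lemma holo_det:
  fixes A :: "'a::complex_space \<Rightarrow> complex ^ 'n ^ 'n"
  assumes "open N" "\<And>i j. holo (\<lambda>q. A q $ i $ j) N"
  shows "holo (\<lambda>q. det (A q)) N"
  unfolding det_def by (intro holo_sum holo_mult holo_const holo_prod assms)

lemma holo_diff_at_vec:
  fixes X :: "surf \<Rightarrow> V6"
  assumes X: "holo X U"
  shows "holo (\<lambda>q. diff_at X q v) U"
proof (rule holo_vecI)
  fix a
  show "holo (\<lambda>q. diff_at X q v $ a) U"
    by (rule holo_cong[OF holo_diff_at_complex[OF holo_vec_nth[OF X]]])
      (simp add: diff_at_vec_nth[OF X])
qed

lemma holo_varpi:
  assumes "holo X U" "holo Y U"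
  shows "holo (\<lambda>q. varpi (X q) (Y q)) U"
  unfolding varpi_def
  by (intro holo_sum holo_diff holo_mult holo_vec_nth assms holo_open[OF assms(1)])

text \<open>Differentiating the contact condition for \<open>v\<close> along \<open>w\<close> gives
  the pairing of two tangent vectors plus a term with second derivatives of \<open>X\<close>. The
  former is antisymmetric in \<open>v\<close>, \<open>w\<close> and the latter symmetric, so both
  vanish.\<close>

lemma tangent_isotropic:
  fixes X :: "surf \<Rightarrow> V6"
  assumes X: "holo X U" and c: "\<And>q v. q \<in> U \<Longrightarrow> varpi (X q) (diff_at X q v) = 0" and q: "q \<in> U"
  shows "varpi (diff_at X q v) (diff_at X q w) = 0"
proof -
  define Y where "Y a q = X q $ a" for a q
  have Y: "holo (Y a) U" for a unfolding Y_def by (rule holo_vec_nth[OF X])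
  have dY: "diff_at X q v $ a = diff_at (Y a) q v" if "q \<in> U" for a q v
    unfolding Y_def by (rule diff_at_vec_nth[OF X that, symmetric])
  note dd = holo_diff_at_complex[OF Y]
  define S where "S v w = (\<Sum>i\<in>UNIV. Y (Inl i) q * diff_at (\<lambda>q. diff_at (Y (Inr i)) q v) q w
    - Y (Inr i) q * diff_at (\<lambda>q. diff_at (Y (Inl i)) q v) q w)" for v w
  have e: "varpi (diff_at X q w) (diff_at X q v) + S v w = 0" for v w
  proof -
    let ?f = "\<lambda>q. \<Sum>i\<in>UNIV. Y (Inl i) q * diff_at (Y (Inr i)) q v - Y (Inr i) q * diff_at (Y (Inl i)) q v"
    have "?f q = 0" if "q \<in> U" for q
      using c[OF that, of v] by (simp add: varpi_def dY[OF that] Y_def)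
    then have "diff_at ?f q w = 0" by (rule diff_at_constant_on[OF holo_open[OF X] q])
    moreover have "diff_at ?f q w = varpi (diff_at X q w) (diff_at X q v) + S v w"
      by (simp add: diff_at_sum[OF holo_diff[OF holo_mult[OF Y dd] holo_mult[OF Y dd]] q]
        diff_at_diff[OF holo_mult[OF Y dd] holo_mult[OF Y dd] q] diff_at_mult[OF Y dd q]
        S_def varpi_def dY[OF q] flip: sum.distrib) (simp add: algebra_simps)
    ultimately show ?thesis by simp
  qed
  have "S v w = S w v" unfolding S_def by (simp add: second_diff_symmetric[OF Y q, of _ v w])
  then show ?thesis
    using e[of v w] e[of w v] varpi_swap[of "diff_at X q v" "diff_at X q w"] by simp
qed

text \<open>Two lifts differ by a factor \<mu>, holomorphic near \<open>q\<close> as a quotient of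
  coordinates, and dX' = \<mu> dX + d\<mu> X stays in the same three-dimensional space.\<close>

lemma local_lift_unique:
  assumes "local_lift x U X" "local_lift x U' X'" "q \<in> U" "q \<in> U'"
  shows "\<exists>c' v'. c *s X' q + diff_at X' q v = c' *s X q + diff_at X q v'"
proof -
  have X: "holo X U" "holo X' U'" and nz: "X q \<noteq> 0"
    and span: "\<And>r. r \<in> U \<inter> U' \<Longrightarrow> vec.span {X' r} = vec.span {X r}"
    using assms by (auto simp: local_lift_def)
  obtain a where a: "X q $ a \<noteq> 0" using nz by (auto simp: vec_eq_iff)
  have o: "open (U \<inter> U')" using holo_open X by blast
  have XX: "holo X (U \<inter> U')" "holo X' (U \<inter> U')" using holo_subset[OF X(1) o] holo_subset[OF X(2) o] by auto
  define D where "D = {r \<in> U \<inter> U'. X r $ a \<noteq> 0}"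
  have oD: "open D" unfolding D_def by (rule open_nonzero[OF holo_vec_nth[OF XX(1)]])
  have qD: "q \<in> D" using a assms(3,4) by (simp add: D_def)
  have XD: "holo X D" "holo X' D" using holo_subset[OF XX(1) oD] holo_subset[OF XX(2) oD] by (auto simp: D_def)
  define \<mu> where "\<mu> r = X' r $ a / X r $ a" for r
  have \<mu>: "holo \<mu> D" unfolding \<mu>_def
    by (intro holo_divide holo_vec_nth XD) (simp add: D_def)
  have eq: "X' r = \<mu> r *s X r" if "r \<in> D" for r
  proof -
    have "X' r \<in> vec.span {X r}"
      using span[of r] that vec.span_base[of "X' r" "{X' r}"] by (auto simp: D_def)
    then obtain k where k: "X' r = k *s X r" by (auto simp: vec.span_singleton)
    then show ?thesis using that by (simp add: \<mu>_def D_def)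
  qed
  have "diff_at X' q v $ b = (\<mu> q *s diff_at X q v + diff_at \<mu> q v *s X q) $ b" for b
  proof -
    have "diff_at X' q v $ b = diff_at (\<lambda>r. X' r $ b) q v"
      by (rule diff_at_vec_nth[OF XD(2) qD, symmetric])
    also have "\<dots> = diff_at (\<lambda>r. \<mu> r * X r $ b) q v"
      by (rule fun_cong[OF diff_at_cong[OF oD qD]]) (simp add: eq)
    also have "\<dots> = \<mu> q * diff_at X q v $ b + diff_at \<mu> q v * X q $ b"
      by (simp add: diff_at_mult[OF \<mu> holo_vec_nth[OF XD(1)] qD] diff_at_vec_nth[OF XD(1) qD])
    finally show ?thesis by simp
  qed
  then have "diff_at X' q v = \<mu> q *s diff_at X q v + diff_at \<mu> q v *s X q" by (simp add: vec_eq_iff)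
  moreover have "diff_at X q (\<mu> q *s v) = \<mu> q *s diff_at X q v"
    using holo_diff_cscale[OF XD(1) qD, of "\<mu> q" v] by (simp add: cscale_vector)
  ultimately have "c *s X' q + diff_at X' q v =
      (c * \<mu> q + diff_at \<mu> q v) *s X q + diff_at X q (\<mu> q *s v)"
    by (simp add: eq[OF qD] vec_eq_iff algebra_simps)
  then show ?thesis by blast
qed

lemma legendre_lift_eq:
  assumes "local_lift x U X" "q \<in> U"
  shows "legendre_lift x q = (x q, {c *s X q + diff_at X q v |c v. True})"
proof -
  have "c *s X' q + diff_at X' q v \<in> {c *s X q + diff_at X q v |c v. True}"
    if "q \<in> U'" "local_lift x U' X'" for c v X' U'
    using local_lift_unique[OF assms(1) that(2) assms(2) that(1), of c v] by blast
  then have "{c *s X' q + diff_at X' q v |c v X'. \<exists>U. q \<in> U \<and> local_lift x U X'} \<subseteq>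
      {c *s X q + diff_at X q v |c v. True}"
    by (intro subsetI) (elim CollectE exE conjE, simp only:)
  moreover have "{c *s X q + diff_at X q v |c v. True} \<subseteq>
      {c *s X' q + diff_at X' q v |c v X'. \<exists>U. q \<in> U \<and> local_lift x U X'}"
    using assms by (intro subsetI) (elim CollectE exE conjE, intro CollectI exI conjI)
  ultimately show ?thesis unfolding legendre_lift_def by (intro arg_cong2[of _ _ _ _ Pair] subset_antisym refl)
qed

lemma diff_at_scale_const:
  fixes X :: "surf \<Rightarrow> V6"
  assumes "holo X U" "q \<in> U"
  shows "diff_at (\<lambda>q. h *s X q) q v = h *s diff_at X q v"
proof -
  have "((\<lambda>q. h *s X q) has_derivative (\<lambda>v. h *s diff_at X q v)) (at q)"
    by (rule has_derivative_vec, unfold vector_smult_component)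
      (rule has_derivative_mult_right[OF bounded_linear.has_derivative[OF bounded_linear_vec_nth
        holo_has_derivative[OF assms]]])
  then show ?thesis by (simp add: diff_at_eq)
qed

lemma surf_basis:
  fixes v1 v2 :: surf
  assumes "\<And>\<alpha> \<beta>. \<alpha> *s v1 + \<beta> *s v2 = 0 \<Longrightarrow> \<alpha> = 0 \<and> \<beta> = 0"
  shows "\<exists>c d. v = c *s v1 + d *s v2"
proof -
  let ?D = "v1 $ 1 * v2 $ 2 - v1 $ 2 * v2 $ 1"
  have "?D \<noteq> 0"
  proof
    assume D: "?D = 0"
    \<comment> \<open>With vanishing determinant these are linear relations, so their coefficients
      vanish by independence; in particular v1 = 0, which contradicts independence.\<close>
    have "v2 $ 1 *s v1 + (- v1 $ 1) *s v2 = 0" "v2 $ 2 *s v1 + (- v1 $ 2) *s v2 = 0"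
      using D by (simp_all add: vec_eq_iff forall_2 mult.commute)
    from this[THEN assms] have "v1 = 0" by (simp add: vec_eq_iff forall_2)
    then have "1 *s v1 + 0 *s v2 = 0" by simp
    from assms[OF this] show False by simp
  qed
  then have "v = ((v $ 1 * v2 $ 2 - v $ 2 * v2 $ 1) / ?D) *s v1 + ((v1 $ 1 * v $ 2 - v1 $ 2 * v $ 1) / ?D) *s v2"
    by (simp add: vec_eq_iff forall_2 divide_simps) (simp add: algebra_simps)
  then show ?thesis by blast
qed


lemma e_vec_entry: "e_vec F j $ a = F $ a $ Inl j"
  by (simp add: e_vec_def column_def)

lemma f_vec_entry: "f_vec F j $ a = F $ a $ Inr j"
  by (simp add: f_vec_def column_def)

lemma Sp3_vecs:
  assumes "F \<in> Sp3"
  shows "varpi (e_vec F i) (e_vec F j) = 0" "varpi (f_vec F i) (f_vec F j) = 0"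
    "varpi (e_vec F i) (f_vec F j) = (if i = j then 1 else 0)"
  using assms by (auto simp: Sp3_def)

text \<open>The Lagrangian plane spanned by the \<open>f\<close>-vectors of a fixed frame stays complementary to
  nearby Lagrangian planes, and inverting the pairing of the two planes yields the dual basis.\<close>

lemma lagrangian_completion:
  fixes E :: "3 \<Rightarrow> surf \<Rightarrow> V6"
  assumes E: "\<And>j. holo (E j) U" "\<And>q i j. q \<in> U \<Longrightarrow> varpi (E i q) (E j q) = 0"
    and F: "F \<in> Sp3" "\<And>j. E j p = e_vec F j" and p: "p \<in> U"
  obtains N s where "p \<in> N" "N \<subseteq> U" "holo s N" "s ` N \<subseteq> Sp3" "s p = F" "\<And>q j. e_vec (s q) j = E j q"
proof -
  define A :: "surf \<Rightarrow> complex ^ 3 ^ 3" where "A q = (\<chi> i j. varpi (E i q) (f_vec F j))" for q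
  have o: "open U" using holo_open[OF E(1)] by blast
  have A: "holo (\<lambda>q. A q $ i $ j) U" for i j
    unfolding A_def by (simp, intro holo_varpi E holo_const o)
  have dA: "holo (\<lambda>q. det (A q)) U" by (rule holo_det[OF o A])
  define N where "N = {q \<in> U. det (A q) \<noteq> 0}"
  have oN: "open N" unfolding N_def by (rule open_nonzero[OF dA])
  have NU: "N \<subseteq> U" by (auto simp: N_def)
  have Ap: "A p = mat 1" by (simp add: A_def F Sp3_vecs[OF F(1)] mat_def)
  \<comment> \<open>The inverse transpose of the pairing matrix by Cramer's rule: as a quotient of
    determinants it is visibly holomorphic.\<close>
  define K where "K j k q = det (\<chi> i l. if l = k then axis j 1 $ i else A q $ i $ l) / det (A q)" for j k q
  have K: "holo (K j k) N" for j k
    unfolding K_def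
  proof (intro holo_divide holo_det oN)
    show "holo (\<lambda>q. (\<chi> i l. if l = k then axis j 1 $ i else A q $ i $ l) $ i' $ l') N" for i' l'
      unfolding vec_lambda_beta by (intro holo_if holo_const oN holo_subset[OF A oN NU])
    show "holo (\<lambda>q. A q $ i' $ l') N" for i' l' by (rule holo_subset[OF A oN NU])
  qed (auto simp: N_def)
  have AK: "(\<Sum>k\<in>UNIV. A q $ i $ k * K j k q) = (if i = j then 1 else 0)" if "q \<in> N" for q i j
  proof -
    have "A q *v (\<chi> k. K j k q) = axis j 1"
      using that unfolding K_def by (subst cramer) (auto simp: N_def)
    from arg_cong[OF this, of "\<lambda>v. v $ i"] show ?thesis
      by (simp add: matrix_vector_mult_def axis_def)
  qed
  define Fv where "Fv j q = (\<Sum>k\<in>UNIV. K j k q *s f_vec F k)" for j q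
  define s :: "surf \<Rightarrow> frame" where
    "s q = (\<chi> a b. case b of Inl j \<Rightarrow> E j q $ a | Inr j \<Rightarrow> Fv j q $ a)" for q
  have ev: "e_vec (s q) j = E j q" and fv: "f_vec (s q) j = Fv j q" for q j
    by (simp_all add: vec_eq_iff e_vec_entry f_vec_entry s_def)
  show ?thesis
  proof (rule that[OF _ NU _ _ _ ev])
    show pN: "p \<in> N" using p Ap by (simp add: N_def)
    show "holo s N"
    proof (rule holo_frameI)
      fix a b
      show "holo (\<lambda>q. s q $ a $ b) N"
      proof (cases b)
        case (Inl j)
        then show ?thesis using holo_subset[OF holo_vec_nth[OF E(1)] oN NU] by (simp add: s_def)
      next
        case (Inr j)
        then show ?thesis
          by (simp add: s_def Fv_def, intro holo_sum holo_mult K holo_const oN)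
      qed
    qed
    show "s ` N \<subseteq> Sp3"
    proof (rule image_subsetI)
      fix q assume q: "q \<in> N"
      have "varpi (E i q) (Fv j q) = (if i = j then 1 else 0)" for i j
        using AK[OF q, of i j] by (simp add: Fv_def varpi_sum_right varpi_scale_right A_def mult.commute)
      moreover have "varpi (Fv i q) (Fv j q) = 0" for i j
        by (simp add: Fv_def varpi_sum_sum Sp3_vecs[OF F(1)])
      ultimately show "s q \<in> Sp3"
        using E(2) q NU unfolding Sp3_def by (auto simp: ev fv)
    qed
    have Kp: "K j k p = (if k = j then 1 else 0)" for j k
      using AK[OF pN, of k j] by (simp add: Ap mat_def if_distrib[of "\<lambda>x. x * _"] cong: if_cong)
    have "s p $ a $ b = F $ a $ b" for a b
    proof (cases b)
      case (Inl j)
      then show ?thesis by (simp add: s_def F e_vec_entry)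
    next
      case (Inr j)
      then show ?thesis
        by (simp add: s_def Fv_def Kp f_vec_entry if_distrib[of "\<lambda>x. x * _"] cong: if_cong)
    qed
    then show "s p = F" by (simp add: vec_eq_iff)
  qed
qed

text \<open>Nondegeneracy is given through one frame at \<open>p\<close>, so the section must extend
  exactly this frame. Its \<open>e\<close> vectors are combinations of a lift \<open>X\<close> and
  derivatives of \<open>X\<close> at \<open>p\<close>; the same constant coefficients define
  isotropic vectors nearby, which \<open>lagrangian_completion\<close> completes.\<close>

lemma initial_section:
  assumes im: "immersed_legendrian M x" and p: "p \<in> M" and F: "(p, F) \<in> frame_bundle M x"
  obtains N s V W where "p \<in> N" "N \<subseteq> M" "adapted x s V W N" "s p = F"
proof -
  obtain U X where U: "p \<in> U" "U \<subseteq> M" and lift: "local_lift x U X"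
    and imm: "\<And>q v. q \<in> U \<Longrightarrow> diff_at X q v \<in> vec.span {X q} \<Longrightarrow> v = 0"
    and leg: "\<And>q v. q \<in> U \<Longrightarrow> varpi (X q) (diff_at X q v) = 0"
    using im p unfolding immersed_legendrian_def by meson
  have X: "holo X U" and xX: "\<And>q. q \<in> U \<Longrightarrow> x q = vec.span {X q}"
    using lift by (auto simp: local_lift_def)
  have FS: "F \<in> Sp3" and flag: "frame_flag F = (x p, {c *s X p + diff_at X p v |c v. True})"
    using F legendre_lift_eq[OF lift U(1)] by (auto simp: frame_bundle_def)
  note sp = Sp3_vecs[OF FS]
  have "e_vec F 0 \<in> vec.span {X p}"
    using flag xX[OF U(1)] vec.span_base[of "e_vec F 0" "{e_vec F 0}"] by (simp add: frame_flag_def)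
  then obtain h where h: "e_vec F 0 = h *s X p" by (auto simp: vec.span_singleton)
  have h0: "h \<noteq> 0" using sp(3)[of 0 0] by (auto simp: h)
  have T: "e_vec F j \<in> {c *s X p + diff_at X p v |c v. True}" if "j = 1 \<or> j = 2" for j
  proof -
    have "e_vec F j \<in> vec.span {e_vec F 0, e_vec F 1, e_vec F 2}"
      using that by (intro vec.span_base) auto
    then show ?thesis using flag by (simp add: frame_flag_def)
  qed
  obtain c1 v1 where e1: "e_vec F 1 = c1 *s X p + diff_at X p v1" using T[of 1] by auto
  obtain c2 v2 where e2: "e_vec F 2 = c2 *s X p + diff_at X p v2" using T[of 2] by auto
  define E where "E j q = (if j = 0 then h *s X q else if j = 1 then c1 *s X q + diff_at X q v1
    else c2 *s X q + diff_at X q v2)" for j :: 3 and q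
  have hs: "holo (\<lambda>q. c *s X q) U" for c
    by (rule holo_vecI) (simp, intro holo_mult holo_const holo_vec_nth X holo_open[OF X])
  have "holo (E j) U" for j
    unfolding E_def by (intro holo_if holo_add hs holo_diff_at_vec X)
  moreover have "varpi (E i q) (E j q) = 0" if "q \<in> U" for i j q
  proof -
    have "varpi (diff_at X q v) (X q) = 0" for v
      using varpi_swap[of "diff_at X q v" "X q"] leg[OF that] by simp
    then show ?thesis
      by (simp add: E_def varpi_add_left varpi_add_right varpi_scale_left varpi_scale_right
          leg[OF that] tangent_isotropic[OF X leg that])
  qed
  moreover have "E j p = e_vec F j" for j
  proof -
    have "\<forall>j. E j p = e_vec F j" unfolding all_index by (simp add: E_def h e1 e2)
    then show ?thesis by blast
  qed
  ultimately obtain N s where N: "p \<in> N" "N \<subseteq> U" "holo s N" "s ` N \<subseteq> Sp3" "s p = F"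
    and ev: "\<And>q j. e_vec (s q) j = E j q"
    using lagrangian_completion[of E U F p] FS U(1) by metis
  have oN: "open N" by (rule holo_open[OF N(3)])
  have XE: "X q = inverse h *s e_vec (s q) 0" for q using h0 by (simp add: ev E_def)
  have dX1: "diff_at X q v1 = e_vec (s q) 1 - (c1 * inverse h) *s e_vec (s q) 0"
    and dX2: "diff_at X q v2 = e_vec (s q) 2 - (c2 * inverse h) *s e_vec (s q) 0" for q
    using h0 by (simp_all add: ev E_def)
  have basis: "\<exists>c d. v = c *s v1 + d *s v2" for v
  proof (rule surf_basis)
    fix \<alpha> \<beta> assume z: "\<alpha> *s v1 + \<beta> *s v2 = 0"
    have "diff_at X p (\<alpha> *s v1 + \<beta> *s v2) = \<alpha> *s diff_at X p v1 + \<beta> *s diff_at X p v2"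
      using holo_diff_add[OF X U(1)] holo_diff_cscale[OF X U(1)]
      by (simp add: cscale_vector)
    then have "\<alpha> *s diff_at X p v1 + \<beta> *s diff_at X p v2 = 0"
      unfolding z using linear_0[OF bounded_linear.linear[OF holo_bounded_linear[OF X U(1)]]] by simp
    then have "varpi (\<alpha> *s diff_at X p v1 + \<beta> *s diff_at X p v2) (f_vec F j) = 0" for j by simp
    from this[of 1] this[of 2] show "\<alpha> = 0 \<and> \<beta> = 0"
      by (simp add: dX1 dX2 N(5) varpi_add_left varpi_diff_left varpi_scale_left sp)
  qed
  \<comment> \<open>As e_0 = h X and e_i = c_i X + dX(v_i), the derivative of e_0 along v_i / h is
    dX(v_i), which is e_i modulo e_0. These constant fields are therefore dual to the
    coframe.\<close>
  let ?V = "\<lambda>_::surf. inverse h *s v1" let ?W = "\<lambda>_::surf. inverse h *s v2"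
  have "frame_flag (s q) = legendre_lift x q" if q: "q \<in> N" for q
  proof -
    have qU: "q \<in> U" using q N(2) by auto
    let ?T = "{c *s X q + diff_at X q v |c v. True}"
    let ?S = "vec.span {e_vec (s q) 0, e_vec (s q) 1, e_vec (s q) 2}"
    have dl: "diff_at X q (c *s v + d *s w) = c *s diff_at X q v + d *s diff_at X q w" for c d v w
      using holo_diff_add[OF X qU] holo_diff_cscale[OF X qU] by (simp add: cscale_vector)
    have "?T \<subseteq> ?S"
    proof safe
      fix c v
      obtain a b where "v = a *s v1 + b *s v2" using basis by blast
      then show "c *s X q + diff_at X q v \<in> ?S"
        by (simp only: dl dX1 dX2 XE)
          (intro vec.span_add vec.span_diff vec.span_scale vec.span_base; simp)
    qed
    moreover have "?S \<subseteq> ?T"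
    proof (rule vec.span_minimal)
      have T: "c *s X q + diff_at X q v \<in> ?T" for c v by blast
      have "diff_at X q 0 = 0"
        by (rule linear_0[OF bounded_linear.linear[OF holo_bounded_linear[OF X qU]]])
      then show "{e_vec (s q) 0, e_vec (s q) 1, e_vec (s q) 2} \<subseteq> ?T"
        using T[of h 0] T[of c1 v1] T[of c2 v2] by (simp add: ev E_def)
      show "vec.subspace ?T"
      proof (rule vec.subspaceI)
        show "0 \<in> ?T" using T[of 0 0] \<open>diff_at X q 0 = 0\<close> by simp
      next
        fix y z assume "y \<in> ?T" "z \<in> ?T"
        then obtain c v d w where "y = c *s X q + diff_at X q v" "z = d *s X q + diff_at X q w" by blast
        then have eq: "y + z = (c + d) *s X q + diff_at X q (1 *s v + 1 *s w)"
          unfolding dl by (simp add: vec_eq_iff algebra_simps)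
        show "y + z \<in> ?T" unfolding eq by (rule T)
      next
        fix k y assume "y \<in> ?T"
        then obtain c v where "y = c *s X q + diff_at X q v" by blast
        then have eq: "k *s y = (k * c) *s X q + diff_at X q (k *s v + 0 *s v)"
          unfolding dl by (simp add: vec_eq_iff algebra_simps)
        show "k *s y \<in> ?T" unfolding eq by (rule T)
      qed
    qed
    ultimately have "?S = ?T" by blast
    moreover have "vec.span {e_vec (s q) 0} = x q"
      using span_scale_singleton[OF h0, of "X q"] xX[OF qU] by (simp add: ev E_def)
    ultimately show ?thesis by (simp add: frame_flag_def legendre_lift_eq[OF lift qU])
  qed
  moreover have m: "mcf s (\<lambda>_. inverse h *s v) E0 u q = varpi (diff_at X q v) (column u (s q))"
    if q: "q \<in> N" for v u q
  proof -
    have qU: "q \<in> U" using q N(2) by auto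
    have "column E0 (diff_at s q w) = h *s diff_at X q w" for w
    proof -
      have "diff_at s q w $ a $ E0 = h * diff_at X q w $ a" for a
      proof -
        have "diff_at s q w $ a $ E0 = diff_at (\<lambda>q. s q $ a $ E0) q w"
          by (rule diff_at_entry[OF N(3) q, symmetric])
        also have "(\<lambda>q. s q $ a $ E0) = (\<lambda>q. (h *s X q) $ a)"
          using ev[of _ 0] by (auto simp: E_def vec_eq_iff e_vec_entry)
        also have "diff_at \<dots> q w = h * diff_at X q w $ a"
          by (simp add: diff_at_vec_nth[OF hs qU] diff_at_scale_const[OF X qU] del: vector_smult_component)
             simp
        finally show ?thesis .
      qed
      then show ?thesis by (simp add: vec_eq_iff column_def)
    qed
    moreover have "diff_at X q (inverse h *s v) = inverse h *s diff_at X q v"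
      using holo_diff_cscale[OF X qU, of "inverse h" v] by (simp add: cscale_vector)
    ultimately show ?thesis using h0 by (simp add: mcf_def bform_def)
  qed
  moreover have "\<exists>c d. v = c *s (inverse h *s v1) + d *s (inverse h *s v2)" for v
  proof -
    obtain a b where "v = a *s v1 + b *s v2" using basis by blast
    then have "v = (a * h) *s (inverse h *s v1) + (b * h) *s (inverse h *s v2)"
      using h0 by (simp add: vector_smult_assoc mult.assoc)
    then show ?thesis by blast
  qed
  moreover have "varpi (diff_at X q v1) (column (Inl j) (s q)) = 0"
    "varpi (diff_at X q v2) (column (Inl j) (s q)) = 0"
    "varpi (diff_at X q v1) (column F1 (s q)) = 1" "varpi (diff_at X q v1) (column F2 (s q)) = 0"
    "varpi (diff_at X q v2) (column F1 (s q)) = 0" "varpi (diff_at X q v2) (column F2 (s q)) = 1"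
    if q: "q \<in> N" for q j
  proof -
    have S: "s q \<in> Sp3" using q N(4) by auto
    show "varpi (diff_at X q v1) (column (Inl j) (s q)) = 0"
    "varpi (diff_at X q v2) (column (Inl j) (s q)) = 0"
    "varpi (diff_at X q v1) (column F1 (s q)) = 1" "varpi (diff_at X q v1) (column F2 (s q)) = 0"
    "varpi (diff_at X q v2) (column F1 (s q)) = 0" "varpi (diff_at X q v2) (column F2 (s q)) = 1"
      by (simp_all add: dX1 dX2 varpi_diff_left varpi_scale_left e_vec_def Sp3_varpi[OF S])
  qed
  ultimately have "adapted x s ?V ?W N"
    unfolding adapted_def using N(3,4) by (simp add: holo_const[OF oN])
  then show ?thesis using that N(1,2,5) U(2) by blast
qed

section \<open>The reduced bundle\<close>

text \<open>A scaling of e_1, e_2 by z and of e_0 by h multiplies the coefficients of the cubic by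
  z^3 / h, so keeping theta normal requires h = z^3. The other weights are the inverses.\<close>

definition weight :: "complex \<Rightarrow> 3 + 3 \<Rightarrow> complex" where
  "weight z a = (case a of Inl i \<Rightarrow> if i = 0 then z ^ 3 else z
     | Inr i \<Rightarrow> if i = 0 then inverse z ^ 3 else inverse z)"

lemma weight_simps [simp]:
  "weight z E0 = z ^ 3" "weight z E1 = z" "weight z E2 = z"
  "weight z F0 = inverse z ^ 3" "weight z F1 = inverse z" "weight z F2 = inverse z"
  by (simp_all add: weight_def)

definition scal :: "complex \<Rightarrow> frame" where
  "scal z = (\<chi> a b. if a = b then weight z a else 0)"

lemma scal_entry: "scal z $ a $ b = (if a = b then weight z a else 0)"
  by (simp add: scal_def)

lemma scal_one: "scal 1 = mat 1"
  by (simp add: vec_eq_iff scal_entry mat_def weight_def split: sum.split)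

lemma scal_mult: "scal z ** scal w = scal (z * w)"
  by (auto simp: vec_eq_iff matrix_entry scal_entry if_distrib[of "\<lambda>x. x * _"] weight_def power_mult_distrib
      split: sum.split cong: if_cong)

lemma parabolic_scal: "z \<noteq> 0 \<Longrightarrow> parabolic (scal z)"
  unfolding parabolic_def Sp3_iff all_index2 all_index
  by (simp add: varpi_def column_def scal_entry sum_index power_inverse field_simps)

lemma scal_Sp3: "z \<noteq> 0 \<Longrightarrow> scal z \<in> Sp3"
  using parabolic_scal by (simp add: parabolic_def)

lemma matrix_inv_scal:
  assumes "z \<noteq> 0"
  shows "matrix_inv (scal z) = scal (inverse z)"
proof -
  have "symp_inv (scal z) = symp_inv (scal z) ** (scal z ** scal (inverse z))"
    using assms by (simp add: scal_mult scal_one)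
  also have "\<dots> = scal (inverse z)"
    by (simp add: matrix_mul_assoc symp_inv_left[OF scal_Sp3[OF assms]])
  finally show ?thesis by (simp add: matrix_inv_Sp3[OF scal_Sp3[OF assms]])
qed

definition scal_group :: "frame set" where
  "scal_group = scal ` (- {0})"

text \<open>Membership as polynomial equations in the entries, from which closedness
  follows.\<close>

lemma scal_group_iff:
  "g \<in> scal_group \<longleftrightarrow> (\<forall>a b. a \<noteq> b \<longrightarrow> g $ a $ b = 0) \<and> g $ E1 $ E1 * g $ F1 $ F1 = 1 \<and>
    g $ E2 $ E2 = g $ E1 $ E1 \<and> g $ F2 $ F2 = g $ F1 $ F1 \<and>
    g $ E0 $ E0 = g $ E1 $ E1 ^ 3 \<and> g $ F0 $ F0 = g $ F1 $ F1 ^ 3" (is "_ \<longleftrightarrow> ?R")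
proof
  assume "g \<in> scal_group"
  then show ?R by (auto simp: scal_group_def scal_entry)
next
  assume R: ?R
  then have inv: "g $ F1 $ F1 = inverse (g $ E1 $ E1)" and nz: "g $ E1 $ E1 \<noteq> 0"
    by (auto simp: inverse_unique)
  have diag: "\<forall>a. g $ a $ a = weight (g $ E1 $ E1) a"
    unfolding all_index2 all_index using R by (simp add: inv)
  have "g $ a $ b = scal (g $ E1 $ E1) $ a $ b" for a b
  proof (cases "a = b")
    case True
    then show ?thesis unfolding scal_entry if_P[OF True] using spec[OF diag, of b] by blast
  next
    case False
    then show ?thesis unfolding scal_entry if_not_P[OF False] using R by blast
  qed
  then have "g = scal (g $ E1 $ E1)" by (intro iffD2[OF vec_eq_iff] allI)
  then show "g \<in> scal_group" using nz unfolding scal_group_def by blast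
qed

lemma closed_scal_group: "closed scal_group"
proof -
  have "scal_group = {g. (\<forall>a b. a \<noteq> b \<longrightarrow> g $ a $ b = 0) \<and> g $ E1 $ E1 * g $ F1 $ F1 = 1 \<and>
    g $ E2 $ E2 = g $ E1 $ E1 \<and> g $ F2 $ F2 = g $ F1 $ F1 \<and>
    g $ E0 $ E0 = g $ E1 $ E1 ^ 3 \<and> g $ F0 $ F0 = g $ F1 $ F1 ^ 3}"
    using scal_group_iff by blast
  also have "closed \<dots>"
    by (intro closed_Collect_conj closed_Collect_all closed_Collect_imp closed_Collect_eq
        open_Collect_const continuous_intros)
  finally show ?thesis .
qed

lemma holo_weight:
  assumes "holo l D" "\<And>q. q \<in> D \<Longrightarrow> l q \<noteq> 0"
  shows "holo (\<lambda>q. weight (l q) a) D"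
  unfolding weight_def
  by (cases a) (auto intro!: holo_if holo_power holo_inverse assms)

lemma holo_scal:
  assumes "holo l D" "\<And>q. q \<in> D \<Longrightarrow> l q \<noteq> 0"
  shows "holo (\<lambda>q. scal (l q)) D"
  by (rule holo_frameI) (auto simp: scal_entry intro!: holo_if holo_weight holo_const assms holo_open[OF assms(1)])

text \<open>\<open>scal\<close> is a global chart with inverse the entry at \<open>E1\<close>,
  \<open>E1\<close>, so the whole matrix space serves as the neighbourhood \<open>W\<close> of every
  point.\<close>

lemma one_dim_scal_group: "one_dim_subgroup scal_group"
  unfolding one_dim_subgroup_def
proof (intro conjI ballI)
  show "scal_group \<subseteq> Sp3" by (auto simp: scal_group_def intro: scal_Sp3)
  show "closed scal_group" by (rule closed_scal_group)
  show "mat 1 \<in> scal_group" using imageI[of 1 "- {0}" scal] by (simp add: scal_group_def scal_one)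
  show "matrix_inv g \<in> scal_group" if "g \<in> scal_group" for g
    using that by (auto simp: scal_group_def matrix_inv_scal)
  show "g ** h \<in> scal_group" if "g \<in> scal_group" "h \<in> scal_group" for g h
    using that by (auto simp: scal_group_def scal_mult)
  fix g :: frame assume g: "g \<in> scal_group"
  have o: "open (- {0::complex})" by (simp add: open_Compl)
  have h: "holo scal (- {0})" by (rule holo_scal[OF holo_ident[OF o]]) simp
  have "diff_at scal z 1 \<noteq> 0" if "z \<in> - {0}" for z
  proof -
    have "diff_at scal z 1 $ E1 $ E1 = diff_at (\<lambda>z. z) z (1::complex)"
      using diff_at_entry[OF h that, of E1 E1 1] by (simp add: scal_entry)
    also have "\<dots> = 1" by (simp add: diff_at_eq[OF has_derivative_ident])
    finally show ?thesis by auto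
  qed
  moreover have "homeomorphism (- {0}) (scal_group \<inter> UNIV) scal (\<lambda>g. g $ E1 $ E1)"
    unfolding homeomorphism_def
  proof (intro conjI ballI)
    show "continuous_on (scal_group \<inter> UNIV) (\<lambda>g. g $ E1 $ E1)" by (intro continuous_intros)
    show "(\<lambda>g. g $ E1 $ E1) ` (scal_group \<inter> UNIV) = - {0}"
      by (force simp: scal_group_def scal_entry image_iff)
  qed (auto simp: scal_entry scal_group_def holo_continuous_on[OF h])
  ultimately show "\<exists>W (D :: complex set) k k'. open W \<and> g \<in> W \<and> holo k D \<and> (\<forall>z\<in>D. diff_at k z 1 \<noteq> 0) \<and>
      homeomorphism D (scal_group \<inter> W) k k'"
    using h g by (intro exI[of _ "UNIV :: frame set"] exI[of _ "- {0 :: complex}"] exI[of _ scal]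
        exI[of _ "\<lambda>g. g $ E1 $ E1"]) simp
qed

lemma bform_scal:
  assumes "F \<in> Sp3"
  shows "bform (F ** scal z) (A ** scal z + F ** g') u w =
    weight z u * weight z w * bform F A u w + (\<Sum>a\<in>UNIV. g' $ a $ u * weight z w * std a w)"
  unfolding bform_gauge[OF assms]
  by (simp add: scal_entry if_distrib[of "\<lambda>x. x * _"] if_distrib[of "(*) _"] cong: if_cong)


text \<open>The exponents of z in \<open>weight\<close>: for g = \<open>scal (l z)\<close>, the form
  g^-1 dg is dl/l times the diagonal matrix of these numbers.\<close>

definition weight_exponent :: "3 + 3 \<Rightarrow> complex" where
  "weight_exponent a = (case a of Inl i \<Rightarrow> if i = 0 then 3 else 1 | Inr i \<Rightarrow> if i = 0 then - 3 else - 1)"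

lemma weight_std: "z \<noteq> 0 \<Longrightarrow> weight z u * weight z w * std u w = std u w"
  by (cases u; cases w) (auto simp: weight_def power_inverse)

lemma weight_derivative:
  assumes "(l has_field_derivative k * l z) (at z)" "l z \<noteq> 0"
  shows "((\<lambda>z. weight (l z) a) has_field_derivative weight_exponent a * k * weight (l z) a) (at z)"
proof -
  have i: "((\<lambda>z. inverse (l z)) has_field_derivative - k * inverse (l z)) (at z)"
    using DERIV_inverse'[OF assms] assms(2) by (simp add: algebra_simps)
  have "((\<lambda>z. f z ^ 3) has_field_derivative 3 * c * f z ^ 3) (at z)"
    if "(f has_field_derivative c * f z) (at z)" for f :: "complex \<Rightarrow> complex" and c
    using DERIV_power[OF that, of 3] by (simp add: power3_eq_cube power2_eq_square algebra_simps numeral_2_eq_2)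
  from this[OF assms(1)] this[OF i] assms(1) i show ?thesis
    by (cases a) (auto simp: weight_def weight_exponent_def)
qed

lemma holo_has_field_derivative:
  fixes f :: "complex \<Rightarrow> complex"
  assumes "holo f D" "z \<in> D"
  shows "(f has_field_derivative diff_at f z 1) (at z)"
proof -
  have "diff_at f z = (*) (diff_at f z 1)"
  proof
    fix v
    have "diff_at f z (cscale v 1) = cscale v (diff_at f z 1)" by (rule holo_diff_cscale[OF assms])
    then show "diff_at f z v = diff_at f z 1 * v"
      unfolding cscale_complex mult_1_right by (simp only: mult.commute)
  qed
  from back_subst[where P = "\<lambda>D. (f has_derivative D) (at z)", OF holo_has_derivative[OF assms] this]
  show ?thesis unfolding has_field_derivative_def .
qed

section \<open>Forms and functions on the orbit of a normal section\<close>

context normal_frame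
begin

definition orbit :: "(surf \<times> frame) set" where
  "orbit = {(q, F). q \<in> N \<and> F \<in> {s q ** g |g. g \<in> scal_group}}"

text \<open>Recovers z from the frame \<open>s q ** scal z\<close> by pairing its e_1 with the f_1
  of the section. The formula makes sense for all frames over \<open>N\<close>, which provides the
  ambient holomorphic extension asked for in \<open>holo_fun_on\<close>.\<close>

definition fibre_coord :: "surf \<times> frame \<Rightarrow> complex" where
  "fibre_coord y = varpi (column E1 (snd y)) (column F1 (s (fst y)))"

text \<open>Extends a function on the surface to the bundle with degree -n in z.\<close>

definition homog :: "nat \<Rightarrow> (surf \<Rightarrow> complex) \<Rightarrow> surf \<times> frame \<Rightarrow> complex" where
  "homog n f y = f (fst y) * inverse (fibre_coord y) ^ n"

lemma orbitD:
  assumes "y \<in> orbit"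
  shows "fst y \<in> N" "fibre_coord y \<noteq> 0" "snd y = s (fst y) ** scal (fibre_coord y)"
proof -
  have "fst y \<in> N" "\<exists>g\<in>scal_group. snd y = s (fst y) ** g"
    using assms by (auto simp: orbit_def)
  then obtain z where y: "fst y \<in> N" "z \<noteq> 0" "snd y = s (fst y) ** scal z"
    by (auto simp: scal_group_def)
  have S: "s (fst y) \<in> Sp3" using y(1) holos(2) by auto
  have "fibre_coord y = z"
    by (simp add: fibre_coord_def y(3) column_mult varpi_sum_left varpi_scale_left Sp3_varpi[OF S] scal_entry
      if_distrib[of "\<lambda>x. x * _"] cong: if_cong)
  then show "fst y \<in> N" "fibre_coord y \<noteq> 0" "snd y = s (fst y) ** scal (fibre_coord y)"
    using y by auto
qed

lemma holo_fibre_coord: "holo fibre_coord (N \<times> UNIV)"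
proof -
  have o: "open (N \<times> (UNIV :: frame set))" using holos(5) by (simp add: open_Times)
  have s: "holo (\<lambda>y. s (fst y)) (N \<times> (UNIV :: frame set))"
    by (rule holo_compose[OF holos(1) holo_fst[OF o]]) auto
  show ?thesis
    unfolding fibre_coord_def varpi_def column_def vec_lambda_beta
    by (intro holo_sum holo_diff holo_mult holo_entry s holo_snd o)
qed

lemma holo_fun_on_homog:
  assumes "holo f N"
  shows "holo_fun_on orbit (homog n f)"
  unfolding holo_fun_on_def
proof
  fix y assume y: "y \<in> orbit"
  let ?W = "{y \<in> N \<times> UNIV. fibre_coord y \<noteq> 0}"
  have o: "open ?W" by (rule open_nonzero[OF holo_fibre_coord])
  have "holo (\<lambda>y. f (fst y)) ?W"
    by (rule holo_compose[OF assms holo_fst[OF o]]) auto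
  moreover have "holo fibre_coord ?W" by (rule holo_subset[OF holo_fibre_coord o]) auto
  ultimately have h: "holo (homog n f) ?W"
    unfolding homog_def by (intro holo_mult holo_power holo_inverse) auto
  have "y \<in> ?W" using orbitD[OF y] by (simp add: mem_Times_iff)
  then show "\<exists>W g. y \<in> W \<and> holo g W \<and> (\<forall>z\<in>orbit \<inter> W. homog n f z = g z)"
    by (intro exI[of _ ?W] exI[of _ "homog n f"] conjI ballI refl h)
qed

lemma reduction_orbit: "reduction N x scal_group orbit"
  unfolding reduction_def
proof (intro conjI ballI)
  show "orbit \<subseteq> frame_bundle N x"
  proof
    fix y assume y: "y \<in> orbit"
    note o = orbitD[OF y]
    have "snd y \<in> Sp3" unfolding o(3) using o(1) holos(2) by (intro Sp3_mult scal_Sp3 o(2)) auto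
    moreover have "frame_flag (snd y) = legendre_lift x (fst y)"
      unfolding o(3) frame_flag_parabolic[OF parabolic_scal[OF o(2)]] using ad o(1) by (simp add: adapted_def)
    ultimately show "y \<in> frame_bundle N x" using o(1) by (simp add: frame_bundle_def case_prod_unfold)
  qed
  fix p assume "p \<in> N"
  then show "\<exists>N' s. p \<in> N' \<and> N' \<subseteq> N \<and> holo s N' \<and>
      (\<forall>q\<in>N'. {F. (q, F) \<in> orbit} = {s q ** g |g. g \<in> scal_group})"
    using holos(1) by (intro exI[of _ N] exI[of _ s]) (simp add: orbit_def)
qed

text \<open>A disc in the orbit is (Q, s(Q) scal(l)). Three numbers describe its velocity:
  \<open>c\<close> and \<open>d\<close> are the components of Q' in \<open>V\<close> and
  \<open>W\<close>, and k = l'/l is the fibre direction. The group factor contributes only the term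
  with \<open>weight_exponent\<close>, free of z because \<open>std\<close> pairs only indices of
  inverse weights.\<close>

lemma disc_forms:
  assumes d: "disc_in orbit \<gamma>"
  obtains c d k where
    "fibre_coord (\<gamma> 0) \<noteq> 0" "\<gamma> 0 \<in> orbit"
    "\<And>u w. bform (snd (\<gamma> 0)) (snd (diff_at \<gamma> 0 1)) u w =
      weight (fibre_coord (\<gamma> 0)) u * weight (fibre_coord (\<gamma> 0)) w *
        (c * mcf s V u w (fst (\<gamma> 0)) + d * mcf s W u w (fst (\<gamma> 0))) + weight_exponent u * k * std u w"
    "\<And>f n. holo f N \<Longrightarrow> ((\<lambda>z. homog n f (\<gamma> z)) has_field_derivative
      (inverse (fibre_coord (\<gamma> 0)) ^ n * (c * diff_at f (fst (\<gamma> 0)) (V (fst (\<gamma> 0))) +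
        d * diff_at f (fst (\<gamma> 0)) (W (fst (\<gamma> 0)))) - of_nat n * k * homog n f (\<gamma> 0))) (at 0)"
proof -
  obtain r where r: "r > 0" and \<gamma>: "holo \<gamma> (ball 0 r)" "\<gamma> ` ball 0 r \<subseteq> orbit"
    using d by (auto simp: disc_in_def)
  let ?B = "ball (0::complex) r"
  have 0: "0 \<in> ?B" using r by simp
  have mem: "\<gamma> z \<in> orbit" if "z \<in> ?B" for z using \<gamma>(2) that by auto
  note o = orbitD[OF mem]
  define Q where "Q z = fst (\<gamma> z)" for z
  define l where "l z = fibre_coord (\<gamma> z)" for z
  have Q: "holo Q ?B" unfolding Q_def by (rule holo_compose[OF holo_fst[OF open_UNIV] \<gamma>(1)]) simp
  have l: "holo l ?B" unfolding l_def
    by (rule holo_compose[OF holo_fibre_coord \<gamma>(1) image_subsetI]) (simp add: o(1) mem_Times_iff)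
  have nz: "l z \<noteq> 0" and QN: "Q z \<in> N" and eq: "snd (\<gamma> z) = s (Q z) ** scal (l z)" if "z \<in> ?B" for z
    using o[OF that] by (simp_all add: l_def Q_def)
  have sQ: "holo (\<lambda>z. s (Q z)) ?B" by (rule holo_compose[OF holos(1) Q]) (use QN in auto)
  have sl: "holo (\<lambda>z. scal (l z)) ?B" by (rule holo_scal[OF l nz])
  define k where "k = diff_at l 0 1 / l 0"
  obtain c d where cd: "diff_at Q 0 1 = c *s V (Q 0) + d *s W (Q 0)"
    using ad QN[OF 0] unfolding adapted_def by meson
  have dl: "(l has_field_derivative k * l 0) (at 0)"
    using holo_has_field_derivative[OF l 0] nz[OF 0] by (simp add: k_def)
  have "snd (diff_at \<gamma> 0 1) = diff_at (\<lambda>z. snd (\<gamma> z)) 0 1"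
    using diff_at_compose[OF holo_snd[OF open_UNIV] \<gamma>(1) 0, of 1]
    by (simp add: diff_at_eq[OF bounded_linear_imp_has_derivative[OF bounded_linear_snd]])
  also have "\<dots> = diff_at (\<lambda>z. s (Q z) ** scal (l z)) 0 1"
    by (rule fun_cong[OF diff_at_cong[OF open_ball 0]]) (rule eq)
  also have "\<dots> = diff_at (\<lambda>z. s (Q z)) 0 1 ** scal (l 0) + s (Q 0) ** diff_at (\<lambda>z. scal (l z)) 0 1"
    by (simp add: diff_at_eq[OF has_derivative_matrix_mult[OF holo_has_derivative[OF sQ 0]
      holo_has_derivative[OF sl 0]]])
  also have "diff_at (\<lambda>z. s (Q z)) 0 1 = diff_at s (Q 0) (diff_at Q 0 1)"
    by (rule diff_at_compose[OF holos(1) Q 0 QN[OF 0]])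
  finally have F': "snd (diff_at \<gamma> 0 1) = diff_at s (Q 0) (diff_at Q 0 1) ** scal (l 0)
      + s (Q 0) ** diff_at (\<lambda>z. scal (l z)) 0 1" .
  have g': "diff_at (\<lambda>z. scal (l z)) 0 1 $ a $ u = (if a = u then weight_exponent u * k * weight (l 0) u else 0)" for a u
  proof -
    have "diff_at (\<lambda>z. scal (l z)) 0 1 $ a $ u = diff_at (\<lambda>z. if a = u then weight (l z) u else 0) 0 1"
      using diff_at_entry[OF sl 0, of a u 1] by (cases "a = u") (simp_all add: scal_entry)
    also have "\<dots> = (if a = u then weight_exponent u * k * weight (l 0) u else 0)"
      using diff_at_eq[OF weight_derivative[OF dl nz[OF 0], of u, unfolded has_field_derivative_def]] by simp
    finally show ?thesis .
  qed
  have S: "s (Q 0) \<in> Sp3" using QN[OF 0] holos(2) by auto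
  have \<beta>: "bform (s (Q 0)) (diff_at s (Q 0) (diff_at Q 0 1)) u w = c * mcf s V u w (Q 0) + d * mcf s W u w (Q 0)" for u w
    using mcf_linear[OF holos(1) QN[OF 0], of "\<lambda>_. c" V "\<lambda>_. d" W u w] by (simp add: mcf_def cd)
  show ?thesis
  proof (rule that[of c d k])
    show "fibre_coord (\<gamma> 0) \<noteq> 0" "\<gamma> 0 \<in> orbit" using o(2) mem 0 by auto
    fix u w
    have "bform (snd (\<gamma> 0)) (snd (diff_at \<gamma> 0 1)) u w =
        weight (l 0) u * weight (l 0) w * bform (s (Q 0)) (diff_at s (Q 0) (diff_at Q 0 1)) u w
        + weight_exponent u * k * (weight (l 0) u * weight (l 0) w * std u w)"
      unfolding F' eq[OF 0] bform_scal[OF S]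
      by (simp add: g' if_distrib[of "\<lambda>x. x * _"] cong: if_cong)
    also have "weight (l 0) u * weight (l 0) w * std u w = std u w"
      by (rule weight_std[OF nz[OF 0]])
    finally show "bform (snd (\<gamma> 0)) (snd (diff_at \<gamma> 0 1)) u w =
      weight (fibre_coord (\<gamma> 0)) u * weight (fibre_coord (\<gamma> 0)) w *
        (c * mcf s V u w (fst (\<gamma> 0)) + d * mcf s W u w (fst (\<gamma> 0))) + weight_exponent u * k * std u w"
      unfolding \<beta> by (simp add: l_def Q_def)
  next
    fix f :: "surf \<Rightarrow> complex" and n assume f: "holo f N"
    have fQ: "holo (\<lambda>z. f (Q z)) ?B" by (rule holo_compose[OF f Q]) (use QN in auto)
    have "diff_at (\<lambda>z. f (Q z)) 0 1 = c * diff_at f (Q 0) (V (Q 0)) + d * diff_at f (Q 0) (W (Q 0))"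
      unfolding diff_at_compose[OF f Q 0 QN[OF 0]] cd cscale_vector[symmetric]
        holo_diff_add[OF f QN[OF 0]] holo_diff_cscale[OF f QN[OF 0]] by simp
    then have df: "((\<lambda>z. f (Q z)) has_field_derivative
        c * diff_at f (Q 0) (V (Q 0)) + d * diff_at f (Q 0) (W (Q 0))) (at 0)"
      using holo_has_field_derivative[OF fQ 0] by simp
    have "((\<lambda>z. inverse (l z) ^ n) has_field_derivative - of_nat n * k * inverse (l 0) ^ n) (at 0)"
    proof (cases n)
      case (Suc m)
      have "((\<lambda>z. inverse (l z) ^ n) has_field_derivative
          of_nat n * (- (inverse (l 0) * (k * l 0) * inverse (l 0)) * inverse (l 0) ^ (n - Suc 0))) (at 0)"
        by (rule DERIV_power[OF DERIV_inverse'[OF dl nz[OF 0]]])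
      then show ?thesis using nz[OF 0] by (simp add: Suc algebra_simps)
    qed simp
    from DERIV_mult[OF df this]
    show "((\<lambda>z. homog n f (\<gamma> z)) has_field_derivative
      (inverse (fibre_coord (\<gamma> 0)) ^ n * (c * diff_at f (fst (\<gamma> 0)) (V (fst (\<gamma> 0))) +
        d * diff_at f (fst (\<gamma> 0)) (W (fst (\<gamma> 0)))) - of_nat n * k * homog n f (\<gamma> 0))) (at 0)"
      unfolding homog_def by (simp add: l_def Q_def algebra_simps)
  qed
qed

end

section \<open>Reading the cubic differential off a section\<close>

lemma maurer_cartan_entries:
  assumes "snd (\<gamma> 0) \<in> Sp3"
  shows "mc_omega \<gamma> i j = bform (snd (\<gamma> 0)) (snd (diff_at \<gamma> 0 1)) (Inl j) (Inr i)"
    "mc_eta \<gamma> i j = bform (snd (\<gamma> 0)) (snd (diff_at \<gamma> 0 1)) (Inr j) (Inr i)"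
    "mc_theta \<gamma> i j = - bform (snd (\<gamma> 0)) (snd (diff_at \<gamma> 0 1)) (Inl j) (Inl i)"
  by (simp_all add: mc_omega_def mc_eta_def mc_theta_def maurer_cartan_def matrix_inv_Sp3[OF assms]
      symp_inv_mult)

text \<open>The section composed with the complex line in direction \<open>v\<close>; it transfers
  conditions quantified over discs to the components along the section.\<close>

lemma section_disc:
  assumes ad: "adapted x s V W N" and N: "N \<subseteq> M" and p: "p \<in> N"
  obtains \<gamma> where "disc_in (frame_bundle M x) \<gamma>" "\<gamma> 0 = (p, s p)" "snd (diff_at \<gamma> 0 1) = diff_at s p v"
proof -
  have s: "holo s N" "s ` N \<subseteq> Sp3" using adapted_holo[OF ad] by auto
  define S where "S = (\<lambda>\<zeta>. p + cscale \<zeta> v) -` N"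
  have "open S" unfolding S_def
    using continuous_open_vimage[OF holo_open[OF s(1)]] holo_continuous_on[OF holo_line]
    by (metis continuous_on_eq_continuous_at open_UNIV UNIV_I)
  moreover have S0: "0 \<in> S" using p by (simp add: S_def)
  ultimately obtain r where r: "r > 0" "ball 0 r \<subseteq> S" using openE by blast
  define \<gamma> where "\<gamma> \<zeta> = (p + cscale \<zeta> v, s (p + cscale \<zeta> v))" for \<zeta>
  have lb: "holo (\<lambda>\<zeta>. p + cscale \<zeta> v) (ball 0 r)" by (rule holo_subset[OF holo_line]) auto
  have "holo (\<lambda>\<zeta>. s (p + cscale \<zeta> v)) (ball 0 r)"
    by (rule holo_compose[OF s(1) lb]) (use r(2) in \<open>auto simp: S_def\<close>)
  then have h: "holo \<gamma> (ball 0 r)" unfolding \<gamma>_def by (rule holo_Pair[OF lb])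
  have "\<gamma> ` ball 0 r \<subseteq> frame_bundle M x"
  proof (rule image_subsetI)
    fix \<zeta> :: complex assume "\<zeta> \<in> ball 0 r"
    then have "p + cscale \<zeta> v \<in> N" using r(2) by (auto simp: S_def)
    then show "\<gamma> \<zeta> \<in> frame_bundle M x"
      using ad N s(2) by (auto simp: \<gamma>_def frame_bundle_def adapted_def)
  qed
  then have "disc_in (frame_bundle M x) \<gamma>" unfolding disc_in_def using r(1) h by blast
  moreover have "snd (diff_at \<gamma> 0 1) = diff_at s p v"
  proof -
    have "(\<gamma> has_derivative (\<lambda>\<zeta>. (cscale \<zeta> v, diff_at s p (cscale \<zeta> v)))) (at 0)"
      unfolding \<gamma>_def
      by (intro has_derivative_Pair line_has_derivative, rule has_derivative_compose[OF line_has_derivative])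
        (simp add: holo_has_derivative[OF s(1) p])
    then have "diff_at \<gamma> 0 1 = (cscale 1 v, diff_at s p (cscale 1 v))" by (simp add: diff_at_eq)
    then show ?thesis by (simp add: cscale_vector)
  qed
  ultimately show ?thesis using that[of \<gamma>] by (simp add: \<gamma>_def)
qed

text \<open>Discs in the directions of \<open>V\<close> and \<open>W\<close> isolate the two terms
  of the sum, since these fields are dual to the coframe.\<close>

lemma cubic_coeffs_mcf:
  assumes ad: "adapted x s V W N" and N: "N \<subseteq> M" and p: "p \<in> N"
    and t: "cubic_coeffs M x (p, s p) t" and ij: "i \<in> {1, 2}" "j \<in> {1, 2}"
  shows "t i j 1 = - mcf s V (Inl j) (Inl i) p" "t i j 2 = - mcf s W (Inl j) (Inl i) p"
proof -
  interpret adapted_frame x s V W N by standard (rule ad)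
  have S: "s p \<in> Sp3" using p holos(2) by auto
  have e: "- bform (s p) (diff_at s p v) (Inl j) (Inl i) =
      t i j 1 * bform (s p) (diff_at s p v) E0 F1 + t i j 2 * bform (s p) (diff_at s p v) E0 F2" for v
  proof -
    obtain \<gamma> where \<gamma>: "disc_in (frame_bundle M x) \<gamma>" "\<gamma> 0 = (p, s p)"
      "snd (diff_at \<gamma> 0 1) = diff_at s p v" by (rule section_disc[OF ad N p])
    have "mc_theta \<gamma> i j = (\<Sum>k\<in>{1,2}. t i j k * mc_omega \<gamma> k 0)"
      using t ij \<gamma>(1,2) unfolding cubic_coeffs_def by blast
    then show ?thesis using S by (simp add: maurer_cartan_entries \<gamma>(2,3))
  qed
  show "t i j 1 = - mcf s V (Inl j) (Inl i) p"
    using e[of "V p"] contact(7,9)[OF p] by (simp add: mcf_def)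
  show "t i j 2 = - mcf s W (Inl j) (Inl i) p"
    using e[of "W p"] contact(8,10)[OF p] by (simp add: mcf_def)
qed

text \<open>If the determinant vanished, (m 1, l 1) and (m 2, l 2) would be coefficients of a
  proportionality, hence zero. Then both forms vanish and (1, 1) is a forbidden pair.\<close>

lemma not_proportional:
  assumes "\<not> proportional l m"
  shows "l 1 * m 2 - l 2 * m 1 \<noteq> 0"
proof
  assume d: "l 1 * m 2 - l 2 * m 1 = 0"
  have p: "\<alpha> = 0 \<and> \<beta> = 0" if "\<alpha> * l 1 = \<beta> * m 1" "\<alpha> * l 2 = \<beta> * m 2" for \<alpha> \<beta>
  proof (rule ccontr)
    assume "\<not> (\<alpha> = 0 \<and> \<beta> = 0)"
    moreover have "\<forall>y. \<alpha> * linear_form l y = \<beta> * linear_form m y"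
      using that by (simp add: linear_form_def distrib_left flip: mult.assoc)
    ultimately show False using assms unfolding proportional_def by blast
  qed
  have 1: "m 1 = 0 \<and> l 1 = 0" by (rule p) (use d in \<open>simp_all add: mult.commute\<close>)
  have 2: "m 2 = 0 \<and> l 2 = 0" by (rule p) (use d in \<open>simp_all add: mult.commute\<close>)
  have "(1::complex) = 0 \<and> (1::complex) = 0" by (rule p) (simp_all add: 1 2)
  then show False by simp
qed

lemma normal_frame_at:
  assumes im: "immersed_legendrian M x" and nd: "nondegenerate M x" and p: "p \<in> M"
  obtains N s V W where "p \<in> N" "N \<subseteq> M" "normal_frame x s V W N"
proof -
  obtain F t where F: "(p, F) \<in> frame_bundle M x" "cubic_coeffs M x (p, F) t" "generic_cubic (cubic_form t)"
    using nd p unfolding nondegenerate_def by blast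
  obtain N s V W where N: "p \<in> N" "N \<subseteq> M" "adapted x s V W N" "s p = F"
    by (rule initial_section[OF im p F(1)])
  interpret adapted_frame x s V W N by standard (rule N(3))
  obtain l m n where lmn: "\<And>y. cubic_form t y = linear_form l y * linear_form m y * linear_form n y"
    "\<not> proportional l m" "\<not> proportional l n" "\<not> proportional m n"
    using F(3) unfolding generic_cubic_def by blast
  note t = cubic_coeffs_mcf[OF N(3,2,1) F(2)[folded N(4)]]
  note cs = cubic_sym[OF N(3,1)]
  \<comment> \<open>The cubic in theta is minus the cubic in \<open>mcf\<close>; the sign is put
    into the first linear factor.\<close>
  have fac: "mcf s V E1 E1 p * y ^ 3 + 3 * mcf s V E1 E2 p * y ^ 2 * z + 3 * mcf s V E2 E2 p * y * z ^ 2
      + mcf s W E2 E2 p * z ^ 3 = ((- l 1) * y + (- l 2) * z) * (m 1 * y + m 2 * z) * (n 1 * y + n 2 * z)" for y z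
    using lmn(1)[of "\<lambda>i. if i = 1 then y else z"]
    by (simp add: cubic_form_def linear_form_def t sym[OF N(1)] cs power2_eq_square power3_eq_cube)
      (simp add: algebra_simps; algebra)
  have np: "(- l 1) * m 2 - (- l 2) * m 1 \<noteq> 0" "(- l 1) * n 2 - (- l 2) * n 1 \<noteq> 0" "m 1 * n 2 - m 2 * n 1 \<noteq> 0"
    using lmn(2-4)[THEN not_proportional] by simp_all
  obtain N' s' V' W' where "p \<in> N'" "N' \<subseteq> N" "normal_frame x s' V' W' N'"
    by (rule normal_frame_exists[OF N(3,1) fac np])
  then show ?thesis using that N(2) by blast
qed

section \<open>Equations on the reduced bundle\<close>

context normal_frame
begin

text \<open>The values eta_11(W), eta_12(V), eta_12(W), eta_22(V); the final branch serves index
  4.\<close>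

definition acoef :: "nat \<Rightarrow> surf \<Rightarrow> complex" where
  "acoef i = (if i = 1 then mcf s W F1 F1 else if i = 2 then mcf s V F1 F2 else if i = 3 then mcf s W F1 F2
    else mcf s V F2 F2)"

definition bcoef :: "nat \<Rightarrow> surf \<Rightarrow> complex" where
  "bcoef i = (if i = 1 then mcf s V F0 F1 else if i = 2 then mcf s W F0 F1 else mcf s V F0 F2)"

definition ccoef :: "nat \<Rightarrow> surf \<Rightarrow> complex" where
  "ccoef i = (if i = 1 then mcf s V F0 F0 else mcf s W F0 F0)"

definition dual_field :: "nat \<Rightarrow> surf \<Rightarrow> surf" where
  "dual_field k = (if k = 1 then V else W)"

lemma holo_coef: "holo (acoef i) N" "holo (bcoef i) N" "holo (ccoef i) N"
  by (simp_all add: acoef_def bcoef_def ccoef_def holo_mcf holos)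

lemma holo_cov:
  assumes f: "holo f N"
  shows "holo (cov f (dual_field k) r) N"
proof -
  have V: "holo (dual_field k) N" by (simp add: dual_field_def holos)
  show ?thesis
    unfolding cov_def[abs_def]
    by (intro holo_add holo_mult holo_const holo_mcf holo_diff_at f V holos)
qed

text \<open>The first claim holds because both sides of each equation have the same degree in z. In
  the second, motion in the fibre changes a function of degree -n by -n k times itself and
  contributes 3 k to omega_00, whence n = 3 r. The covariant derivatives have degree -(n + 2) to
  compensate the factor z^2 of omega^1 and omega^2.\<close>

lemma disc_equations:
  assumes d: "disc_in orbit \<gamma>"
  shows "let y = \<gamma> 0; \<omega> = mc_omega \<gamma>; \<eta> = mc_eta \<gamma>; \<theta> = mc_theta \<gamma>; \<omega>1 = \<omega> 1 0; \<omega>2 = \<omega> 2 0;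
      a = \<lambda>i. homog 4 (acoef i); b = \<lambda>i. homog 6 (bcoef i); c = \<lambda>i. homog 8 (ccoef i) in
    \<theta> 0 0 = 0 \<and> \<theta> 1 0 = 0 \<and> \<theta> 2 0 = 0 \<and> \<theta> 1 1 = \<omega>2 \<and> \<theta> 1 2 = \<omega>1 + \<omega>2 \<and> \<theta> 2 2 = \<omega>1 \<and>
    (\<forall>i\<in>{1,2}. \<forall>j\<in>{1,2}. \<omega> i j = (if i = j then 1/3 else 0) * \<omega> 0 0) \<and>
    \<omega> 0 1 = (a 2 y + a 4 y) * \<omega>1 + 3/5 * (a 3 y - a 2 y) * \<omega>2 \<and>
    \<omega> 0 2 = 3/5 * (a 2 y - a 3 y) * \<omega>1 + (a 1 y + a 3 y) * \<omega>2 \<and>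
    \<eta> 1 1 = a 1 y * \<omega>2 \<and> \<eta> 1 2 = a 2 y * \<omega>1 + a 3 y * \<omega>2 \<and> \<eta> 2 2 = a 4 y * \<omega>1 \<and>
    \<eta> 1 0 = b 1 y * \<omega>1 + b 2 y * \<omega>2 \<and> \<eta> 2 0 = b 3 y * \<omega>1 - b 1 y * \<omega>2 \<and>
    \<eta> 0 0 = c 1 y * \<omega>1 + c 2 y * \<omega>2" (is ?forms)
    and "holo f N \<Longrightarrow> of_nat n = 3 * r \<Longrightarrow> ((\<lambda>z. homog n f (\<gamma> z)) has_field_derivative
      - r * homog n f (\<gamma> 0) * mc_omega \<gamma> 0 0 + homog (n + 2) (cov f (dual_field 1) r) (\<gamma> 0) * mc_omega \<gamma> 1 0
      + homog (n + 2) (cov f (dual_field 2) r) (\<gamma> 0) * mc_omega \<gamma> 2 0) (at 0)"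
proof -
  obtain c d k where z: "fibre_coord (\<gamma> 0) \<noteq> 0" and mem: "\<gamma> 0 \<in> orbit"
    and \<beta>: "\<And>u w. bform (snd (\<gamma> 0)) (snd (diff_at \<gamma> 0 1)) u w =
      weight (fibre_coord (\<gamma> 0)) u * weight (fibre_coord (\<gamma> 0)) w *
        (c * mcf s V u w (fst (\<gamma> 0)) + d * mcf s W u w (fst (\<gamma> 0))) + weight_exponent u * k * std u w"
    and der: "\<And>f n. holo f N \<Longrightarrow> ((\<lambda>z. homog n f (\<gamma> z)) has_field_derivative
      (inverse (fibre_coord (\<gamma> 0)) ^ n * (c * diff_at f (fst (\<gamma> 0)) (V (fst (\<gamma> 0))) +
        d * diff_at f (fst (\<gamma> 0)) (W (fst (\<gamma> 0)))) - of_nat n * k * homog n f (\<gamma> 0))) (at 0)"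
    by (rule disc_forms[OF d]) (rule that)
  note o = orbitD[OF mem]
  have S: "snd (\<gamma> 0) \<in> Sp3"
    unfolding o(3) using o(1) holos(2) by (intro Sp3_mult scal_Sp3 z) auto
  define q where "q = fst (\<gamma> 0)"
  define t where "t = inverse (fibre_coord (\<gamma> 0))"
  define u where "u = fibre_coord (\<gamma> 0)"
  have ut: "u * t = 1" using z by (simp add: u_def t_def)
  have it: "inverse u = t" by (simp add: u_def t_def)
  have q: "q \<in> N" using o(1) by (simp add: q_def)
  note \<beta>' = \<beta>[folded q_def u_def]
  note m = maurer_cartan_entries[of \<gamma>, OF S] \<beta>' it weight_exponent_def q
  have w: "mc_omega \<gamma> 1 0 = u ^ 3 * t * c" "mc_omega \<gamma> 2 0 = u ^ 3 * t * d"
    "mc_omega \<gamma> 0 0 = c * mcf s V E0 F0 q + d * mcf s W E0 F0 q + 3 * k"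
    using ut by (simp_all add: m flip: power_mult_distrib)
  have h: "homog n f (\<gamma> 0) = f q * t ^ n" for n f by (simp add: homog_def q_def t_def)
  have tnz: "t \<noteq> 0" and u1: "u = 1 / t" using z by (simp_all add: t_def u_def divide_inverse)
  note s = m norms[OF q] omega_0j[OF q] acoef_def bcoef_def ccoef_def u1 field_simps power_numeral_reduce
  show ?forms
    unfolding Let_def w h
  proof (intro conjI ballI)
    show "mc_omega \<gamma> i j = (if i = j then 1 / 3 else 0) * (c * mcf s V E0 F0 q + d * mcf s W E0 F0 q + 3 * k)"
      if "i \<in> {1, 2}" "j \<in> {1, 2}" for i j
      using that tnz by (auto simp: s)
  qed (use tnz in \<open>simp_all add: s\<close>)
  show "((\<lambda>z. homog n f (\<gamma> z)) has_field_derivative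
      - r * homog n f (\<gamma> 0) * mc_omega \<gamma> 0 0 + homog (n + 2) (cov f (dual_field 1) r) (\<gamma> 0) * mc_omega \<gamma> 1 0
      + homog (n + 2) (cov f (dual_field 2) r) (\<gamma> 0) * mc_omega \<gamma> 2 0) (at 0)"
    if f: "holo f N" and r: "of_nat n = 3 * r"
  proof -
    have ut2: "t ^ (n + 2) * (u ^ 3 * t * e) = t ^ n * e" for e
    proof -
      have "t ^ (n + 2) * (u ^ 3 * t * e) = t ^ n * e * (u * t) ^ 3"
        by (simp add: power_add power2_eq_square power3_eq_cube)
      then show ?thesis by (simp add: ut)
    qed
    have "inverse (fibre_coord (\<gamma> 0)) ^ n * (c * diff_at f (fst (\<gamma> 0)) (V (fst (\<gamma> 0))) +
        d * diff_at f (fst (\<gamma> 0)) (W (fst (\<gamma> 0)))) - of_nat n * k * homog n f (\<gamma> 0) =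
      - r * homog n f (\<gamma> 0) * mc_omega \<gamma> 0 0 + homog (n + 2) (cov f (dual_field 1) r) (\<gamma> 0) * mc_omega \<gamma> 1 0
      + homog (n + 2) (cov f (dual_field 2) r) (\<gamma> 0) * mc_omega \<gamma> 2 0"
      unfolding w h r mult.assoc[of _ "t ^ (n + 2)"] ut2
      by (simp add: cov_def dual_field_def flip: t_def q_def) (simp add: algebra_simps)
    then show ?thesis using der[OF f, of n] by simp
  qed
qed

text \<open>Each relation is homogeneous, of degree -6, -8 or -10 in z, so its validity on the
  section extends to the bundle.\<close>

lemma orbit_relations:
  assumes "y \<in> orbit"
  defines "a \<equiv> \<lambda>i. homog 4 (acoef i)" and "b \<equiv> \<lambda>i. homog 6 (bcoef i)" and "c \<equiv> \<lambda>i. homog 8 (ccoef i)"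
    and "a' \<equiv> \<lambda>i k. homog 6 (cov (acoef i) (dual_field k) (4/3))"
    and "b' \<equiv> \<lambda>i k. homog 8 (cov (bcoef i) (dual_field k) 2)"
    and "c' \<equiv> \<lambda>i k. homog 10 (cov (ccoef i) (dual_field k) (8/3))"
  shows "a' 1 1 y = - 2 * b 2 y \<and>
          a' 2 2 y = - (3/2) * a' 2 1 y + 15/2 * b 3 y + 8 * b 1 y \<and>
          a' 3 1 y = - (3/2) * a' 2 1 y + 15/2 * b 3 y + 10 * b 1 y \<and>
          a' 3 2 y = a' 2 1 y + 5 * b 2 y - 12 * b 1 y - 5 * b 3 y \<and>
          a' 4 2 y = - 2 * b 3 y \<and>
          b' 1 2 y = b' 2 1 y - 3/5 * (a 3 y)\<^sup>2 + c 2 y + a 4 y * a 1 y - 2/5 * a 2 y * a 3 y \<and>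
          b' 3 2 y = - b' 1 1 y - c 1 y + 3/5 * (a 2 y)\<^sup>2 + 2/5 * a 2 y * a 3 y - a 4 y * a 1 y \<and>
          c' 1 2 y = c' 2 1 y - 2 * a 1 y * b 3 y - 2 * a 3 y * b 3 y + 2 * a 2 y * b 2 y
                     + 2 * a 4 y * b 2 y"
proof -
  have q: "fst y \<in> N" using orbitD[OF assms(1)] by simp
  note d = a_def b_def c_def a'_def b'_def c'_def homog_def acoef_def bcoef_def ccoef_def dual_field_def
  note r = relations[OF q]
  obtain t where t: "inverse (fibre_coord y) = t" by blast
  show ?thesis
    by (intro conjI; simp add: d r t; algebra)
qed

end

theorem proposition2p22:
  fixes M :: "(complex ^ 2) set" and x :: "complex ^ 2 \<Rightarrow> (complex ^ (3 + 3)) set"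
  assumes "immersed_legendrian M x" and "nondegenerate M x"
  shows "\<forall>p\<in>M. \<exists>U. open U \<and> p \<in> U \<and> U \<subseteq> M \<and>
    (\<exists>G B. one_dim_subgroup G \<and> reduction U x G B \<and>
     (\<exists>(a :: nat \<Rightarrow> surf \<times> frame \<Rightarrow> complex) (b :: nat \<Rightarrow> surf \<times> frame \<Rightarrow> complex)
       (c :: nat \<Rightarrow> surf \<times> frame \<Rightarrow> complex)
       (a' :: nat \<Rightarrow> nat \<Rightarrow> surf \<times> frame \<Rightarrow> complex)
       (b' :: nat \<Rightarrow> nat \<Rightarrow> surf \<times> frame \<Rightarrow> complex)
       (c' :: nat \<Rightarrow> nat \<Rightarrow> surf \<times> frame \<Rightarrow> complex).
      (\<forall>i\<in>{1..4}. holo_fun_on B (a i) \<and> (\<forall>k\<in>{1,2}. holo_fun_on B (a' i k))) \<and>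
      (\<forall>i\<in>{1..3}. holo_fun_on B (b i) \<and> (\<forall>k\<in>{1,2}. holo_fun_on B (b' i k))) \<and>
      (\<forall>i\<in>{1..2}. holo_fun_on B (c i) \<and> (\<forall>k\<in>{1,2}. holo_fun_on B (c' i k))) \<and>
      (\<forall>\<gamma>. disc_in B \<gamma> \<longrightarrow>
        (let y = \<gamma> 0; \<omega> = mc_omega \<gamma>; \<eta> = mc_eta \<gamma>; \<theta> = mc_theta \<gamma>;
             \<omega>1 = \<omega> 1 0; \<omega>2 = \<omega> 2 0
         in
          \<theta> 0 0 = 0 \<and> \<theta> 1 0 = 0 \<and> \<theta> 2 0 = 0 \<and>
          \<theta> 1 1 = \<omega>2 \<and> \<theta> 1 2 = \<omega>1 + \<omega>2 \<and> \<theta> 2 2 = \<omega>1 \<and>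
          (\<forall>i\<in>{1,2}. \<forall>j\<in>{1,2}. \<omega> i j = (if i = j then 1/3 else 0) * \<omega> 0 0) \<and>
          \<omega> 0 1 = (a 2 y + a 4 y) * \<omega>1 + 3/5 * (a 3 y - a 2 y) * \<omega>2 \<and>
          \<omega> 0 2 = 3/5 * (a 2 y - a 3 y) * \<omega>1 + (a 1 y + a 3 y) * \<omega>2 \<and>
          \<eta> 1 1 = a 1 y * \<omega>2 \<and>
          \<eta> 1 2 = a 2 y * \<omega>1 + a 3 y * \<omega>2 \<and>
          \<eta> 2 2 = a 4 y * \<omega>1 \<and>
          \<eta> 1 0 = b 1 y * \<omega>1 + b 2 y * \<omega>2 \<and>
          \<eta> 2 0 = b 3 y * \<omega>1 - b 1 y * \<omega>2 \<and>
          \<eta> 0 0 = c 1 y * \<omega>1 + c 2 y * \<omega>2 \<and>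
          (\<forall>i\<in>{1..4}. ((\<lambda>z. a i (\<gamma> z)) has_field_derivative
             (- (4/3) * a i y * \<omega> 0 0 + a' i 1 y * \<omega>1 + a' i 2 y * \<omega>2)) (at 0)) \<and>
          (\<forall>i\<in>{1..3}. ((\<lambda>z. b i (\<gamma> z)) has_field_derivative
             (- 2 * b i y * \<omega> 0 0 + b' i 1 y * \<omega>1 + b' i 2 y * \<omega>2)) (at 0)) \<and>
          (\<forall>i\<in>{1..2}. ((\<lambda>z. c i (\<gamma> z)) has_field_derivative
             (- (8/3) * c i y * \<omega> 0 0 + c' i 1 y * \<omega>1 + c' i 2 y * \<omega>2)) (at 0)))) \<and>
      (\<forall>y\<in>B.
          a' 1 1 y = - 2 * b 2 y \<and>
          a' 2 2 y = - (3/2) * a' 2 1 y + 15/2 * b 3 y + 8 * b 1 y \<and>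
          a' 3 1 y = - (3/2) * a' 2 1 y + 15/2 * b 3 y + 10 * b 1 y \<and>
          a' 3 2 y = a' 2 1 y + 5 * b 2 y - 12 * b 1 y - 5 * b 3 y \<and>
          a' 4 2 y = - 2 * b 3 y \<and>
          b' 1 2 y = b' 2 1 y - 3/5 * (a 3 y)\<^sup>2 + c 2 y + a 4 y * a 1 y - 2/5 * a 2 y * a 3 y \<and>
          b' 3 2 y = - b' 1 1 y - c 1 y + 3/5 * (a 2 y)\<^sup>2 + 2/5 * a 2 y * a 3 y - a 4 y * a 1 y \<and>
          c' 1 2 y = c' 2 1 y - 2 * a 1 y * b 3 y - 2 * a 3 y * b 3 y + 2 * a 2 y * b 2 y
                     + 2 * a 4 y * b 2 y)))"
proof (rule ballI, erule normal_frame_at[OF assms], goal_cases)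
  case (1 p N s V W)
  interpret normal_frame x s V W N by (rule 1(3))
  let ?a = "\<lambda>i. homog 4 (acoef i)" and ?b = "\<lambda>i. homog 6 (bcoef i)" and ?c = "\<lambda>i. homog 8 (ccoef i)"
  let ?a' = "\<lambda>i k. homog 6 (cov (acoef i) (dual_field k) (4/3))"
  let ?b' = "\<lambda>i k. homog 8 (cov (bcoef i) (dual_field k) 2)"
  let ?c' = "\<lambda>i k. homog 10 (cov (ccoef i) (dual_field k) (8/3))"
  note hol = holo_fun_on_homog[OF holo_coef(1)] holo_fun_on_homog[OF holo_coef(2)]
    holo_fun_on_homog[OF holo_coef(3)] holo_fun_on_homog[OF holo_cov[OF holo_coef(1)]]
    holo_fun_on_homog[OF holo_cov[OF holo_coef(2)]] holo_fun_on_homog[OF holo_cov[OF holo_coef(3)]]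
  show ?case
  proof (rule exI[of _ N], intro conjI holos(5) 1(1,2), rule exI[of _ scal_group], rule exI[of _ orbit],
      intro conjI one_dim_scal_group reduction_orbit,
      rule exI[of _ ?a], rule exI[of _ ?b], rule exI[of _ ?c],
      rule exI[of _ ?a'], rule exI[of _ ?b'], rule exI[of _ ?c'],
      rule conjI[rotated], rule conjI[rotated], rule conjI[rotated], rule conjI[rotated], goal_cases)
    case 1
    show ?case by (intro ballI orbit_relations)
  next
    case 2
    show ?case
    proof (intro allI impI, goal_cases)
      case (1 \<gamma>)
      note e = disc_equations(1)[OF 1, unfolded Let_def]
      note der = disc_equations(2)[OF 1]
      have "\<forall>i\<in>{1..4}. ((\<lambda>z. ?a i (\<gamma> z)) has_field_derivative - (4/3) * ?a i (\<gamma> 0) * mc_omega \<gamma> 0 0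
          + ?a' i 1 (\<gamma> 0) * mc_omega \<gamma> 1 0 + ?a' i 2 (\<gamma> 0) * mc_omega \<gamma> 2 0) (at 0)"
        using der[OF holo_coef(1), of 4 "4/3"] by simp
      moreover have "\<forall>i\<in>{1..3}. ((\<lambda>z. ?b i (\<gamma> z)) has_field_derivative - 2 * ?b i (\<gamma> 0) * mc_omega \<gamma> 0 0
          + ?b' i 1 (\<gamma> 0) * mc_omega \<gamma> 1 0 + ?b' i 2 (\<gamma> 0) * mc_omega \<gamma> 2 0) (at 0)"
        using der[OF holo_coef(2), of 6 2] by simp
      moreover have "\<forall>i\<in>{1..2}. ((\<lambda>z. ?c i (\<gamma> z)) has_field_derivative - (8/3) * ?c i (\<gamma> 0) * mc_omega \<gamma> 0 0
          + ?c' i 1 (\<gamma> 0) * mc_omega \<gamma> 1 0 + ?c' i 2 (\<gamma> 0) * mc_omega \<gamma> 2 0) (at 0)"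
        using der[OF holo_coef(3), of 8 "8/3"] by simp
      ultimately show ?case
        unfolding Let_def using e by (elim conjE, intro conjI) assumption+
    qed
  qed (intro ballI conjI hol)+
qed

end
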